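(* Let $G$ be a Lie group and $(A,\rho_A)$ a smooth $G$-module. For each $f\in Z^2_{ss}(G,A)$ the group $A\times_f G$ carries the structure of a Lie group such that the map $q: A\times_f G\to G$, $(a,g)\mapsto g$, is a Lie group extension of $G$ by the smooth $G$-module $A$. Conversely, every Lie group extension of $G$ by the smooth $G$-module $A$ is equivalent to one of this form. The assignment $$Z^2_{ss}(G,A)\to \mathrm{Ext}_{\rho_A}(G,A),\qquad f\mapsto [A\times_f G]$$ factors through a bijection $H^2_{ss}(G,A)\to \mathrm{Ext}_{\rho_A}(G,A)$. If $G$ is connected, then $Z^2_{ss}(G,A)=Z^2_s(G,A)$, and we obtain a bijection $H^2_s(G,A)\to\mathrm{Ext}_{\rho_A}(G,A)$.
   Context: A Lie group is a group that is a smooth manifold modeled on a (Hausdorff, not necessarily complete) locally convex space with smooth group operations; smoothness is in the following sense: $f:U\subseteq X\to Y$ is $C^1$ if it is continuous, all directional derivatives $df(x)(h)$ exist and $df:U\times X\to Y$ is continuous; $C^n$ if it is $C^1$ and $df$ is $C^{n-1}$; smooth if $C^n$ for all $n$. Abelian groups are written additively. A smooth $G$-module $(A,\rho_A)$ is an abelian Lie group $A$ with a smooth action $\rho_A:G\times A\to A$ by group automorphisms. $C^n_s(G,A)$ is the group of functions $f:G^n\to A$ that are smooth in an identity neighborhood and vanish on tuples in which some entry is $\mathbf 1$. The differential is $(d_Gf)(g_0,\dots,g_n)=g_0.f(g_1,\dots,g_n)+\sum_{j=1}^n(-1)^jf(g_0,\dots,g_{j-1}g_j,\dots,g_n)+(-1)^{n+1}f(g_0,\dots,g_{n-1})$.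 $Z^n_s,B^n_s,H^n_s=Z^n_s/B^n_s$ denote cocycles, coboundaries and cohomology. For $f\in Z^2_s(G,A)$ and $g\in G$ put $f_g(g'):=f(g,g')-f(gg'g^{-1},g)$. Then $Z^2_{ss}(G,A):=\{f\in Z^2_s(G,A): f_g\in C^1_s(G,A)\text{ for all }g\in G\}$; it contains $B^2_s(G,A)$, and $H^2_{ss}(G,A):=Z^2_{ss}(G,A)/B^2_s(G,A)$. For $f\in Z^2_s(G,A)$, $A\times_fG$ is the set $A\times G$ with the group multiplication $(a,g)(a',g')=(a+g.a'+f(g,g'),gg')$. An extension of Lie groups is a surjective morphism of Lie groups $q:\hat G\to G$ with a smooth local section for which $N:=\ker q$ has a natural Lie group structure such that $N\times\hat G\to\hat G$, $(n,g)\mapsto ng$, is smooth (so $\hat G$ is a smooth principal $N$-bundle over $G$). Two extensions $\hat G_1,\hat G_2$ of $G$ by $N$ are equivalent if there is a Lie group morphism $\varphi:\hat G_1\to\hat G_2$ inducing the identity on $N$ and on $G$. An extension of $G$ by the smooth $G$-module $A$ is an extension with kernel $A$ for which the action of $G$ on $A$ induced by conjugation in $\hat G$ is $\rho_A$; $\mathrm{Ext}_{\rho_A}(G,A)$ is the set of equivalence classes of these. *)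

theory Defs
  imports "HOL-Analysis.Analysis" "HOL-Algebra.Coset" "HOL-Algebra.Bij"
begin

section \<open>Locally convex spaces\<close>

text \<open>Real Hausdorff locally convex spaces; no completeness is assumed.\<close>

class lcs = real_vector + topological_ab_group_add + t2_space +
  assumes tendsto_scaleR_Pair:
    "filterlim (\<lambda>z. fst z *\<^sub>R snd z) (nhds (c *\<^sub>R x)) (nhds c \<times>\<^sub>F nhds x)"
  and convex_nhds: "open U \<Longrightarrow> 0 \<in> U \<Longrightarrow>
    \<exists>V. open V \<and> 0 \<in> V \<and> V \<subseteq> U \<and>
      (\<forall>x\<in>V. \<forall>y\<in>V. \<forall>u\<ge>0. \<forall>v\<ge>0. u + v = 1 \<longrightarrow> u *\<^sub>R x + v *\<^sub>R y \<in> V)"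

instance real_normed_vector \<subseteq> lcs
proof
  fix c :: real and x :: 'a
  show "filterlim (\<lambda>z. fst z *\<^sub>R snd z) (nhds (c *\<^sub>R x)) (nhds c \<times>\<^sub>F nhds x)"
    unfolding nhds_prod[symmetric]
    using tendsto_scaleR[OF tendsto_fst[OF filterlim_ident, of "(c, x)"]
        tendsto_snd[OF filterlim_ident, of "(c, x)"]]
    by simp
next
  fix U :: "'a set" assume "open U" "0 \<in> U"
  then obtain e where "e > 0" "ball 0 e \<subseteq> U"
    by (meson open_contains_ball)
  then show "\<exists>V. open V \<and> 0 \<in> V \<and> V \<subseteq> U \<and>
      (\<forall>x\<in>V. \<forall>y\<in>V. \<forall>u\<ge>0. \<forall>v\<ge>0. u + v = 1 \<longrightarrow> u *\<^sub>R x + v *\<^sub>R y \<in> V)"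
    using convex_ball[of "0::'a" e] unfolding convex_def
    by (intro exI[of _ "ball 0 e"]) auto
qed

instance prod :: (topological_monoid_add, topological_monoid_add) topological_monoid_add
proof
  fix a b :: "'a \<times> 'b"
  have "((\<lambda>z. (fst (fst z) + fst (snd z), snd (fst z) + snd (snd z)))
      \<longlongrightarrow> (fst a + fst b, snd a + snd b)) (nhds (a, b))"
    by (intro tendsto_Pair tendsto_add
        tendsto_fst[OF tendsto_fst[OF filterlim_ident, of "(a, b)"], simplified]
        tendsto_fst[OF tendsto_snd[OF filterlim_ident, of "(a, b)"], simplified]
        tendsto_snd[OF tendsto_fst[OF filterlim_ident, of "(a, b)"], simplified]
        tendsto_snd[OF tendsto_snd[OF filterlim_ident, of "(a, b)"], simplified])
  then show "filterlim (\<lambda>z. fst z + snd z) (nhds (a + b)) (nhds a \<times>\<^sub>F nhds b)"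
    by (simp add: nhds_prod[symmetric] plus_prod_def)
qed

instance prod :: (topological_group_add, topological_group_add) topological_group_add
proof
  fix a :: "'a \<times> 'b"
  have "((\<lambda>z. (- fst z, - snd z)) \<longlongrightarrow> (- fst a, - snd a)) (nhds a)"
    by (intro tendsto_Pair tendsto_minus
        tendsto_fst[OF filterlim_ident] tendsto_snd[OF filterlim_ident])
  moreover have "uminus = (\<lambda>z :: 'a \<times> 'b. (- fst z, - snd z))"
    by (simp add: fun_eq_iff uminus_prod_def)
  ultimately show "(uminus \<longlongrightarrow> - a) (nhds a)"
    by (simp add: uminus_prod_def)
qed

instance prod :: (topological_comm_monoid_add, topological_comm_monoid_add)
  topological_comm_monoid_add ..

instance prod :: (topological_ab_group_add, topological_ab_group_add)
  topological_ab_group_add ..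

instance prod :: (lcs, lcs) lcs
proof
  fix c :: real and x :: "'a \<times> 'b"
  have 1: "((\<lambda>z. (fst z, fst (snd z))) \<longlongrightarrow> (c, fst x)) (nhds (c, x))"
    by (intro tendsto_Pair tendsto_fst[OF filterlim_ident, of "(c, x)", simplified]
        tendsto_fst[OF tendsto_snd[OF filterlim_ident, of "(c, x)"], simplified])
  have 2: "((\<lambda>z. (fst z, snd (snd z))) \<longlongrightarrow> (c, snd x)) (nhds (c, x))"
    by (intro tendsto_Pair tendsto_fst[OF filterlim_ident, of "(c, x)", simplified]
        tendsto_snd[OF tendsto_snd[OF filterlim_ident, of "(c, x)"], simplified])
  have "((\<lambda>z. (fst z *\<^sub>R fst (snd z), fst z *\<^sub>R snd (snd z)))
      \<longlongrightarrow> (c *\<^sub>R fst x, c *\<^sub>R snd x)) (nhds (c, x))"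
    using filterlim_compose[OF tendsto_scaleR_Pair 1[unfolded nhds_prod]]
      filterlim_compose[OF tendsto_scaleR_Pair 2[unfolded nhds_prod]]
    by (intro tendsto_Pair) (simp_all add: nhds_prod)
  then show "filterlim (\<lambda>z. fst z *\<^sub>R snd z) (nhds (c *\<^sub>R x)) (nhds c \<times>\<^sub>F nhds x)"
    by (simp add: nhds_prod[symmetric] scaleR_prod_def)
next
  fix U :: "('a \<times> 'b) set" assume "open U" "0 \<in> U"
  then obtain A B where AB: "open A" "open B" "0 \<in> A" "0 \<in> B" "A \<times> B \<subseteq> U"
    by (metis open_prod_elim mem_Times_iff fst_zero snd_zero)
  obtain V where V: "open V" "0 \<in> V" "V \<subseteq> A"
    "\<forall>x\<in>V. \<forall>y\<in>V. \<forall>u\<ge>0. \<forall>v\<ge>0. u + v = 1 \<longrightarrow> u *\<^sub>R x + v *\<^sub>R y \<in> V"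
    using convex_nhds[OF AB(1,3)] by blast
  obtain W where W: "open W" "0 \<in> W" "W \<subseteq> B"
    "\<forall>x\<in>W. \<forall>y\<in>W. \<forall>u\<ge>0. \<forall>v\<ge>0. u + v = 1 \<longrightarrow> u *\<^sub>R x + v *\<^sub>R y \<in> W"
    using convex_nhds[OF AB(2,4)] by blast
  show "\<exists>V. open V \<and> 0 \<in> V \<and> V \<subseteq> U \<and>
      (\<forall>x\<in>V. \<forall>y\<in>V. \<forall>u\<ge>0. \<forall>v\<ge>0. u + v = 1 \<longrightarrow> u *\<^sub>R x + v *\<^sub>R y \<in> V)"
    using V W AB by (intro exI[of _ "V \<times> W"]) (auto simp: open_Times zero_prod_def)
qed


section \<open>Smooth maps between locally convex spaces\<close>

definition dd :: "('x::lcs \<Rightarrow> 'y::lcs) \<Rightarrow> 'x \<Rightarrow> 'x \<Rightarrow> 'y" where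
  "dd f x h = Lim (at (0::real)) (\<lambda>t. (1 / t) *\<^sub>R (f (x + t *\<^sub>R h) - f x))"

definition C1_on :: "'x::lcs set \<Rightarrow> ('x \<Rightarrow> 'y::lcs) \<Rightarrow> bool" where
  "C1_on U f \<longleftrightarrow> continuous_on U f \<and>
    (\<forall>x\<in>U. \<forall>h. \<exists>l. ((\<lambda>t. (1 / t) *\<^sub>R (f (x + t *\<^sub>R h) - f x)) \<longlongrightarrow> l) (at (0::real))) \<and>
    continuous_on (U \<times> UNIV) (\<lambda>(x, h). dd f x h)"

text \<open>
  A map is \<open>C\<^sup>n\<^sup>+\<^sup>1\<close> on \<open>U\<close> if it is \<open>C\<^sup>1\<close> and \<open>df : U \<times> X \<rightarrow> Y\<close> is \<open>C\<^sup>n\<close>. The source of the map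
  changes from \<open>X\<close> to \<open>X \<times> X\<close>, so this is not a recursion over a function on a fixed type. We
  therefore realise \<open>X\<^sup>m\<close> as the space \<open>vpow m\<close> of sequences in \<open>X\<close> vanishing from index \<open>m\<close> on,
  with the topology of pointwise convergence, and \<open>X\<^sup>m \<times> X\<^sup>m\<close> as \<open>vpow (2 * m)\<close>, with projections
  \<open>vfst m\<close> and \<open>vsnd m\<close>. The lemma \<open>C_on_Suc\<close> below recovers the recursion in its original form.
\<close>

definition vpow :: "nat \<Rightarrow> (nat \<Rightarrow> 'x::zero) set" where
  "vpow m = {p. \<forall>i\<ge>m. p i = 0}"

definition vfst :: "nat \<Rightarrow> (nat \<Rightarrow> 'x::zero) \<Rightarrow> nat \<Rightarrow> 'x" where
  "vfst m p = (\<lambda>i. if i < m then p i else 0)"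

definition vsnd :: "nat \<Rightarrow> (nat \<Rightarrow> 'x::zero) \<Rightarrow> nat \<Rightarrow> 'x" where
  "vsnd m p = (\<lambda>i. if i < m then p (m + i) else 0)"

definition vquot ::
  "((nat \<Rightarrow> 'x::lcs) \<Rightarrow> 'y::lcs) \<Rightarrow> (nat \<Rightarrow> 'x) \<Rightarrow> (nat \<Rightarrow> 'x) \<Rightarrow> real \<Rightarrow> 'y" where
  "vquot F x h t = (1 / t) *\<^sub>R (F (\<lambda>i. x i + t *\<^sub>R h i) - F x)"

primrec Cpow_on ::
  "nat \<Rightarrow> nat \<Rightarrow> (nat \<Rightarrow> 'x::lcs) set \<Rightarrow> ((nat \<Rightarrow> 'x) \<Rightarrow> 'y::lcs) \<Rightarrow> bool" where
  "Cpow_on 0 m U F \<longleftrightarrow> continuous_on U F"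
| "Cpow_on (Suc n) m U F \<longleftrightarrow> continuous_on U F \<and>
     (\<forall>x\<in>U. \<forall>h\<in>vpow m. \<exists>l. (vquot F x h \<longlongrightarrow> l) (at 0)) \<and>
     Cpow_on n (2 * m) {p \<in> vpow (2 * m). vfst m p \<in> U}
       (\<lambda>p. Lim (at 0) (vquot F (vfst m p) (vsnd m p)))"

definition C_on :: "nat \<Rightarrow> 'x::lcs set \<Rightarrow> ('x \<Rightarrow> 'y::lcs) \<Rightarrow> bool" where
  "C_on n U f \<longleftrightarrow> Cpow_on n 1 {p \<in> vpow 1. p 0 \<in> U} (\<lambda>p. f (p 0))"

definition smooth_on :: "'x::lcs set \<Rightarrow> ('x \<Rightarrow> 'y::lcs) \<Rightarrow> bool" where
  "smooth_on U f \<longleftrightarrow> (\<forall>n. C_on n U f)"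

subsection \<open>The defining recursion\<close>

definition vjoin :: "nat \<Rightarrow> (nat \<Rightarrow> 'x::zero) \<Rightarrow> (nat \<Rightarrow> 'x) \<Rightarrow> nat \<Rightarrow> 'x" where
  "vjoin m p q = (\<lambda>i. if i < m then p i else if i < 2 * m then q (i - m) else 0)"

definition vpow_iso :: "nat \<Rightarrow> nat \<Rightarrow> ((nat \<Rightarrow> 'z::lcs) \<Rightarrow> (nat \<Rightarrow> 'x::lcs)) \<Rightarrow>
    ((nat \<Rightarrow> 'x) \<Rightarrow> (nat \<Rightarrow> 'z)) \<Rightarrow> bool" where
  "vpow_iso m k T S \<longleftrightarrow>
    (\<forall>p\<in>vpow m. T p \<in> vpow k \<and> S (T p) = p) \<and>
    (\<forall>q\<in>vpow k. S q \<in> vpow m \<and> T (S q) = q) \<and>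
    (\<forall>x\<in>vpow m. \<forall>h\<in>vpow m. \<forall>t. T (\<lambda>i. x i + t *\<^sub>R h i) = (\<lambda>i. T x i + t *\<^sub>R T h i)) \<and>
    continuous_on (vpow m) T \<and> continuous_on (vpow k) S"

lemma vfst_vpow [simp]: "vfst m p \<in> vpow m"
  and vsnd_vpow [simp]: "vsnd m p \<in> vpow m"
  and vjoin_vpow [simp]: "vjoin m p q \<in> vpow (2 * m)"
  by (auto simp: vfst_def vsnd_def vpow_def vjoin_def)

lemma vfst_vjoin [simp]: "p \<in> vpow m \<Longrightarrow> vfst m (vjoin m p q) = p"
  and vsnd_vjoin [simp]: "q \<in> vpow m \<Longrightarrow> vsnd m (vjoin m p q) = q"
  and vjoin_vfst_vsnd [simp]: "r \<in> vpow (2 * m) \<Longrightarrow> vjoin m (vfst m r) (vsnd m r) = r"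
  by (auto simp: vfst_def vsnd_def vpow_def vjoin_def fun_eq_iff)

lemma continuous_on_coord: "continuous_on A (\<lambda>p::nat \<Rightarrow> 'x::topological_space. p i)"
  by (rule continuous_on_subset[OF continuous_on_product_coordinates]) simp

lemma continuous_on_vfst: "continuous_on A (vfst m :: (nat \<Rightarrow> 'x::lcs) \<Rightarrow> _)"
proof (rule continuous_on_coordinatewise_then_product)
  show "continuous_on A (\<lambda>p :: nat \<Rightarrow> 'x. vfst m p i)" for i
    by (cases "i < m") (simp_all add: vfst_def continuous_on_coord)
qed

lemma continuous_on_vsnd: "continuous_on A (vsnd m :: (nat \<Rightarrow> 'x::lcs) \<Rightarrow> _)"
proof (rule continuous_on_coordinatewise_then_product)
  show "continuous_on A (\<lambda>p :: nat \<Rightarrow> 'x. vsnd m p i)" for i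
    by (cases "i < m") (simp_all add: vsnd_def continuous_on_coord)
qed

lemma continuous_on_vjoin:
  fixes f g :: "'z::topological_space \<Rightarrow> nat \<Rightarrow> 'x::lcs"
  assumes "continuous_on A f" "continuous_on A g"
  shows "continuous_on A (\<lambda>z. vjoin m (f z) (g z))"
proof (rule continuous_on_coordinatewise_then_product)
  have "continuous_on A (\<lambda>z. f z i)" "continuous_on A (\<lambda>z. g z i)" for i
    using assms by (auto intro: continuous_on_product_then_coordinatewise)
  then show "continuous_on A (\<lambda>z. vjoin m (f z) (g z) i)" for i
    by (cases "i < m"; cases "i < 2 * m") (simp_all add: vjoin_def)
qed

lemma vpow_iso_double:
  assumes "vpow_iso m k T S"
  shows "vpow_iso (2 * m) (2 * k) (\<lambda>p. vjoin k (T (vfst m p)) (T (vsnd m p)))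
    (\<lambda>q. vjoin m (S (vfst k q)) (S (vsnd k q)))"
proof -
  have TS: "\<And>p. p \<in> vpow m \<Longrightarrow> T p \<in> vpow k" "\<And>p. p \<in> vpow m \<Longrightarrow> S (T p) = p"
    "\<And>q. q \<in> vpow k \<Longrightarrow> S q \<in> vpow m" "\<And>q. q \<in> vpow k \<Longrightarrow> T (S q) = q"
    "continuous_on (vpow m) T" "continuous_on (vpow k) S"
    and lin: "\<And>x h t. x \<in> vpow m \<Longrightarrow> h \<in> vpow m \<Longrightarrow>
      T (\<lambda>i. x i + t *\<^sub>R h i) = (\<lambda>i. T x i + t *\<^sub>R T h i)"
    using assms unfolding vpow_iso_def by auto
  have split: "vfst m (\<lambda>i. x i + t *\<^sub>R h i) = (\<lambda>i. vfst m x i + t *\<^sub>R vfst m h i)"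
    "vsnd m (\<lambda>i. x i + t *\<^sub>R h i) = (\<lambda>i. vsnd m x i + t *\<^sub>R vsnd m h i)"
    for x h :: "nat \<Rightarrow> 'a" and t
    by (auto simp: vfst_def vsnd_def fun_eq_iff)
  have "continuous_on (vpow (2 * m)) (\<lambda>p. vjoin k (T (vfst m p)) (T (vsnd m p)))"
    by (intro continuous_on_vjoin continuous_on_compose2[OF TS(5)]
        continuous_on_vfst continuous_on_vsnd) auto
  moreover have "continuous_on (vpow (2 * k)) (\<lambda>q. vjoin m (S (vfst k q)) (S (vsnd k q)))"
    by (intro continuous_on_vjoin continuous_on_compose2[OF TS(6)]
        continuous_on_vfst continuous_on_vsnd) auto
  ultimately show ?thesis
    unfolding vpow_iso_def by (auto simp: TS split lin) (auto simp: vjoin_def fun_eq_iff)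
qed

lemma vpow_iso_continuous:
  assumes iso: "vpow_iso m k T S" and W: "W \<subseteq> vpow m"
  shows "continuous_on W (\<lambda>p. F (T p)) \<longleftrightarrow> continuous_on (T ` W) F"
proof
  have TS: "\<And>p. p \<in> W \<Longrightarrow> S (T p) = p" "T ` W \<subseteq> vpow k"
    using iso W unfolding vpow_iso_def by blast+
  have T: "continuous_on W T" and S: "continuous_on (T ` W) S"
    using iso TS(2) W continuous_on_subset unfolding vpow_iso_def by blast+
  show "continuous_on W (\<lambda>p. F (T p))" if "continuous_on (T ` W) F"
    using that T by (rule continuous_on_compose2) simp
  assume "continuous_on W (\<lambda>p. F (T p))"
  then have "continuous_on (T ` W) (\<lambda>q. F (T (S q)))"
    using S by (rule continuous_on_compose2) (use TS in auto)
  moreover have "F (T (S q)) = F q" if "q \<in> T ` W" for q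
    using that TS by auto
  ultimately show "continuous_on (T ` W) F"
    using continuous_on_cong by (metis (no_types, lifting))
qed

lemma Cpow_on_reindex:
  assumes "vpow_iso m k T S" "W \<subseteq> vpow m"
  shows "Cpow_on n m W (\<lambda>p. F (T p)) \<longleftrightarrow> Cpow_on n k (T ` W) F"
  using assms
proof (induction n arbitrary: m k T S W F)
  case (0 m k T S W F)
  then show ?case
    using vpow_iso_continuous[of m k T S W F] by simp
next
  case (Suc n m k T S W F)
  note iso = \<open>vpow_iso m k T S\<close>
  have TS: "\<And>p. p \<in> vpow m \<Longrightarrow> T p \<in> vpow k" "\<And>p. p \<in> vpow m \<Longrightarrow> S (T p) = p"
    "\<And>q. q \<in> vpow k \<Longrightarrow> S q \<in> vpow m" "\<And>q. q \<in> vpow k \<Longrightarrow> T (S q) = q"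
    "continuous_on (vpow m) T" "continuous_on (vpow k) S"
    and lin: "\<And>x h t. x \<in> vpow m \<Longrightarrow> h \<in> vpow m \<Longrightarrow>
      T (\<lambda>i. x i + t *\<^sub>R h i) = (\<lambda>i. T x i + t *\<^sub>R T h i)"
    using iso unfolding vpow_iso_def by auto
  have W: "\<And>x. x \<in> W \<Longrightarrow> x \<in> vpow m" using Suc.prems by auto
  define T' where "T' = (\<lambda>p. vjoin k (T (vfst m p)) (T (vsnd m p)))"
  define S' where "S' = (\<lambda>q. vjoin m (S (vfst k q)) (S (vsnd k q)))"
  have iso': "vpow_iso (2 * m) (2 * k) T' S'"
    unfolding T'_def S'_def by (rule vpow_iso_double[OF iso])
  have q: "vquot (\<lambda>p. F (T p)) x h = vquot F (T x) (T h)"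
    if "x \<in> vpow m" "h \<in> vpow m" for x h
    using that by (simp add: vquot_def fun_eq_iff lin)
  have cont: "continuous_on W (\<lambda>p. F (T p)) \<longleftrightarrow> continuous_on (T ` W) F"
    using iso Suc.prems(2) by (rule vpow_iso_continuous)
  have ex: "(\<forall>x\<in>W. \<forall>h\<in>vpow m. \<exists>l. (vquot (\<lambda>p. F (T p)) x h \<longlongrightarrow> l) (at 0)) \<longleftrightarrow>
    (\<forall>x\<in>T ` W. \<forall>h\<in>vpow k. \<exists>l. (vquot F x h \<longlongrightarrow> l) (at 0))"
  proof
    assume *: "\<forall>x\<in>W. \<forall>h\<in>vpow m. \<exists>l. (vquot (\<lambda>p. F (T p)) x h \<longlongrightarrow> l) (at 0)"
    show "\<forall>x\<in>T ` W. \<forall>h\<in>vpow k. \<exists>l. (vquot F x h \<longlongrightarrow> l) (at 0)"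
    proof clarify
      fix x and h :: "nat \<Rightarrow> 'b" assume "x \<in> W" "h \<in> vpow k"
      then show "\<exists>l. (vquot F (T x) h \<longlongrightarrow> l) (at 0)"
        using *[rule_format, of x "S h"] q[of x "S h"] TS(3,4)[of h] W by simp
    qed
  next
    assume "\<forall>x\<in>T ` W. \<forall>h\<in>vpow k. \<exists>l. (vquot F x h \<longlongrightarrow> l) (at 0)"
    then show "\<forall>x\<in>W. \<forall>h\<in>vpow m. \<exists>l. (vquot (\<lambda>p. F (T p)) x h \<longlongrightarrow> l) (at 0)"
      using q W TS(1) by auto
  qed
  have "Lim (at 0) (vquot (\<lambda>p. F (T p)) (vfst m p) (vsnd m p)) =
      Lim (at 0) (vquot F (vfst k (T' p)) (vsnd k (T' p)))" for p
    by (simp add: q T'_def TS)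
  moreover have "T' ` {p \<in> vpow (2 * m). vfst m p \<in> W} = {p \<in> vpow (2 * k). vfst k p \<in> T ` W}"
  proof (intro equalityI subsetI)
    fix r assume "r \<in> T' ` {p \<in> vpow (2 * m). vfst m p \<in> W}"
    then show "r \<in> {p \<in> vpow (2 * k). vfst k p \<in> T ` W}"
      by (auto simp: T'_def TS)
  next
    fix r assume r: "r \<in> {p \<in> vpow (2 * k). vfst k p \<in> T ` W}"
    then have "S' r \<in> vpow (2 * m)" "T' (S' r) = r"
      using iso' unfolding vpow_iso_def by auto
    moreover have "vfst m (S' r) \<in> W"
      using r by (auto simp: S'_def TS W)
    ultimately show "r \<in> T' ` {p \<in> vpow (2 * m). vfst m p \<in> W}"
      by (metis (mono_tags, lifting) image_eqI mem_Collect_eq)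
  qed
  ultimately have "Cpow_on n (2 * m) {p \<in> vpow (2 * m). vfst m p \<in> W}
       (\<lambda>p. Lim (at 0) (vquot (\<lambda>p. F (T p)) (vfst m p) (vsnd m p))) \<longleftrightarrow>
     Cpow_on n (2 * k) {p \<in> vpow (2 * k). vfst k p \<in> T ` W}
       (\<lambda>p. Lim (at 0) (vquot F (vfst k p) (vsnd k p)))"
    using Suc.IH[OF iso', of "{p \<in> vpow (2 * m). vfst m p \<in> W}"
        "\<lambda>p. Lim (at 0) (vquot F (vfst k p) (vsnd k p))"] by simp
  then show ?case
    using cont ex by simp
qed

lemma C_on_0: "C_on 0 U f \<longleftrightarrow> continuous_on U f"
proof -
  let ?e = "\<lambda>x i. if i = (0::nat) then x else (0::'a)"
  have e: "continuous_on U ?e"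
  proof (rule continuous_on_coordinatewise_then_product)
    show "continuous_on U (\<lambda>x. ?e x i)" for i
      by (cases "i = 0") simp_all
  qed
  show ?thesis
  proof
    assume "C_on 0 U f"
    then have "continuous_on {p \<in> vpow 1. p 0 \<in> U} (\<lambda>p. f (p 0))"
      by (simp add: C_on_def)
    then have "continuous_on U (\<lambda>x. f (?e x 0))"
      using e by (rule continuous_on_compose2) (auto simp: vpow_def)
    then show "continuous_on U f" by simp
  next
    assume "continuous_on U f"
    then show "C_on 0 U f"
      unfolding C_on_def Cpow_on.simps
      by (rule continuous_on_compose2) (auto intro: continuous_on_coord)
  qed
qed

lemma C_on_imp_continuous_on: "C_on n U f \<Longrightarrow> continuous_on U f"
  by (subst C_on_0[symmetric], cases n) (auto simp: C_on_def)

theorem C_on_Suc: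
  "C_on (Suc n) U f \<longleftrightarrow> C1_on U f \<and> C_on n (U \<times> UNIV) (\<lambda>(x, h). dd f x h)"
proof -
  define T :: "(nat \<Rightarrow> 'a \<times> 'a) \<Rightarrow> nat \<Rightarrow> 'a" where
    "T = (\<lambda>q i. if i = 0 then fst (q 0) else if i = 1 then snd (q 0) else 0)"
  define S :: "(nat \<Rightarrow> 'a) \<Rightarrow> nat \<Rightarrow> 'a \<times> 'a" where
    "S = (\<lambda>p i. if i = 0 then (p 0, p 1) else 0)"
  have "continuous_on X T" for X
  proof (rule continuous_on_coordinatewise_then_product)
    show "continuous_on X (\<lambda>x. T x i)" for i
      by (cases "i = 0"; cases "i = 1")
         (simp_all add: T_def continuous_on_fst continuous_on_snd continuous_on_coord)
  qed
  moreover have "continuous_on X S" for X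
  proof (rule continuous_on_coordinatewise_then_product)
    show "continuous_on X (\<lambda>x. S x i)" for i
      by (cases "i = 0") (simp_all add: S_def continuous_on_Pair continuous_on_coord)
  qed
  ultimately have iso: "vpow_iso 1 2 T S"
    unfolding vpow_iso_def by (auto simp: T_def S_def vpow_def fun_eq_iff zero_prod_def)
  let ?W = "{q \<in> vpow 1. q 0 \<in> U \<times> UNIV}"
  have im: "T ` ?W = {p \<in> vpow 2. vfst 1 p \<in> {p \<in> vpow 1. p 0 \<in> U}}"
  proof (intro equalityI subsetI)
    fix r assume "r \<in> T ` ?W"
    then show "r \<in> {p \<in> vpow 2. vfst 1 p \<in> {p \<in> vpow 1. p 0 \<in> U}}"
      by (auto simp: T_def vpow_def vfst_def)
  next
    fix r :: "nat \<Rightarrow> 'a" assume r: "r \<in> {p \<in> vpow 2. vfst 1 p \<in> {p \<in> vpow 1. p 0 \<in> U}}"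
    then have 1: "T (S r) = r" "S r \<in> vpow 1"
      using iso unfolding vpow_iso_def by auto
    moreover have "S r 0 \<in> U \<times> UNIV"
      using r by (auto simp: S_def vfst_def)
    ultimately have "S r \<in> ?W" by simp
    then show "r \<in> T ` ?W" by (rule rev_image_eqI) (simp only: 1)
  qed
  have vq: "vquot (\<lambda>p. f (p 0)) x h = (\<lambda>t. (1 / t) *\<^sub>R (f (x 0 + t *\<^sub>R h 0) - f (x 0)))"
    for x h :: "nat \<Rightarrow> 'a"
    by (simp add: vquot_def fun_eq_iff)
  have "C_on n (U \<times> UNIV) (\<lambda>(x, h). dd f x h) \<longleftrightarrow>
      Cpow_on n 1 ?W (\<lambda>q. dd f (T q 0) (T q 1))"
    by (simp add: C_on_def T_def case_prod_unfold)
  also have "\<dots> \<longleftrightarrow> Cpow_on n 2 (T ` ?W) (\<lambda>p. dd f (p 0) (p 1))"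
    by (rule Cpow_on_reindex[OF iso]) auto
  also have "(\<lambda>p. dd f (p 0) (p 1)) =
      (\<lambda>p. Lim (at 0) (vquot (\<lambda>p. f (p 0)) (vfst 1 p) (vsnd 1 p)))"
    by (simp add: fun_eq_iff dd_def vq vfst_def vsnd_def)
  finally have D: "C_on n (U \<times> UNIV) (\<lambda>(x, h). dd f x h) \<longleftrightarrow>
      Cpow_on n 2 {p \<in> vpow 2. vfst 1 p \<in> {p \<in> vpow 1. p 0 \<in> U}}
        (\<lambda>p. Lim (at 0) (vquot (\<lambda>p. f (p 0)) (vfst 1 p) (vsnd 1 p)))"
    unfolding im .
  have E: "(\<forall>x\<in>{p \<in> vpow 1. p 0 \<in> U}. \<forall>h\<in>vpow 1. \<exists>l. (vquot (\<lambda>p. f (p 0)) x h \<longlongrightarrow> l) (at 0)) \<longleftrightarrow>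
      (\<forall>x\<in>U. \<forall>h. \<exists>l. ((\<lambda>t. (1 / t) *\<^sub>R (f (x + t *\<^sub>R h) - f x)) \<longlongrightarrow> l) (at (0::real)))"
    (is "?L \<longleftrightarrow> ?R")
  proof
    assume L: ?L
    show ?R
    proof clarify
      fix x h assume "x \<in> U"
      then show "\<exists>l. ((\<lambda>t. (1 / t) *\<^sub>R (f (x + t *\<^sub>R h) - f x)) \<longlongrightarrow> l) (at (0::real))"
        using L[rule_format, of "\<lambda>i. if i = 0 then x else 0" "\<lambda>i. if i = 0 then h else 0"]
        by (simp add: vq vpow_def)
    qed
  qed (auto simp: vq)
  have "C_on (Suc n) U f \<longleftrightarrow> continuous_on U f \<and>
      (\<forall>x\<in>U. \<forall>h. \<exists>l. ((\<lambda>t. (1 / t) *\<^sub>R (f (x + t *\<^sub>R h) - f x)) \<longlongrightarrow> l) (at (0::real))) \<and>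
      C_on n (U \<times> UNIV) (\<lambda>(x, h). dd f x h)"
    using D E C_on_0[of U f] by (simp add: C_on_def numeral_2_eq_2)
  then show ?thesis
    unfolding C1_on_def using C_on_imp_continuous_on by blast
qed


section \<open>Manifolds and Lie groups\<close>

record ('m, 'v) manifold =
  mtop :: "'m topology"
  atlas :: "('m set \<times> ('m \<Rightarrow> 'v)) set"

definition manifold :: "('m, 'v::lcs) manifold \<Rightarrow> bool" where
  "manifold M \<longleftrightarrow> Hausdorff_space (mtop M) \<and>
    \<Union>(fst ` atlas M) = topspace (mtop M) \<and>
    (\<forall>(U, \<phi>)\<in>atlas M. openin (mtop M) U \<and> open (\<phi> ` U) \<and>
      homeomorphic_map (subtopology (mtop M) U) (top_of_set (\<phi> ` U)) \<phi>) \<and>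
    (\<forall>(U, \<phi>)\<in>atlas M. \<forall>(V, \<psi>)\<in>atlas M.
      smooth_on (\<phi> ` (U \<inter> V)) (\<lambda>x. \<psi> (inv_into U \<phi> x)))"

definition smooth_map ::
  "('m, 'v::lcs) manifold \<Rightarrow> ('n, 'w::lcs) manifold \<Rightarrow> ('m \<Rightarrow> 'n) \<Rightarrow> bool" where
  "smooth_map M N f \<longleftrightarrow> continuous_map (mtop M) (mtop N) f \<and>
    (\<forall>(U, \<phi>)\<in>atlas M. \<forall>(V, \<psi>)\<in>atlas N.
      smooth_on (\<phi> ` (U \<inter> f -` V)) (\<lambda>x. \<psi> (f (inv_into U \<phi> x))))"

definition diffeo ::
  "('m, 'v::lcs) manifold \<Rightarrow> ('n, 'w::lcs) manifold \<Rightarrow> ('m \<Rightarrow> 'n) \<Rightarrow> bool" where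
  "diffeo M N f \<longleftrightarrow> bij_betw f (topspace (mtop M)) (topspace (mtop N)) \<and>
    smooth_map M N f \<and> smooth_map N M (inv_into (topspace (mtop M)) f)"

definition prod_mfd ::
  "('m, 'v) manifold \<Rightarrow> ('n, 'w) manifold \<Rightarrow> ('m \<times> 'n, 'v \<times> 'w) manifold" (infixr "\<times>\<^sub>M" 80) where
  "M \<times>\<^sub>M N = \<lparr>mtop = prod_topology (mtop M) (mtop N),
    atlas = {(U \<times> V, map_prod \<phi> \<psi>) | U \<phi> V \<psi>. (U, \<phi>) \<in> atlas M \<and> (V, \<psi>) \<in> atlas N}\<rparr>"

definition open_submfd :: "('m, 'v) manifold \<Rightarrow> 'm set \<Rightarrow> ('m, 'v) manifold" where
  "open_submfd M W = \<lparr>mtop = subtopology (mtop M) W, atlas = (\<lambda>(U, \<phi>). (U \<inter> W, \<phi>)) ` atlas M\<rparr>"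

definition smooth_near ::
  "('m, 'v::lcs) manifold \<Rightarrow> ('n, 'w::lcs) manifold \<Rightarrow> 'm \<Rightarrow> ('m \<Rightarrow> 'n) \<Rightarrow> bool" where
  "smooth_near M N x f \<longleftrightarrow>
    (\<exists>W. openin (mtop M) W \<and> x \<in> W \<and> smooth_map (open_submfd M W) N f)"

record ('g, 'v) lie_group = "'g monoid" +
  mfd :: "('g, 'v) manifold"

definition lie_group :: "('g, 'v::lcs) lie_group \<Rightarrow> bool" where
  "lie_group G \<longleftrightarrow> group G \<and> manifold (mfd G) \<and> topspace (mtop (mfd G)) = carrier G \<and>
    smooth_map (mfd G \<times>\<^sub>M mfd G) (mfd G) (\<lambda>(x, y). x \<otimes>\<^bsub>G\<^esub> y) \<and>
    smooth_map (mfd G) (mfd G) (\<lambda>x. inv\<^bsub>G\<^esub> x)"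

definition lie_hom :: "('g, 'v::lcs) lie_group \<Rightarrow> ('h, 'w::lcs) lie_group \<Rightarrow> ('g \<Rightarrow> 'h) set" where
  "lie_hom G H = {f \<in> hom G H. smooth_map (mfd G) (mfd H) f}"

text \<open>
  As usual in \<open>HOL-Algebra\<close>, the operation of an abelian group \<open>A\<close> is written
  \<open>a \<otimes>\<^bsub>A\<^esub> b\<close>, its neutral element \<open>\<one>\<^bsub>A\<^esub>\<close> and inverses \<open>inv\<^bsub>A\<^esub> a\<close>; these are \<open>a + b\<close>, \<open>0\<close>, \<open>- a\<close>
  in additive notation.
\<close>

definition smooth_module ::
  "('g, 'v::lcs) lie_group \<Rightarrow> ('a, 'u::lcs) lie_group \<Rightarrow> ('g \<Rightarrow> 'a \<Rightarrow> 'a) \<Rightarrow> bool" where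
  "smooth_module G A \<rho> \<longleftrightarrow> lie_group A \<and> comm_group A \<and> \<rho> \<in> hom G (AutoGroup A) \<and>
    smooth_map (mfd G \<times>\<^sub>M mfd A) (mfd A) (\<lambda>(g, a). \<rho> g a)"


section \<open>Locally smooth cohomology in degree two\<close>

text \<open>
  Cochains are extensional functions, so that they are determined by their values on the group.
\<close>

definition C1s :: "('g, 'v::lcs) lie_group \<Rightarrow> ('a, 'u::lcs) lie_group \<Rightarrow> ('g \<Rightarrow> 'a) set" where
  "C1s G A = {h \<in> carrier G \<rightarrow>\<^sub>E carrier A.
    smooth_near (mfd G) (mfd A) \<one>\<^bsub>G\<^esub> h \<and> h \<one>\<^bsub>G\<^esub> = \<one>\<^bsub>A\<^esub>}"

definition C2s :: "('g, 'v::lcs) lie_group \<Rightarrow> ('a, 'u::lcs) lie_group \<Rightarrow> ('g \<times> 'g \<Rightarrow> 'a) set" where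
  "C2s G A = {f \<in> carrier G \<times> carrier G \<rightarrow>\<^sub>E carrier A.
    smooth_near (mfd G \<times>\<^sub>M mfd G) (mfd A) (\<one>\<^bsub>G\<^esub>, \<one>\<^bsub>G\<^esub>) f \<and>
    (\<forall>g\<in>carrier G. f (g, \<one>\<^bsub>G\<^esub>) = \<one>\<^bsub>A\<^esub> \<and> f (\<one>\<^bsub>G\<^esub>, g) = \<one>\<^bsub>A\<^esub>)}"

definition d1 :: "('g, 'v::lcs) lie_group \<Rightarrow> ('a, 'u::lcs) lie_group \<Rightarrow> ('g \<Rightarrow> 'a \<Rightarrow> 'a) \<Rightarrow>
    ('g \<Rightarrow> 'a) \<Rightarrow> 'g \<times> 'g \<Rightarrow> 'a" where
  "d1 G A \<rho> h = (\<lambda>(g0, g1) \<in> carrier G \<times> carrier G.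
    \<rho> g0 (h g1) \<otimes>\<^bsub>A\<^esub> inv\<^bsub>A\<^esub> h (g0 \<otimes>\<^bsub>G\<^esub> g1) \<otimes>\<^bsub>A\<^esub> h g0)"

definition d2 :: "('g, 'v::lcs) lie_group \<Rightarrow> ('a, 'u::lcs) lie_group \<Rightarrow> ('g \<Rightarrow> 'a \<Rightarrow> 'a) \<Rightarrow>
    ('g \<times> 'g \<Rightarrow> 'a) \<Rightarrow> 'g \<times> 'g \<times> 'g \<Rightarrow> 'a" where
  "d2 G A \<rho> f = (\<lambda>(g0, g1, g2) \<in> carrier G \<times> carrier G \<times> carrier G.
    \<rho> g0 (f (g1, g2)) \<otimes>\<^bsub>A\<^esub> inv\<^bsub>A\<^esub> f (g0 \<otimes>\<^bsub>G\<^esub> g1, g2) \<otimes>\<^bsub>A\<^esub> f (g0, g1 \<otimes>\<^bsub>G\<^esub> g2)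
      \<otimes>\<^bsub>A\<^esub> inv\<^bsub>A\<^esub> f (g0, g1))"

definition Z2s :: "('g, 'v::lcs) lie_group \<Rightarrow> ('a, 'u::lcs) lie_group \<Rightarrow> ('g \<Rightarrow> 'a \<Rightarrow> 'a) \<Rightarrow>
    ('g \<times> 'g \<Rightarrow> 'a) set" where
  "Z2s G A \<rho> = {f \<in> C2s G A. \<forall>x \<in> carrier G \<times> carrier G \<times> carrier G. d2 G A \<rho> f x = \<one>\<^bsub>A\<^esub>}"

definition B2s :: "('g, 'v::lcs) lie_group \<Rightarrow> ('a, 'u::lcs) lie_group \<Rightarrow> ('g \<Rightarrow> 'a \<Rightarrow> 'a) \<Rightarrow>
    ('g \<times> 'g \<Rightarrow> 'a) set" where
  "B2s G A \<rho> = d1 G A \<rho> ` C1s G A"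

definition conj_defect :: "('g, 'v::lcs) lie_group \<Rightarrow> ('a, 'u::lcs) lie_group \<Rightarrow>
    ('g \<times> 'g \<Rightarrow> 'a) \<Rightarrow> 'g \<Rightarrow> 'g \<Rightarrow> 'a" where
  "conj_defect G A f g = (\<lambda>g' \<in> carrier G.
    f (g, g') \<otimes>\<^bsub>A\<^esub> inv\<^bsub>A\<^esub> f (g \<otimes>\<^bsub>G\<^esub> g' \<otimes>\<^bsub>G\<^esub> inv\<^bsub>G\<^esub> g, g))"

definition Z2ss :: "('g, 'v::lcs) lie_group \<Rightarrow> ('a, 'u::lcs) lie_group \<Rightarrow> ('g \<Rightarrow> 'a \<Rightarrow> 'a) \<Rightarrow>
    ('g \<times> 'g \<Rightarrow> 'a) set" where
  "Z2ss G A \<rho> = {f \<in> Z2s G A \<rho>. \<forall>g\<in>carrier G. conj_defect G A f g \<in> C1s G A}"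

definition cochain_group :: "'d set \<Rightarrow> ('a, 'u::lcs) lie_group \<Rightarrow> ('d \<Rightarrow> 'a) set \<Rightarrow>
    ('d \<Rightarrow> 'a) monoid" where
  "cochain_group D A F = \<lparr>carrier = F, mult = (\<lambda>f f'. \<lambda>x\<in>D. f x \<otimes>\<^bsub>A\<^esub> f' x), one = (\<lambda>x\<in>D. \<one>\<^bsub>A\<^esub>)\<rparr>"

definition Z2s_group where
  "Z2s_group G A \<rho> = cochain_group (carrier G \<times> carrier G) A (Z2s G A \<rho>)"

definition Z2ss_group where
  "Z2ss_group G A \<rho> = cochain_group (carrier G \<times> carrier G) A (Z2ss G A \<rho>)"

definition H2s where
  "H2s G A \<rho> = Z2s_group G A \<rho> Mod B2s G A \<rho>"

definition H2ss where
  "H2ss G A \<rho> = Z2ss_group G A \<rho> Mod B2s G A \<rho>"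


section \<open>Extensions of Lie groups\<close>

text \<open>
  An extension of \<open>G\<close> by \<open>N\<close> consists of the total group, the inclusion of \<open>N\<close> (an isomorphism
  onto the kernel) and the projection.
\<close>

record ('n, 'g, 'e, 'w) lie_ext =
  tot :: "('e, 'w) lie_group"
  inc :: "'n \<Rightarrow> 'e"
  proj :: "'e \<Rightarrow> 'g"

text \<open>
  That the Lie group structure on the kernel is the natural one means that multiplication by \<open>N\<close>
  makes the total group a smooth principal \<open>N\<close>-bundle: the smooth local section \<open>\<sigma>\<close> gives a
  diffeomorphism \<open>N \<times> U \<rightarrow> q\<^sup>-\<^sup>1(U)\<close>, \<open>(n, g) \<mapsto> n \<sigma>(g)\<close>. Smoothness of \<open>(n, x) \<mapsto> n x\<close> alone would,
  for instance, allow the discrete real line as a kernel of \<open>\<real> \<rightarrow> 0\<close>.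
\<close>

definition lie_extension :: "('n, 'u::lcs) lie_group \<Rightarrow> ('g, 'v::lcs) lie_group \<Rightarrow>
    ('n, 'g, 'e, 'w::lcs) lie_ext \<Rightarrow> bool" where
  "lie_extension N G E \<longleftrightarrow> lie_group N \<and> lie_group G \<and> lie_group (tot E) \<and>
    proj E \<in> lie_hom (tot E) G \<and> proj E ` carrier (tot E) = carrier G \<and>
    inc E \<in> hom N (tot E) \<and> inj_on (inc E) (carrier N) \<and>
    inc E ` carrier N = kernel (tot E) G (proj E) \<and>
    smooth_map (mfd N \<times>\<^sub>M mfd (tot E)) (mfd (tot E)) (\<lambda>(n, x). inc E n \<otimes>\<^bsub>tot E\<^esub> x) \<and>
    (\<exists>U \<sigma>. openin (mtop (mfd G)) U \<and> \<one>\<^bsub>G\<^esub> \<in> U \<and>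
      smooth_map (open_submfd (mfd G) U) (mfd (tot E)) \<sigma> \<and> (\<forall>g\<in>U. proj E (\<sigma> g) = g) \<and>
      diffeo (mfd N \<times>\<^sub>M open_submfd (mfd G) U)
        (open_submfd (mfd (tot E)) {x \<in> carrier (tot E). proj E x \<in> U})
        (\<lambda>(n, g). inc E n \<otimes>\<^bsub>tot E\<^esub> \<sigma> g))"

definition module_extension :: "('g, 'v::lcs) lie_group \<Rightarrow> ('a, 'u::lcs) lie_group \<Rightarrow>
    ('g \<Rightarrow> 'a \<Rightarrow> 'a) \<Rightarrow> ('a, 'g, 'e, 'w::lcs) lie_ext \<Rightarrow> bool" where
  "module_extension G A \<rho> E \<longleftrightarrow> lie_extension A G E \<and>
    (\<forall>x\<in>carrier (tot E). \<forall>a\<in>carrier A.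
      x \<otimes>\<^bsub>tot E\<^esub> inc E a \<otimes>\<^bsub>tot E\<^esub> inv\<^bsub>tot E\<^esub> x = inc E (\<rho> (proj E x) a))"

definition ext_equiv :: "('n, 'u::lcs) lie_group \<Rightarrow> ('n, 'g, 'e, 'w::lcs) lie_ext \<Rightarrow>
    ('n, 'g, 'f, 'z::lcs) lie_ext \<Rightarrow> bool" where
  "ext_equiv N E E' \<longleftrightarrow> (\<exists>\<phi>\<in>lie_hom (tot E) (tot E').
    (\<forall>n\<in>carrier N. \<phi> (inc E n) = inc E' n) \<and>
    (\<forall>x\<in>carrier (tot E). proj E' (\<phi> x) = proj E x))"

text \<open>
  A set of equivalence classes requires a fixed type for total groups and for model spaces. We
  take \<open>'a \<times> 'g\<close> and \<open>'u \<times> 'v\<close>; by local triviality, every extension, whatever its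
  types, is equivalent to one over these.
\<close>

type_synonym ('a, 'u, 'g, 'v) std_ext = "('a, 'g, 'a \<times> 'g, 'u \<times> 'v) lie_ext"

definition ext_rel :: "('g, 'v::lcs) lie_group \<Rightarrow> ('a, 'u::lcs) lie_group \<Rightarrow>
    ('g \<Rightarrow> 'a \<Rightarrow> 'a) \<Rightarrow> ('a, 'u, 'g, 'v) std_ext rel" where
  "ext_rel G A \<rho> = {(E, E'). module_extension G A \<rho> E \<and> module_extension G A \<rho> E' \<and>
    ext_equiv A E E'}"

definition Ext :: "('g, 'v::lcs) lie_group \<Rightarrow> ('a, 'u::lcs) lie_group \<Rightarrow>
    ('g \<Rightarrow> 'a \<Rightarrow> 'a) \<Rightarrow> ('a, 'u, 'g, 'v) std_ext set set" where
  "Ext G A \<rho> = {E. module_extension G A \<rho> E} // ext_rel G A \<rho>"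

definition ext_class :: "('g, 'v::lcs) lie_group \<Rightarrow> ('a, 'u::lcs) lie_group \<Rightarrow>
    ('g \<Rightarrow> 'a \<Rightarrow> 'a) \<Rightarrow> ('a, 'u, 'g, 'v) std_ext \<Rightarrow> ('a, 'u, 'g, 'v) std_ext set" where
  "ext_class G A \<rho> E = ext_rel G A \<rho> `` {E}"

definition crossed_ext :: "('g, 'v::lcs) lie_group \<Rightarrow> ('a, 'u::lcs) lie_group \<Rightarrow>
    ('g \<Rightarrow> 'a \<Rightarrow> 'a) \<Rightarrow> ('g \<times> 'g \<Rightarrow> 'a) \<Rightarrow> ('a \<times> 'g, 'u \<times> 'v) manifold \<Rightarrow>
    ('a, 'u, 'g, 'v) std_ext" where
  "crossed_ext G A \<rho> f M =
    \<lparr>tot = \<lparr>carrier = carrier A \<times> carrier G,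
        mult = (\<lambda>(a, g) (a', g'). (a \<otimes>\<^bsub>A\<^esub> \<rho> g a' \<otimes>\<^bsub>A\<^esub> f (g, g'), g \<otimes>\<^bsub>G\<^esub> g')),
        one = (\<one>\<^bsub>A\<^esub>, \<one>\<^bsub>G\<^esub>), mfd = M\<rparr>,
     inc = (\<lambda>a. (a, \<one>\<^bsub>G\<^esub>)), proj = snd\<rparr>"

text \<open>
  The class \<open>[A \<times>\<^sub>f G]\<close> refers to the manifold structure for which the section \<open>g \<mapsto> (0, g)\<close> is
  smooth near the identity. Without this normalisation the class is not well defined: with
  the circle as \<open>G\<close> and the discrete rationals as \<open>A\<close>, the group \<open>A \<times> G\<close> also carries the structure
  of a non-split Lie group extension.
\<close>

definition crossed_structure :: "('g, 'v::lcs) lie_group \<Rightarrow> ('a, 'u::lcs) lie_group \<Rightarrow>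
    ('g \<Rightarrow> 'a \<Rightarrow> 'a) \<Rightarrow> ('g \<times> 'g \<Rightarrow> 'a) \<Rightarrow> ('a \<times> 'g, 'u \<times> 'v) manifold \<Rightarrow> bool" where
  "crossed_structure G A \<rho> f M \<longleftrightarrow> module_extension G A \<rho> (crossed_ext G A \<rho> f M) \<and>
    smooth_near (mfd G) M \<one>\<^bsub>G\<^esub> (\<lambda>g. (\<one>\<^bsub>A\<^esub>, g))"

end

theory Submission
  imports Defs
begin

text \<open>
  For \<open>f\<close> in \<open>Z2ss\<close>, the left translates of \<open>A \<times> U\<close>, with \<open>U\<close> a small identity neighbourhood of \<open>G\<close>,
  are charts of \<open>A \<times>\<^sub>f G\<close>: changes of charts and multiplication and inversion near the identity are
  smooth because \<open>f\<close> is smooth near \<open>(1, 1)\<close>, and conjugations are smooth near the identity because the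
  functions \<open>f\<^sub>g\<close> are; left translation spreads smoothness over the whole group. Conversely, a section
  of an extension that is smooth near the identity yields a cocycle, and the local trivialisation
  makes the \<open>A\<close>-component of the total group smooth. A group homomorphism between extensions that
  respects \<open>A\<close> is smooth as soon as it is smooth along such a section, so equivalences of crossed
  products correspond to locally smooth 1-cochains. Calculus on locally convex spaces enters only
  through the chain rule.
\<close>

section \<open>Smooth maps between locally convex spaces\<close>

subsection \<open>The chain rule\<close>

text \<open>The obstacle that shapes the proof is that neither \<open>f\<close> nor a section need
  be smooth away from the identity. Every smoothness statement about a group is therefore reduced to
  a germ at the identity, and smoothness is handled throughout by the pointwise predicate
  \<open>smooth_at\<close>. For products this reduction involves conjugation by arbitrary, possibly
  distant, elements. The A-component of conjugation by (c, z) in A x_f G is a sum of f_z and of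
  terms that are smooth because A is a smooth module; this is the origin of the condition defining
  Z2ss. When G is connected, any identity neighbourhood generates it, and the condition only has to
  be checked for small z, where it follows from smoothness of f near (1, 1). The type
  \<open>lie_ext\<close> leaves the manifold on A x G open, so statements about crossed products
  hold for every structure M normalised along g |-> (0, g), not only for the one that is
  constructed.\<close>

lemma tendsto_scaleR_lcs:
  fixes g :: "'b \<Rightarrow> 'y::lcs"
  assumes "(f \<longlongrightarrow> c) F" "(g \<longlongrightarrow> x) F"
  shows "((\<lambda>t. f t *\<^sub>R g t) \<longlongrightarrow> c *\<^sub>R x) F"
  using filterlim_compose[OF tendsto_scaleR_Pair filterlim_Pair[OF assms]] by simp

lemma convex_nhds_at:
  fixes x :: "'y::lcs"
  assumes "open V" "x \<in> V"
  obtains C where "open C" "x \<in> C" "C \<subseteq> V" "convex C"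
proof -
  have sh: "open ((\<lambda>z. z + a) -` S)" if "open S" for S and a :: 'y
    by (rule open_vimage[OF that]) (intro continuous_intros)
  obtain C where C: "open C" "0 \<in> C" "C \<subseteq> (\<lambda>z. z + x) -` V"
    and cv: "\<forall>y\<in>C. \<forall>z\<in>C. \<forall>u\<ge>0. \<forall>v\<ge>0. u + v = 1 \<longrightarrow> u *\<^sub>R y + v *\<^sub>R z \<in> C"
    using convex_nhds[OF sh[OF assms(1), of x]] assms(2) by auto
  show ?thesis
  proof (rule that[of "(\<lambda>z. z + (- x)) -` C"])
    show "open ((\<lambda>z. z + (- x)) -` C)" by (rule sh[OF C(1)])
    show "x \<in> (\<lambda>z. z + (- x)) -` C" using C(2) by simp
    show "(\<lambda>z. z + (- x)) -` C \<subseteq> V" using C(3) by force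
    show "convex ((\<lambda>z. z + (- x)) -` C)"
      unfolding convex_def
    proof (intro ballI allI impI)
      fix y z u v
      assume *: "y \<in> (\<lambda>z. z + (- x)) -` C" "z \<in> (\<lambda>z. z + (- x)) -` C"
        "0 \<le> u" "0 \<le> v" "u + v = (1::real)"
      have "u *\<^sub>R y + v *\<^sub>R z + (- x) = u *\<^sub>R (y + (- x)) + v *\<^sub>R (z + (- x))"
        using *(5) by (simp add: algebra_simps flip: scaleR_add_left)
      then show "u *\<^sub>R y + v *\<^sub>R z \<in> (\<lambda>z. z + (- x)) -` C" using * cv by simp
    qed
  qed
qed

text \<open>
  The difference quotient over an interval is a convex combination of those over two pieces, so by
  bisection it lies in every open convex set containing all derivatives; no Hahn-Banach theorem is
  needed.
\<close>

lemma mean_value_convex: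
  fixes c :: "real \<Rightarrow> 'y::lcs"
  assumes der: "\<And>s. 0 \<le> s \<Longrightarrow> s \<le> 1 \<Longrightarrow> ((\<lambda>r. (1 / r) *\<^sub>R (c (s + r) - c s)) \<longlongrightarrow> c' s) (at 0)"
    and C: "open C" "\<And>s. 0 \<le> s \<Longrightarrow> s \<le> 1 \<Longrightarrow> c' s \<in> C"
    and cv: "convex C"
  shows "c 1 - c 0 \<in> C"
proof -
  let ?q = "\<lambda>a b. (1 / (b - a)) *\<^sub>R (c b - c a)"
  have comb: "?q a b \<in> C" if "a < x" "x < b" "?q a x \<in> C" "?q x b \<in> C" for a b x
  proof -
    have "((x - a) / (b - a)) *\<^sub>R ?q a x + ((b - x) / (b - a)) *\<^sub>R ?q x b =
        (1 / (b - a)) *\<^sub>R (c x - c a) + (1 / (b - a)) *\<^sub>R (c b - c x)"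
      using that(1,2) by simp
    also have "\<dots> = ?q a b"
      by (simp flip: scaleR_add_right)
    finally have eq: "((x - a) / (b - a)) *\<^sub>R ?q a x + ((b - x) / (b - a)) *\<^sub>R ?q x b = ?q a b" .
    have "(x - a) / (b - a) + (b - x) / (b - a) = 1"
      using that(1,2) by (simp flip: add_divide_distrib)
    then show ?thesis
      using that(1,2) by (subst eq[symmetric], intro convexD[OF cv] that(3,4)) auto
  qed
  \<comment> \<open>The derivative at a point x controls the quotients with one end at x; symmetry
    lets the same limit serve for the pieces on either side of x.\<close>
  have sym: "?q a b = ?q b a" for a b
  proof -
    have "1 / (a - b) = - (1 / (b - a))"
      by (metis minus_diff_eq minus_divide_right)
    moreover have "c a - c b = - (c b - c a)" by simp
    ultimately show ?thesis by (simp only: scaleR_minus_left scaleR_minus_right minus_minus)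
  qed
  have "(0::real) \<le> 1" by simp
  then have "(0::real) < 1 \<longrightarrow> ?q 0 1 \<in> C"
  proof (induction rule: Bolzano[of 0 1 "\<lambda>a b. a < b \<longrightarrow> ?q a b \<in> C"])
    case (trans a b d)
    then show ?case using comb[of a b d] by (cases "a < b"; cases "b < d") auto
  next
    case (local x)
    have "eventually (\<lambda>r. (1 / r) *\<^sub>R (c (x + r) - c x) \<in> C) (at 0)"
      using der[OF local] C local by (auto simp: tendsto_def)
    then obtain d where d: "d > 0" "\<And>r. r \<noteq> 0 \<Longrightarrow> \<bar>r\<bar> < d \<Longrightarrow> (1 / r) *\<^sub>R (c (x + r) - c x) \<in> C"
      unfolding eventually_at by (auto simp: dist_real_def)
    have q: "?q x b \<in> C" if "x \<noteq> b" "\<bar>b - x\<bar> < d" for b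
      using d(2)[of "b - x"] that by simp
    have "?q a b \<in> C" if "a \<le> x" "x \<le> b" "b - a < d" "a < b" for a b
    proof (cases "a = x \<or> x = b")
      case True
      then show ?thesis using q[of b] q[of a] that sym[of a b] by auto
    next
      case False
      then show ?thesis
        using comb[of a x b] q[of b] q[of a] that sym[of a x] by auto
    qed
    then show ?case using d(1) by blast
  qed
  then show ?thesis by simp
qed

lemma tendsto_funI:
  fixes f :: "'b \<Rightarrow> 'i \<Rightarrow> 'y::topological_space"
  assumes "\<And>i. ((\<lambda>x. f x i) \<longlongrightarrow> l i) F"
  shows "(f \<longlongrightarrow> l) F"
proof -
  have "limitin (product_topology (\<lambda>i. euclidean) UNIV) f l F"
    unfolding limitin_componentwise using assms by simp
  then show ?thesis by (simp add: euclidean_product_topology)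
qed

text \<open>A convex neighbourhood of 0 that contains u also contains s u for every s in [0,1].
  Pairing \<open>F\<close> with the principal filter on [0,1] expresses that the limit is uniform in
  s.\<close>

lemma tendsto_scaleR_unit_interval:
  fixes u :: "'b \<Rightarrow> 'y::lcs"
  assumes "(u \<longlongrightarrow> 0) F"
  shows "((\<lambda>(t, s). s *\<^sub>R u t) \<longlongrightarrow> 0) (F \<times>\<^sub>F principal {0..1::real})"
proof (rule topological_tendstoI)
  fix S :: "'y set" assume "open S" "0 \<in> S"
  then obtain C where C: "open C" "0 \<in> C" "C \<subseteq> S"
    and cv: "convex C"
    by (rule convex_nhds_at)
  have "eventually (\<lambda>t. u t \<in> C) F"
    using assms C by (auto simp: tendsto_def)
  moreover have "s *\<^sub>R u t \<in> S" if "u t \<in> C" "s \<in> {0..1}" for s t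
    using convexD[OF cv that(1) C(2), of s "1 - s"] that(2) C(3) by auto
  ultimately show "\<forall>\<^sub>F x in F \<times>\<^sub>F principal {0..1}. (case x of (t, s) \<Rightarrow> s *\<^sub>R u t) \<in> S"
    unfolding eventually_prod_filter eventually_principal
    by (intro exI[of _ "\<lambda>t. u t \<in> C"] exI[of _ "\<lambda>s. s \<in> {0..1}"]) simp
qed

text \<open>A principal filter has a smallest set, so uniformity in s survives the passage from
  pairs to a quantifier over s.\<close>

lemma eventually_prod_principalD:
  assumes "eventually (\<lambda>p. P (snd p) (fst p)) (F \<times>\<^sub>F principal S)"
  shows "eventually (\<lambda>t. \<forall>s\<in>S. P s t) F"
proof -
  obtain Pf Pg where "eventually Pf F" "\<forall>s\<in>S. Pg s" "\<forall>t. Pf t \<longrightarrow> (\<forall>s. Pg s \<longrightarrow> P s t)"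
    using assms unfolding eventually_prod_filter eventually_principal by auto
  then show ?thesis by (auto elim: eventually_mono)
qed

abbreviation vopen :: "nat \<Rightarrow> (nat \<Rightarrow> 'x::{zero, topological_space}) set \<Rightarrow> bool" where
  "vopen m \<equiv> openin (top_of_set (vpow m))"

text \<open>\<open>vdom m U\<close> is U x X^m inside X^(2m), and \<open>vderiv m F\<close> is dF on
  it: the two ingredients of the successor clause of \<open>Cpow_on\<close>.\<close>

abbreviation vdom :: "nat \<Rightarrow> (nat \<Rightarrow> 'x::zero) set \<Rightarrow> (nat \<Rightarrow> 'x) set" where
  "vdom m U \<equiv> {p \<in> vpow (2 * m). vfst m p \<in> U}"

abbreviation vderiv :: "nat \<Rightarrow> ((nat \<Rightarrow> 'x::lcs) \<Rightarrow> 'y::lcs) \<Rightarrow> (nat \<Rightarrow> 'x) \<Rightarrow> 'y" where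
  "vderiv m F \<equiv> \<lambda>p. Lim (at 0) (vquot F (vfst m p) (vsnd m p))"

text \<open>The core of the chain rule: F is differentiated along a curve that is merely tangent to
  h at y. The mean value argument is applied to F on the segment from y to
  \<open>\<gamma> t\<close>. Its derivatives there are values of dF at (z, kappa t), with z on the
  segment and kappa t the difference quotient of the curve, and continuity of dF brings them
  uniformly close to dF(y, h) for small t. Openness of W puts the whole segment into W for such
  t.\<close>

lemma vquot_curve:
  fixes F :: "(nat \<Rightarrow> 'y::lcs) \<Rightarrow> 'z::lcs"
  assumes W: "vopen k W"
    and der: "\<forall>x\<in>W. \<forall>h\<in>vpow k. \<exists>l. (vquot F x h \<longlongrightarrow> l) (at 0)"
    and cont: "continuous_on (vdom k W)
      (vderiv k F)"
    and y: "y \<in> W" and h: "h \<in> vpow k"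
    and \<gamma>: "\<And>t. \<gamma> t \<in> vpow k"
    and lim: "\<And>i. i < k \<Longrightarrow> ((\<lambda>t. (1 / t) *\<^sub>R (\<gamma> t i - y i)) \<longlongrightarrow> h i) (at (0::real))"
  shows "((\<lambda>t. (1 / t) *\<^sub>R (F (\<gamma> t) - F y)) \<longlongrightarrow> Lim (at 0) (vquot F y h)) (at 0)"
proof (rule topological_tendstoI)
  let ?D = "\<lambda>p. Lim (at 0) (vquot F (vfst k p) (vsnd k p))"
  let ?\<F> = "at (0::real) \<times>\<^sub>F principal {0..1::real}"
  obtain O' where O': "open O'" "W = vpow k \<inter> O'"
    using W by (auto simp: openin_open)
  have yk: "y \<in> vpow k" using y O' by auto
  define \<kappa> where "\<kappa> t = (\<lambda>i. if i < k then (1 / t) *\<^sub>R (\<gamma> t i - y i) else 0)" for t :: real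
  define z where "z = (\<lambda>(t, s::real) i. y i + s *\<^sub>R (\<gamma> t i - y i))"
  have \<kappa>_vpow: "\<kappa> t \<in> vpow k" for t by (simp add: \<kappa>_def vpow_def)
  have z_vpow: "z p \<in> vpow k" for p
    using \<gamma> yk by (auto simp: z_def vpow_def split: prod.split)
  have \<kappa>_lim: "((\<lambda>t. \<kappa> t i) \<longlongrightarrow> h i) (at 0)" for i
    using lim[of i] h by (cases "i < k") (auto simp: \<kappa>_def vpow_def)
  have tk: "\<gamma> t i - y i = t *\<^sub>R \<kappa> t i" if "t \<noteq> 0" for t i
    using that \<gamma>[of t] yk by (auto simp: \<kappa>_def vpow_def)
  have "((\<lambda>t. \<gamma> t i - y i) \<longlongrightarrow> 0) (at 0)" for i
  proof -
    have "((\<lambda>t. t *\<^sub>R \<kappa> t i) \<longlongrightarrow> 0 *\<^sub>R h i) (at 0)"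
      by (intro tendsto_scaleR_lcs \<kappa>_lim tendsto_ident_at)
    moreover have "\<forall>\<^sub>F t in at 0. t *\<^sub>R \<kappa> t i = \<gamma> t i - y i"
      using tk by (auto simp: eventually_at_filter)
    ultimately show ?thesis unfolding scaleR_zero_left by (rule Lim_transform_eventually)
  qed
  then have u_lim: "((\<lambda>(t, s). s *\<^sub>R (\<gamma> t i - y i)) \<longlongrightarrow> 0) ?\<F>" for i
    by (rule tendsto_scaleR_unit_interval)
  have zi: "((\<lambda>p. z p i) \<longlongrightarrow> y i) ?\<F>" for i
    using tendsto_add[OF tendsto_const[of "y i"] u_lim[of i]] by (simp add: z_def case_prod_unfold)
  then have z_lim: "(z \<longlongrightarrow> y) ?\<F>" by (rule tendsto_funI)
  have "\<forall>\<^sub>F p in ?\<F>. z p \<in> O'"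
    by (rule topological_tendstoD[OF z_lim O'(1)]) (use O'(2) y in simp)
  then have zW: "\<forall>\<^sub>F p in ?\<F>. z p \<in> W"
    by eventually_elim (simp add: O'(2) z_vpow)
  have fst_lim: "filterlim fst (at 0) ?\<F>" by (rule filterlim_fst)
  have "((\<lambda>p. vjoin k (z p) (\<kappa> (fst p)) i) \<longlongrightarrow> vjoin k y h i) ?\<F>" for i
    using zi[of i] filterlim_compose[OF \<kappa>_lim[of "i - k"] fst_lim]
    by (simp add: vjoin_def)
  then have "((\<lambda>p. vjoin k (z p) (\<kappa> (fst p))) \<longlongrightarrow> vjoin k y h) ?\<F>"
    by (rule tendsto_funI)
  then have D: "((\<lambda>p. ?D (vjoin k (z p) (\<kappa> (fst p)))) \<longlongrightarrow> ?D (vjoin k y h)) ?\<F>"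
  proof (rule continuous_on_tendsto_compose[OF cont])
    show "vjoin k y h \<in> (vdom k W)" using yk y by simp
    show "\<forall>\<^sub>F p in ?\<F>. vjoin k (z p) (\<kappa> (fst p)) \<in> (vdom k W)"
      using zW by eventually_elim (simp add: z_vpow)
  qed
  fix S assume "open S" "Lim (at 0) (vquot F y h) \<in> S"
  then obtain C where C: "open C" "Lim (at 0) (vquot F y h) \<in> C" "C \<subseteq> S"
    and cv: "convex C"
    by (rule convex_nhds_at)
  have "\<forall>\<^sub>F p in ?\<F>. ?D (vjoin k (z p) (\<kappa> (fst p))) \<in> C"
    by (rule topological_tendstoD[OF D C(1)]) (use C(2) yk h in simp)
  with zW have "\<forall>\<^sub>F p in ?\<F>. z (fst p, snd p) \<in> W \<and>
      Lim (at 0) (vquot F (z (fst p, snd p)) (\<kappa> (fst p))) \<in> C"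
    by eventually_elim (simp add: z_vpow \<kappa>_vpow)
  then have "\<forall>\<^sub>F t in at 0. \<forall>s\<in>{0..1}. z (t, s) \<in> W \<and> Lim (at 0) (vquot F (z (t, s)) (\<kappa> t)) \<in> C"
    by (rule eventually_prod_principalD)
  moreover have "\<forall>\<^sub>F t in at (0::real). t \<noteq> 0" by (simp add: eventually_at_filter)
  ultimately show "\<forall>\<^sub>F t in at 0. (1 / t) *\<^sub>R (F (\<gamma> t) - F y) \<in> S"
  proof eventually_elim
    case (elim t)
    \<comment> \<open>The factor 1/t makes c 1 - c 0 the quotient in question. Moving s by r moves z
      by (r t) kappa t, so the derivative of c at s is dF at z(t, s) in direction kappa t.\<close>
    define c where "c s = (1 / t) *\<^sub>R F (z (t, s))" for s
    have "((\<lambda>r. (1 / r) *\<^sub>R (c (s + r) - c s)) \<longlongrightarrow> Lim (at 0) (vquot F (z (t, s)) (\<kappa> t))) (at 0)"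
      if s: "0 \<le> s" "s \<le> 1" for s
    proof -
      obtain l where l: "(vquot F (z (t, s)) (\<kappa> t) \<longlongrightarrow> l) (at 0)"
        using elim(1) s der[rule_format, of "z (t, s)" "\<kappa> t"] \<kappa>_vpow[of t] by auto
      then have "(vquot F (z (t, s)) (\<kappa> t) \<longlongrightarrow> Lim (at 0) (vquot F (z (t, s)) (\<kappa> t))) (at 0)"
        using tendsto_Lim[OF trivial_limit_at l] by simp
      moreover have "filterlim (\<lambda>r. r * t) (at 0) (at 0)"
        using elim(2) tendsto_mult[OF tendsto_ident_at tendsto_const[of t], of 0 UNIV]
        by (simp add: filterlim_at eventually_at_filter)
      ultimately have "((\<lambda>r. vquot F (z (t, s)) (\<kappa> t) (r * t)) \<longlongrightarrow>
          Lim (at 0) (vquot F (z (t, s)) (\<kappa> t))) (at 0)"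
        by (rule filterlim_compose)
      moreover have "vquot F (z (t, s)) (\<kappa> t) (r * t) = (1 / r) *\<^sub>R (c (s + r) - c s)" for r
      proof -
        have "(\<lambda>i. z (t, s) i + (r * t) *\<^sub>R \<kappa> t i) = z (t, s + r)"
          using tk[OF elim(2)] by (auto simp: z_def fun_eq_iff algebra_simps)
        then show ?thesis
          by (simp add: vquot_def c_def algebra_simps)
      qed
      ultimately show ?thesis by simp
    qed
    then have "c 1 - c 0 \<in> C"
      by (rule mean_value_convex[OF _ C(1) _ cv]) (use elim(1) in auto)
    moreover have "z (t, 1) = \<gamma> t" "z (t, 0) = y" by (auto simp: z_def)
    then have "c 1 - c 0 = (1 / t) *\<^sub>R (F (\<gamma> t) - F y)"
      by (simp add: c_def scaleR_diff_right)
    ultimately show ?case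
      using C(3) by auto
  qed
qed

subsection \<open>Maps on powers\<close>

lemma Cpow_on_imp_continuous_on: "Cpow_on n m U F \<Longrightarrow> continuous_on U F"
  by (cases n) auto

lemma Cpow_on_SucD: "Cpow_on (Suc n) m U F \<Longrightarrow> Cpow_on n m U F"
proof (induction n arbitrary: m U F)
  case (Suc n)
  then show ?case
    using Suc.IH[of "2 * m"] unfolding Cpow_on.simps(2)[of "Suc n"] Cpow_on.simps(2)[of n m] by blast
qed simp

lemma Cpow_on_Suc_tendsto:
  assumes "Cpow_on (Suc n) m U F" "x \<in> U" "h \<in> vpow m"
  shows "(vquot F x h \<longlongrightarrow> Lim (at 0) (vquot F x h)) (at 0)"
proof -
  obtain l where "(vquot F x h \<longlongrightarrow> l) (at 0)"
    using assms by auto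
  then show ?thesis using tendsto_Lim[OF trivial_limit_at] by metis
qed

lemma Cpow_on_subset: "Cpow_on n m U F \<Longrightarrow> V \<subseteq> U \<Longrightarrow> Cpow_on n m V F"
proof (induction n arbitrary: m U V F)
  case (Suc n)
  then show ?case
    by (auto intro: continuous_on_subset
        intro!: Suc.IH[of _ "(vdom m U)" _ "(vdom m V)"])
qed (auto intro: continuous_on_subset)

lemma openin_vpow_double:
  fixes U :: "(nat \<Rightarrow> 'x::lcs) set"
  assumes "vopen m U"
  shows "vopen (2 * m) (vdom m U)"
proof -
  obtain O' where O': "open O'" "U = vpow m \<inter> O'"
    using assms by (auto simp: openin_open)
  have "open (vfst m -` O')"
    using continuous_on_vfst[of UNIV m] O'(1) by (rule open_vimage[rotated])
  moreover have "(vdom m U) = vpow (2 * m) \<inter> vfst m -` O'"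
    using O'(2) by auto
  ultimately show ?thesis by (auto simp: openin_open)
qed

lemma vpow_line: "x \<in> vpow m \<Longrightarrow> h \<in> vpow m \<Longrightarrow> (\<lambda>i. x i + t *\<^sub>R h i) \<in> vpow m"
  for x h :: "nat \<Rightarrow> 'x::lcs"
  by (simp add: vpow_def)

lemma eventually_line_in:
  fixes x h :: "nat \<Rightarrow> 'x::lcs"
  assumes U: "vopen m U" and x: "x \<in> U" and h: "h \<in> vpow m"
  shows "\<forall>\<^sub>F t in at (0::real). (\<lambda>i. x i + t *\<^sub>R h i) \<in> U"
proof -
  obtain O' where O': "open O'" "U = vpow m \<inter> O'"
    using U by (auto simp: openin_open)
  have "((\<lambda>t. x i + t *\<^sub>R h i) \<longlongrightarrow> x i) (at (0::real))" for i
    using tendsto_add[OF tendsto_const[of "x i"]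
        tendsto_scaleR_lcs[OF tendsto_ident_at[of 0 UNIV] tendsto_const[of "h i"]]] by simp
  then have "((\<lambda>t i. x i + t *\<^sub>R h i) \<longlongrightarrow> x) (at (0::real))"
    by (rule tendsto_funI)
  from topological_tendstoD[OF this O'(1)]
  have "\<forall>\<^sub>F t in at (0::real). (\<lambda>i. x i + t *\<^sub>R h i) \<in> O'" using x O'(2) by simp
  then show ?thesis
    by eventually_elim (use x h O'(2) vpow_line in blast)
qed

text \<open>\<open>Lim\<close> is a definite description, and eventually equal functions satisfy the
  same convergence statements; the equality therefore also covers the case in which neither limit
  exists.\<close>

lemma Lim_cong_eventually:
  "\<forall>\<^sub>F t in F. f t = g t \<Longrightarrow> Lim F f = Lim F g"
  unfolding t2_space_class.Lim_def by (simp cong: tendsto_cong)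

lemma vquot_cong:
  assumes "vopen m U" "x \<in> U" "h \<in> vpow m" "\<And>x. x \<in> U \<Longrightarrow> F x = F' x"
  shows "\<forall>\<^sub>F t in at 0. vquot F x h t = vquot F' x h t"
  using eventually_line_in[OF assms(1-3)]
  by eventually_elim (simp add: vquot_def assms)

text \<open>Openness keeps short segments from a point of U inside U, so both maps have the same
  difference quotients, and their derivatives agree on \<open>vdom m U\<close>, which is open
  again.\<close>

lemma Cpow_on_cong_open:
  assumes "vopen m U" "\<And>x. x \<in> U \<Longrightarrow> F x = F' x" "Cpow_on n m U F"
  shows "Cpow_on n m U F'"
  using assms
proof (induction n arbitrary: m U F F')
  case 0
  then show ?case by (simp cong: continuous_on_cong)
next
  case (Suc n)
  note q = vquot_cong[OF Suc.prems(1) _ _ Suc.prems(2)]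
  have "Cpow_on n (2 * m) (vdom m U)
       (vderiv m F')"
  proof (rule Suc.IH[OF openin_vpow_double[OF Suc.prems(1)]])
    show "Lim (at 0) (vquot F (vfst m x) (vsnd m x)) = Lim (at 0) (vquot F' (vfst m x) (vsnd m x))"
      if "x \<in> (vdom m U)" for x
      using that by (intro Lim_cong_eventually q) auto
  qed (use Suc.prems(3) in simp)
  moreover have "continuous_on U F'"
    using Suc.prems by (simp cong: continuous_on_cong)
  moreover have "\<exists>l. (vquot F' x h \<longlongrightarrow> l) (at 0)" if "x \<in> U" "h \<in> vpow m" for x h
    using iffD1[OF tendsto_cong[OF q[OF that]] Cpow_on_Suc_tendsto[OF Suc.prems(3) that]] by blast
  ultimately show ?case by simp
qed

lemma Cpow_on_local:
  assumes "U \<subseteq> vpow m"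
    and "\<And>x. x \<in> U \<Longrightarrow> \<exists>V. vopen m V \<and> x \<in> V \<and> Cpow_on n m V F"
  shows "Cpow_on n m U F"
  using assms
proof (induction n arbitrary: m U F)
  case (0 m U F)
  have "(F \<longlongrightarrow> F x) (at x within U)" if x: "x \<in> U" for x
  proof -
    obtain V where V: "vopen m V" "x \<in> V" "continuous_on V F"
      using 0(2)[OF x] by auto
    obtain O' where O': "open O'" "V = vpow m \<inter> O'"
      using V(1) by (auto simp: openin_open)
    have "(F \<longlongrightarrow> F x) (at x within U \<inter> V)"
      using V(2,3) x by (meson IntI continuous_on_def continuous_on_subset inf_le2)
    moreover have "at x within U \<inter> V = at x within U"
      by (rule at_within_nhd[of x O']) (use O' V(2) 0(1) in auto)
    ultimately show ?thesis by simp
  qed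
  then show ?case by (simp add: continuous_on_def)
next
  case (Suc n m U F)
  have "Cpow_on n (2 * m) (vdom m U)
       (vderiv m F)"
  proof (rule Suc.IH)
    fix p assume p: "p \<in> (vdom m U)"
    then obtain V where V: "vopen m V" "vfst m p \<in> V" "Cpow_on (Suc n) m V F"
      using Suc.prems(2) by blast
    then show "\<exists>V. vopen (2 * m) V \<and> p \<in> V \<and>
        Cpow_on n (2 * m) V (vderiv m F)"
      using p by (intro exI[of _ "(vdom m V)"] conjI openin_vpow_double) auto
  qed auto
  \<comment> \<open>Continuity on U is itself a local matter; it is read off from the induction
    hypothesis at the same m and the weaker order n.\<close>
  moreover have "Cpow_on n m U F"
  proof (rule Suc.IH[OF Suc.prems(1)])
    show "\<exists>V. vopen m V \<and> x \<in> V \<and> Cpow_on n m V F" if "x \<in> U" for x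
      using Suc.prems(2)[OF that] Cpow_on_SucD by blast
  qed
  then have "continuous_on U F" by (rule Cpow_on_imp_continuous_on)
  moreover have "\<exists>l. (vquot F x h \<longlongrightarrow> l) (at 0)" if "x \<in> U" "h \<in> vpow m" for x h
    using Suc.prems(2)[OF that(1)] that(2) by auto
  ultimately show ?case by simp
qed

section \<open>Pairs, linear maps and composition\<close>

lemma Cpow_on_Pair:
  assumes "vopen m U" "Cpow_on n m U F" "Cpow_on n m U F'"
  shows "Cpow_on n m U (\<lambda>p. (F p, F' p))"
  using assms
proof (induction n arbitrary: m U F F')
  case 0
  then show ?case by (simp add: continuous_on_Pair)
next
  case (Suc n)
  have q: "vquot (\<lambda>p. (F p, F' p)) x h = (\<lambda>t. (vquot F x h t, vquot F' x h t))" for x h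
    by (simp add: vquot_def fun_eq_iff)
  have lim: "(vquot (\<lambda>p. (F p, F' p)) x h \<longlongrightarrow>
      (Lim (at 0) (vquot F x h), Lim (at 0) (vquot F' x h))) (at 0)"
    if "x \<in> U" "h \<in> vpow m" for x h
    unfolding q using that Suc.prems(2,3) by (intro tendsto_Pair Cpow_on_Suc_tendsto)
  have "Cpow_on n (2 * m) (vdom m U)
       (\<lambda>p. Lim (at 0) (vquot (\<lambda>p. (F p, F' p)) (vfst m p) (vsnd m p)))"
  proof (rule Cpow_on_cong_open[OF openin_vpow_double[OF Suc.prems(1)]])
    show "Cpow_on n (2 * m) (vdom m U)
       (\<lambda>p. (Lim (at 0) (vquot F (vfst m p) (vsnd m p)), Lim (at 0) (vquot F' (vfst m p) (vsnd m p))))"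
      by (rule Suc.IH[OF openin_vpow_double[OF Suc.prems(1)]]) (use Suc.prems(2,3) in auto)
  qed (simp add: tendsto_Lim[OF trivial_limit_at lim])
  moreover have "continuous_on U (\<lambda>p. (F p, F' p))"
    using Suc.prems(2,3) by (intro continuous_on_Pair) auto
  ultimately show ?case
    using lim by auto
qed

text \<open>The derivative of F o L is dF o (L x L), again a composition with a linear map, so the
  induction closes for every set U. \<open>Cpow_on_comp\<close> uses the case L =
  \<open>vfst m\<close>, in which a function of x is viewed as a function of (x, h).\<close>

lemma Cpow_on_comp_linear:
  assumes L: "\<And>x. x \<in> vpow m \<Longrightarrow> L x \<in> vpow k"
    and lin: "\<And>x h t. x \<in> vpow m \<Longrightarrow> h \<in> vpow m \<Longrightarrow>
      L (\<lambda>i. x i + t *\<^sub>R h i) = (\<lambda>i. L x i + t *\<^sub>R L h i)"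
    and cont: "continuous_on (vpow m) L"
    and F: "Cpow_on n k U F"
  shows "Cpow_on n m {x \<in> vpow m. L x \<in> U} (\<lambda>x. F (L x))"
  using assms
proof (induction n arbitrary: m k L U F)
  case (0 m k L U F)
  then show ?case
    by (auto intro: continuous_on_compose2[of U F] continuous_on_subset)
next
  case (Suc n m k L U F)
  note L = Suc.prems(1) and lin = Suc.prems(2) and cont = Suc.prems(3)
  have q: "vquot (\<lambda>x. F (L x)) x h = vquot F (L x) (L h)" if "x \<in> vpow m" "h \<in> vpow m" for x h
    using that by (simp add: vquot_def fun_eq_iff lin)
  let ?L = "\<lambda>p. vjoin k (L (vfst m p)) (L (vsnd m p))"
  have "Cpow_on n (2 * m) {p \<in> vpow (2 * m). ?L p \<in> (vdom k U)}
       (\<lambda>p. (vderiv k F) (?L p))"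
  proof (rule Suc.IH)
    show "?L (\<lambda>i. x i + t *\<^sub>R h i) = (\<lambda>i. ?L x i + t *\<^sub>R ?L h i)" for x h :: "nat \<Rightarrow> 'a" and t
    proof -
      have "vfst m (\<lambda>i. x i + t *\<^sub>R h i) = (\<lambda>i. vfst m x i + t *\<^sub>R vfst m h i)"
        "vsnd m (\<lambda>i. x i + t *\<^sub>R h i) = (\<lambda>i. vsnd m x i + t *\<^sub>R vsnd m h i)"
        by (auto simp: vfst_def vsnd_def)
      then show ?thesis by (auto simp: lin vjoin_def)
    qed
    show "continuous_on (vpow (2 * m)) ?L"
      by (intro continuous_on_vjoin continuous_on_compose2[OF cont] continuous_on_vfst
          continuous_on_vsnd) auto
    show "Cpow_on n (2 * k) (vdom k U)
      (vderiv k F)" using Suc.prems(4) by simp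
  qed simp
  moreover have "{p \<in> vpow (2 * m). ?L p \<in> (vdom k U)} =
      {p \<in> vpow (2 * m). vfst m p \<in> {x \<in> vpow m. L x \<in> U}}"
    by (auto simp: L)
  ultimately have "Cpow_on n (2 * m) {p \<in> vpow (2 * m). vfst m p \<in> {x \<in> vpow m. L x \<in> U}}
       (\<lambda>p. Lim (at 0) (vquot (\<lambda>x. F (L x)) (vfst m p) (vsnd m p)))"
    by (simp add: q L)
  moreover have "continuous_on {x \<in> vpow m. L x \<in> U} (\<lambda>x. F (L x))"
    using Suc.prems(4) by (auto intro: continuous_on_compose2[of U F] continuous_on_subset[OF cont])
  ultimately show ?case
    using Suc.prems(4) L by (auto simp: q)
qed

text \<open>The difference quotient at x in direction h equals F h for all nonzero t, so the
  derivative sends (x, h) to F h and is linear and continuous again.\<close>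

lemma Cpow_on_linear:
  fixes F :: "(nat \<Rightarrow> 'x::lcs) \<Rightarrow> 'y::lcs"
  assumes "\<And>x h t. x \<in> vpow m \<Longrightarrow> h \<in> vpow m \<Longrightarrow> F (\<lambda>i. x i + t *\<^sub>R h i) = F x + t *\<^sub>R F h"
    and "continuous_on (vpow m) F" and "U \<subseteq> vpow m"
  shows "Cpow_on n m U F"
  using assms
proof (induction n arbitrary: m F U)
  case 0
  then show ?case by (auto intro: continuous_on_subset)
next
  case (Suc n)
  have lim: "(vquot F x h \<longlongrightarrow> F h) (at 0)" if "x \<in> vpow m" "h \<in> vpow m" for x h
    by (rule Lim_transform_eventually[of "\<lambda>t. F h"])
      (use that in \<open>auto simp: vquot_def Suc.prems(1) eventually_at_filter\<close>)
  have "Cpow_on n (2 * m) (vdom m U) (\<lambda>p. F (vsnd m p))"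
  proof (rule Suc.IH)
    fix x h :: "nat \<Rightarrow> 'x" and t
    have "vsnd m (\<lambda>i. x i + t *\<^sub>R h i) = (\<lambda>i. vsnd m x i + t *\<^sub>R vsnd m h i)"
      by (auto simp: vsnd_def)
    then show "F (vsnd m (\<lambda>i. x i + t *\<^sub>R h i)) = F (vsnd m x) + t *\<^sub>R F (vsnd m h)"
      by (simp add: Suc.prems(1))
  next
    show "continuous_on (vpow (2 * m)) (\<lambda>p. F (vsnd m p))"
      by (rule continuous_on_compose2[OF Suc.prems(2) continuous_on_vsnd]) auto
  qed auto
  then have "Cpow_on n (2 * m) (vdom m U)
       (vderiv m F)"
    by (simp add: tendsto_Lim[OF trivial_limit_at lim])
  then show ?case
    using Suc.prems(2,3) lim by (auto intro: continuous_on_subset)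
qed

lemma Cpow_on_const:
  fixes U :: "(nat \<Rightarrow> 'x::lcs) set" and c :: "'y::lcs"
  shows "Cpow_on n m U (\<lambda>p. c)"
proof (induction n arbitrary: m U c)
  case (Suc n)
  have "vquot (\<lambda>p. c) x h = (\<lambda>t. 0)" for x h :: "nat \<Rightarrow> 'x" and c :: 'y
    by (simp add: vquot_def fun_eq_iff)
  then show ?case using Suc.IH by (auto simp: tendsto_Lim[OF trivial_limit_at tendsto_const])
qed simp

text \<open>Stated for a family of k components because the derivative of F o f is dF o (f, df), a
  composition with 2 k components of one order less, to which the induction hypothesis
  applies.\<close>

lemma Cpow_on_comp:
  fixes f :: "nat \<Rightarrow> (nat \<Rightarrow> 'x::lcs) \<Rightarrow> 'y::lcs" and F :: "(nat \<Rightarrow> 'y) \<Rightarrow> 'z::lcs"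
  assumes "vopen m U" "vopen k W"
    and "\<And>i. i < k \<Longrightarrow> Cpow_on n m U (f i)"
    and "\<And>p. p \<in> U \<Longrightarrow> (\<lambda>i. if i < k then f i p else 0) \<in> W"
    and "Cpow_on n k W F"
  shows "Cpow_on n m U (\<lambda>p. F (\<lambda>i. if i < k then f i p else 0))"
  using assms
proof (induction n arbitrary: m k U W f F)
  case (0 m k U W f F)
  have "continuous_on U (\<lambda>p i. if i < k then f i p else 0)"
  proof (rule continuous_on_coordinatewise_then_product)
    show "continuous_on U (\<lambda>p. if i < k then f i p else 0)" for i
      using 0(3) by (cases "i < k") auto
  qed
  then show ?case
    using 0(4,5) by (auto intro: continuous_on_compose2[of W F])
next
  case (Suc n m k U W f F)
  note U = Suc.prems(1) and W = Suc.prems(2) and f = Suc.prems(3) and fW = Suc.prems(4)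
  have Um: "U \<subseteq> vpow m" using U by (auto simp: openin_open)
  let ?f = "\<lambda>p i. if i < k then f i p else 0"
  let ?D = "\<lambda>i p. Lim (at 0) (vquot (f i) (vfst m p) (vsnd m p))"
  let ?U = "(vdom m U)" and ?W = "(vdom k W)"
  \<comment> \<open>The first k components are those of f at the base point, used at one order less
    than available; the last k are their derivatives.\<close>
  define f' where "f' i p = (if i < k then f i (vfst m p) else ?D (i - k) p)" for i p
  have join: "(\<lambda>i. if i < 2 * k then f' i p else 0) =
      vjoin k (?f (vfst m p)) (\<lambda>i. if i < k then ?D i p else 0)" for p
    by (auto simp: f'_def vjoin_def fun_eq_iff)
  have vp: "?f p \<in> vpow k" "(\<lambda>i. if i < k then ?D i p else 0) \<in> vpow k" for p
    by (auto simp: vpow_def)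
  have lim: "(vquot (\<lambda>p. F (?f p)) (vfst m p) (vsnd m p) \<longlongrightarrow>
      Lim (at 0) (vquot F (?f (vfst m p)) (\<lambda>i. if i < k then ?D i p else 0))) (at 0)"
    if p: "p \<in> ?U" for p
    unfolding vquot_def[of "\<lambda>p. F (?f p)"]
  proof (rule vquot_curve[OF W])
    fix i assume "i < k"
    then have "(vquot (f i) (vfst m p) (vsnd m p) \<longlongrightarrow> ?D i p) (at 0)"
      using f[of i] p by (intro Cpow_on_Suc_tendsto) auto
    then show "((\<lambda>t. (1 / t) *\<^sub>R (?f (\<lambda>i. vfst m p i + t *\<^sub>R vsnd m p i) i - ?f (vfst m p) i)) \<longlongrightarrow>
        (if i < k then ?D i p else 0)) (at 0)"
      using \<open>i < k\<close> by (simp add: vquot_def[abs_def])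
  qed (use p fW Suc.prems(5) vp Cpow_on_imp_continuous_on in auto)
  have "Cpow_on n (2 * m) ?U (\<lambda>p. (vderiv k F)
      (\<lambda>i. if i < 2 * k then f' i p else 0))"
  proof (rule Suc.IH[OF openin_vpow_double[OF U] openin_vpow_double[OF W]])
    show "Cpow_on n (2 * k) ?W (vderiv k F)"
      using Suc.prems(5) by simp
    show "(\<lambda>i. if i < 2 * k then f' i p else 0) \<in> ?W" if "p \<in> ?U" for p
      using that fW vp by (simp add: join)
    fix i assume "i < 2 * k"
    show "Cpow_on n (2 * m) ?U (f' i)"
    proof (cases "i < k")
      case True
      have "Cpow_on n (2 * m) ?U (\<lambda>p. f i (vfst m p))"
      proof (rule Cpow_on_subset[OF Cpow_on_comp_linear[where L = "vfst m" and k = m and U = U and F = "f i"]])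
        show "Cpow_on n m U (f i)" using f[OF True] by (rule Cpow_on_SucD)
        show "vfst m (\<lambda>i. x i + t *\<^sub>R h i) = (\<lambda>i. vfst m x i + t *\<^sub>R vfst m h i)"
          for x h :: "nat \<Rightarrow> 'x" and t by (auto simp: vfst_def)
      qed (auto simp: continuous_on_vfst)
      then show ?thesis using True by (simp add: f'_def[abs_def])
    next
      case False
      then show ?thesis
        using f[of "i - k"] \<open>i < 2 * k\<close> by (simp add: f'_def[abs_def])
    qed
  qed
  then have "Cpow_on n (2 * m) ?U (\<lambda>p. Lim (at 0) (vquot (\<lambda>p. F (?f p)) (vfst m p) (vsnd m p)))"
    by (rule Cpow_on_cong_open[OF openin_vpow_double[OF U], rotated])
      (simp add: join vp tendsto_Lim[OF trivial_limit_at lim])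
  moreover have "Cpow_on n m U (\<lambda>p. F (?f p))"
    by (rule Suc.IH[OF U W]) (use f fW Suc.prems(5) Cpow_on_SucD in blast)+
  then have "continuous_on U (\<lambda>p. F (?f p))" by (rule Cpow_on_imp_continuous_on)
  moreover have "\<exists>l. (vquot (\<lambda>p. F (?f p)) x h \<longlongrightarrow> l) (at 0)" if "x \<in> U" "h \<in> vpow m" for x h
  proof -
    have "x \<in> vpow m" using that(1) Um by blast
    then show ?thesis using lim[of "vjoin m x h"] that by auto
  qed
  ultimately show ?case by simp
qed

subsection \<open>Operations on smooth maps\<close>

lemma openin_vpow_1: "open U \<Longrightarrow> vopen 1 {p \<in> vpow 1. p 0 \<in> U}"
  for U :: "'x::lcs set"
  using open_vimage[of U "\<lambda>p::nat \<Rightarrow> 'x. p 0"] continuous_on_coord[of UNIV 0]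
  by (auto simp: openin_open vimage_def)

lemma smooth_on_imp_continuous_on: "smooth_on U f \<Longrightarrow> continuous_on U f"
  unfolding smooth_on_def using C_on_imp_continuous_on by blast

lemma smooth_on_subset: "smooth_on U f \<Longrightarrow> V \<subseteq> U \<Longrightarrow> smooth_on V f"
  unfolding smooth_on_def C_on_def by (blast intro: Cpow_on_subset)

lemma smooth_on_cong_open:
  assumes "open U" "\<And>x. x \<in> U \<Longrightarrow> f x = g x" "smooth_on U f"
  shows "smooth_on U g"
  unfolding smooth_on_def C_on_def
proof
  fix n
  show "Cpow_on n 1 {p \<in> vpow 1. p 0 \<in> U} (\<lambda>p. g (p 0))"
    by (rule Cpow_on_cong_open[OF openin_vpow_1[OF assms(1)], where F = "\<lambda>p. f (p 0)"])
      (use assms(2,3) in \<open>auto simp: smooth_on_def C_on_def\<close>)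
qed

lemma smooth_on_local:
  assumes "\<And>x. x \<in> U \<Longrightarrow> \<exists>V. open V \<and> x \<in> V \<and> smooth_on V f"
  shows "smooth_on U f"
  unfolding smooth_on_def C_on_def
proof (intro allI Cpow_on_local)
  fix n and p :: "nat \<Rightarrow> 'a" assume p: "p \<in> {p \<in> vpow 1. p 0 \<in> U}"
  then obtain V where "open V" "p 0 \<in> V" "smooth_on V f" using assms by blast
  then show "\<exists>V. vopen 1 V \<and> p \<in> V \<and> Cpow_on n 1 V (\<lambda>p. f (p 0))"
    using p openin_vpow_1[of V]
    by (intro exI[of _ "{p \<in> vpow 1. p 0 \<in> V}"]) (auto simp: smooth_on_def C_on_def)
qed auto

lemma smooth_on_compose:
  assumes "open U" "open V" "smooth_on U f" "smooth_on V g" "f ` U \<subseteq> V"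
  shows "smooth_on U (\<lambda>x. g (f x))"
  unfolding smooth_on_def C_on_def
proof
  fix n
  have "Cpow_on n 1 {p \<in> vpow 1. p 0 \<in> U} (\<lambda>p. g ((\<lambda>i::nat. if i < 1 then f (p 0) else 0) 0))"
    by (rule Cpow_on_comp[where f = "\<lambda>i p. f (p 0)" and F = "\<lambda>q. g (q 0)",
          OF openin_vpow_1[OF assms(1)] openin_vpow_1[OF assms(2)]])
      (use assms(3-5) in \<open>auto simp: smooth_on_def C_on_def vpow_def\<close>)
  then show "Cpow_on n 1 {p \<in> vpow 1. p 0 \<in> U} (\<lambda>p. g (f (p 0)))" by simp
qed

lemma smooth_on_Pair:
  "open U \<Longrightarrow> smooth_on U f \<Longrightarrow> smooth_on U g \<Longrightarrow> smooth_on U (\<lambda>x. (f x, g x))"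
  unfolding smooth_on_def C_on_def by (intro allI Cpow_on_Pair openin_vpow_1) auto

lemma smooth_on_linear:
  assumes "\<And>x h t. f (x + t *\<^sub>R h) = f x + t *\<^sub>R f h" and "continuous_on UNIV f"
  shows "smooth_on U f"
  unfolding smooth_on_def C_on_def
  by (intro allI Cpow_on_linear continuous_on_compose2[OF assms(2)] continuous_on_coord)
    (auto simp: assms(1))

lemma smooth_on_id: "smooth_on U (\<lambda>x. x)"
  and smooth_on_fst: "smooth_on V fst"
  and smooth_on_snd: "smooth_on V snd"
  by (rule smooth_on_linear; simp add: continuous_on_fst continuous_on_snd)+

lemma smooth_on_const: "smooth_on U (\<lambda>x. c)"
  unfolding smooth_on_def C_on_def by (simp add: Cpow_on_const)

section \<open>Manifolds\<close>

abbreviation points :: "('m, 'v) manifold \<Rightarrow> 'm set" where "points M \<equiv> topspace (mtop M)"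
abbreviation mopen :: "('m, 'v) manifold \<Rightarrow> 'm set \<Rightarrow> bool" where "mopen M \<equiv> openin (mtop M)"

subsection \<open>Charts\<close>

text \<open>A homeomorphism of U onto an open set, expressed by open images and open preimages so
  that no subtopology occurs; \<open>chart_iff_homeomorphic\<close> relates it to the definition of
  a manifold.\<close>

definition chart :: "('m, 'v::lcs) manifold \<Rightarrow> 'm set \<Rightarrow> ('m \<Rightarrow> 'v) \<Rightarrow> bool" where
  "chart M U \<phi> \<longleftrightarrow> mopen M U \<and> inj_on \<phi> U \<and>
    (\<forall>S. mopen M S \<longrightarrow> S \<subseteq> U \<longrightarrow> open (\<phi> ` S)) \<and>
    (\<forall>S. open S \<longrightarrow> mopen M {x \<in> U. \<phi> x \<in> S})"

lemma chartD:
  assumes "chart M U \<phi>"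
  shows "mopen M U" "inj_on \<phi> U"
    "mopen M S \<Longrightarrow> S \<subseteq> U \<Longrightarrow> open (\<phi> ` S)"
    "open S' \<Longrightarrow> mopen M {x \<in> U. \<phi> x \<in> S'}"
  using assms unfolding chart_def by blast+

lemma chart_iff_homeomorphic:
  assumes U: "mopen M U"
  shows "chart M U \<phi> \<longleftrightarrow> open (\<phi> ` U) \<and>
    homeomorphic_map (subtopology (mtop M) U) (top_of_set (\<phi> ` U)) \<phi>"
proof
  have ts: "topspace (subtopology (mtop M) U) = U"
    using openin_subset[OF U] by (simp add: Int_absorb1)
  show "open (\<phi> ` U) \<and> homeomorphic_map (subtopology (mtop M) U) (top_of_set (\<phi> ` U)) \<phi>"
    if c: "chart M U \<phi>"
  proof
    show op: "open (\<phi> ` U)" using chartD(3)[OF c U] by simp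
    show "homeomorphic_map (subtopology (mtop M) U) (top_of_set (\<phi> ` U)) \<phi>"
    proof (rule bijective_open_imp_homeomorphic_map)
      show "continuous_map (subtopology (mtop M) U) (top_of_set (\<phi> ` U)) \<phi>"
        unfolding continuous_map_def
      proof (intro conjI allI impI)
        fix S assume "openin (top_of_set (\<phi> ` U)) S"
        then have "open S" using op by (simp add: openin_open_eq)
        then have "mopen M {x \<in> U. \<phi> x \<in> S}" by (rule chartD(4)[OF c])
        then show "openin (subtopology (mtop M) U) {x \<in> topspace (subtopology (mtop M) U). \<phi> x \<in> S}"
          unfolding ts by (simp add: openin_open_subtopology[OF U])
      qed (simp add: ts)
      show "open_map (subtopology (mtop M) U) (top_of_set (\<phi> ` U)) \<phi>"
        unfolding open_map_def openin_open_subtopology[OF U]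
        using chartD(3)[OF c] op by (auto simp: openin_open_eq)
    qed (use ts chartD(2)[OF c] in auto)
  qed
  show "chart M U \<phi>"
    if h: "open (\<phi> ` U) \<and> homeomorphic_map (subtopology (mtop M) U) (top_of_set (\<phi> ` U)) \<phi>"
    unfolding chart_def
  proof (intro conjI allI impI U)
    show "inj_on \<phi> U"
      using h homeomorphic_imp_injective_map ts by metis
    fix S assume "mopen M S" "S \<subseteq> U"
    then have "openin (top_of_set (\<phi> ` U)) (\<phi> ` S)"
      using h homeomorphic_imp_open_map unfolding open_map_def
      by (metis openin_open_subtopology[OF U])
    then show "open (\<phi> ` S)" using h openin_open_trans by blast
  next
    fix S :: "'b set" assume "open S"
    then have "openin (subtopology (mtop M) U) {x \<in> topspace (subtopology (mtop M) U). \<phi> x \<in> \<phi> ` U \<inter> S}"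
      using h homeomorphic_imp_continuous_map[of "subtopology (mtop M) U" "top_of_set (\<phi> ` U)" \<phi>]
      by (intro openin_continuous_map_preimage) auto
    moreover have "{x \<in> topspace (subtopology (mtop M) U). \<phi> x \<in> \<phi> ` U \<inter> S} = {x \<in> U. \<phi> x \<in> S}"
      unfolding ts by auto
    ultimately show "mopen M {x \<in> U. \<phi> x \<in> S}"
      by (simp add: openin_open_subtopology[OF U])
  qed
qed

lemma manifold_iff:
  "manifold M \<longleftrightarrow> Hausdorff_space (mtop M) \<and> \<Union>(fst ` atlas M) = points M \<and>
    (\<forall>U \<phi>. (U, \<phi>) \<in> atlas M \<longrightarrow> chart M U \<phi>) \<and>
    (\<forall>U \<phi> V \<psi>. (U, \<phi>) \<in> atlas M \<longrightarrow> (V, \<psi>) \<in> atlas M \<longrightarrow>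
      smooth_on (\<phi> ` (U \<inter> V)) (\<lambda>x. \<psi> (inv_into U \<phi> x)))"
proof -
  have ball: "(\<forall>(U, \<phi>)\<in>X. Q U \<phi>) \<longleftrightarrow> (\<forall>U \<phi>. (U, \<phi>) \<in> X \<longrightarrow> Q U \<phi>)" for X :: "('x \<times> 'y) set" and Q
    by auto
  have eq: "(mopen M U \<and> open (\<phi> ` U) \<and>
      homeomorphic_map (subtopology (mtop M) U) (top_of_set (\<phi> ` U)) \<phi>) = chart M U \<phi>" for U \<phi>
    using chart_iff_homeomorphic[of M U \<phi>] chartD(1)[of M U \<phi>] by blast
  then show ?thesis
    unfolding manifold_def ball eq by simp
qed

lemma manifold_chart: "manifold M \<Longrightarrow> (U, \<phi>) \<in> atlas M \<Longrightarrow> chart M U \<phi>"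
  and manifold_Hausdorff: "manifold M \<Longrightarrow> Hausdorff_space (mtop M)"
  and manifold_transition: "manifold M \<Longrightarrow> (U, \<phi>) \<in> atlas M \<Longrightarrow> (V, \<psi>) \<in> atlas M \<Longrightarrow>
    smooth_on (\<phi> ` (U \<inter> V)) (\<lambda>x. \<psi> (inv_into U \<phi> x))"
  unfolding manifold_iff by auto

lemma manifold_chart_at:
  assumes "manifold M" "x \<in> points M"
  obtains U \<phi> where "(U, \<phi>) \<in> atlas M" "x \<in> U"
proof -
  have "x \<in> \<Union> (fst ` atlas M)"
    using assms by (simp add: manifold_iff)
  then show ?thesis using that by auto
qed

lemma chart_subset_topspace: "chart M U \<phi> \<Longrightarrow> U \<subseteq> points M"
  by (simp add: chartD(1) openin_subset)

subsection \<open>Smoothness at a point\<close>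

text \<open>Smoothness of the germ of f at x. It speaks of a neighbourhood S and is thus an open
  condition in x. It mentions one pair of charts and no continuity; \<open>smooth_at_charts\<close>
  and \<open>smooth_at_continuous\<close> recover arbitrary charts and continuity.\<close>

definition smooth_at ::
  "('m, 'v::lcs) manifold \<Rightarrow> ('n, 'w::lcs) manifold \<Rightarrow> 'm \<Rightarrow> ('m \<Rightarrow> 'n) \<Rightarrow> bool" where
  "smooth_at M N x f \<longleftrightarrow> (\<exists>U \<phi> V \<psi> S. (U, \<phi>) \<in> atlas M \<and> (V, \<psi>) \<in> atlas N \<and>
    mopen M S \<and> x \<in> S \<and> S \<subseteq> U \<and> f ` S \<subseteq> V \<and>
    smooth_on (\<phi> ` S) (\<lambda>z. \<psi> (f (inv_into U \<phi> z))))"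

lemma smooth_atI:
  assumes "(U, \<phi>) \<in> atlas M" "(V, \<psi>) \<in> atlas N" "mopen M S" "x \<in> S" "S \<subseteq> U" "f ` S \<subseteq> V"
    and "smooth_on (\<phi> ` S) (\<lambda>z. \<psi> (f (inv_into U \<phi> z)))"
  shows "smooth_at M N x f"
  unfolding smooth_at_def using assms by blast

lemma smooth_at_topspace:
  assumes "manifold M" "manifold N" "smooth_at M N x f"
  shows "x \<in> points M" "f x \<in> points N"
  using assms chart_subset_topspace manifold_chart unfolding smooth_at_def by blast+

lemma chart_preimage_open:
  assumes M: "chart M U \<phi>" and N: "chart N V \<psi>" and S: "mopen M S" "S \<subseteq> U" "f ` S \<subseteq> V"
    and f: "smooth_on (\<phi> ` S) (\<lambda>z. \<psi> (f (inv_into U \<phi> z)))" and W: "mopen N W"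
  shows "mopen M {x \<in> S. f x \<in> W}"
proof -
  let ?h = "\<lambda>z. \<psi> (f (inv_into U \<phi> z))"
  let ?T = "\<phi> ` S \<inter> ?h -` (\<psi> ` (V \<inter> W))"
  have "open ?T"
    using smooth_on_imp_continuous_on[OF f] chartD(3)[OF M S(1,2)]
    by (rule continuous_open_preimage)
      (rule chartD(3)[OF N openin_Int[OF chartD(1)[OF N] W]], blast)
  then have "mopen M {x \<in> U. \<phi> x \<in> ?T}" by (rule chartD(4)[OF M])
  moreover have "{x \<in> U. \<phi> x \<in> ?T} = {x \<in> S. f x \<in> W}"
  proof -
    have 1: "\<phi> x \<in> \<phi> ` S \<longleftrightarrow> x \<in> S" if "x \<in> U" for x
      using that S(2) chartD(2)[OF M] by (rule_tac inj_on_image_mem_iff)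
    have 2: "?h (\<phi> x) \<in> \<psi> ` (V \<inter> W) \<longleftrightarrow> f x \<in> W" if "x \<in> S" for x
    proof -
      have "f x \<in> V" using that S(3) by blast
      moreover have "inv_into U \<phi> (\<phi> x) = x"
        using that S(2) chartD(2)[OF M] by auto
      ultimately show ?thesis using inj_on_image_mem_iff[OF chartD(2)[OF N], of "f x" "V \<inter> W"] by auto
    qed
    show ?thesis using 1 2 S(2) by auto
  qed
  ultimately show ?thesis by simp
qed

lemma smooth_at_continuous:
  assumes "manifold M" "manifold N" "smooth_at M N x f" "mopen N W" "f x \<in> W"
  obtains S where "mopen M S" "x \<in> S" "f ` S \<subseteq> W"
proof -
  obtain U \<phi> V \<psi> S where *: "(U, \<phi>) \<in> atlas M" "(V, \<psi>) \<in> atlas N"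
    "mopen M S" "x \<in> S" "S \<subseteq> U" "f ` S \<subseteq> V"
    "smooth_on (\<phi> ` S) (\<lambda>z. \<psi> (f (inv_into U \<phi> z)))"
    using assms(3) unfolding smooth_at_def by blast
  have "mopen M {x \<in> S. f x \<in> W}"
    using chart_preimage_open[OF manifold_chart[OF assms(1) *(1)] manifold_chart[OF assms(2) *(2)]
        *(3,5,6,7) assms(4)] .
  then show ?thesis using that[of "{x \<in> S. f x \<in> W}"] *(4) assms(5) by auto
qed

lemma smooth_at_nearby:
  assumes "smooth_at M N x f"
  obtains S where "mopen M S" "x \<in> S" "\<And>y. y \<in> S \<Longrightarrow> smooth_at M N y f"
  using assms unfolding smooth_at_def by meson

text \<open>The coordinate expression in the prescribed charts is the known one composed with a
  transition map on either side; S is cut down until all four chart domains are respected.\<close>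

lemma smooth_at_charts:
  assumes M: "manifold M" and N: "manifold N" and f: "smooth_at M N x f"
    and U: "(U, \<phi>) \<in> atlas M" "x \<in> U" and V: "(V, \<psi>) \<in> atlas N" "f x \<in> V"
  obtains S where "mopen M S" "x \<in> S" "S \<subseteq> U" "f ` S \<subseteq> V"
    "smooth_on (\<phi> ` S) (\<lambda>z. \<psi> (f (inv_into U \<phi> z)))"
proof -
  obtain U' \<phi>' V' \<psi>' S' where *: "(U', \<phi>') \<in> atlas M" "(V', \<psi>') \<in> atlas N"
    "mopen M S'" "x \<in> S'" "S' \<subseteq> U'" "f ` S' \<subseteq> V'"
    and h: "smooth_on (\<phi>' ` S') (\<lambda>z. \<psi>' (f (inv_into U' \<phi>' z)))"
    using f unfolding smooth_at_def by blast
  note cU = manifold_chart[OF M U(1)] and cU' = manifold_chart[OF M *(1)]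
    and cV = manifold_chart[OF N V(1)] and cV' = manifold_chart[OF N *(2)]
  define S where "S = {x \<in> S'. f x \<in> V} \<inter> U"
  have S: "mopen M S"
    unfolding S_def
    by (intro openin_Int chart_preimage_open[OF cU' cV' *(3,5,6) h chartD(1)[OF cV]] chartD(1)[OF cU])
  have inv: "inv_into U \<phi> (\<phi> y) = y" "inv_into U' \<phi>' (\<phi>' y) = y" "inv_into V' \<psi>' (\<psi>' (f y)) = f y"
    if "y \<in> S" for y
    using that chartD(2)[OF cU] chartD(2)[OF cU'] chartD(2)[OF cV'] *(5,6) unfolding S_def by auto
  have op: "open (\<phi> ` S)" "open (\<phi>' ` S)" "open (\<psi>' ` (V' \<inter> V))"
    using chartD(3)[OF cU S] chartD(3)[OF cU' S] *(5)
      chartD(3)[OF cV' openin_Int[OF chartD(1)[OF cV'] chartD(1)[OF cV]]]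
    unfolding S_def by auto
  have 1: "smooth_on (\<phi> ` S) (\<lambda>z. \<phi>' (inv_into U \<phi> z))"
    by (rule smooth_on_subset[OF manifold_transition[OF M U(1) *(1)]]) (use *(5) in \<open>auto simp: S_def\<close>)
  have 2: "smooth_on (\<phi>' ` S) (\<lambda>z. \<psi>' (f (inv_into U' \<phi>' z)))"
    by (rule smooth_on_subset[OF h]) (auto simp: S_def)
  have 3: "smooth_on (\<psi>' ` (V' \<inter> V)) (\<lambda>z. \<psi> (inv_into V' \<psi>' z))"
    by (rule manifold_transition[OF N *(2) V(1)])
  have 4: "smooth_on (\<phi> ` S) (\<lambda>z. \<psi>' (f (inv_into U' \<phi>' (\<phi>' (inv_into U \<phi> z)))))"
    by (rule smooth_on_compose[OF op(1,2) 1 2]) (auto simp: inv)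
  have "smooth_on (\<phi> ` S) (\<lambda>z. \<psi> (inv_into V' \<psi>' (\<psi>' (f (inv_into U' \<phi>' (\<phi>' (inv_into U \<phi> z)))))))"
    by (rule smooth_on_compose[OF op(1,3) 4 3]) (use *(6) in \<open>auto simp: inv S_def\<close>)
  then have "smooth_on (\<phi> ` S) (\<lambda>z. \<psi> (f (inv_into U \<phi> z)))"
    by (rule smooth_on_cong_open[OF op(1), rotated]) (auto simp: inv)
  then show ?thesis
    using that[of S] S *(4) U(2) V(2) by (auto simp: S_def)
qed

lemma smooth_at_cong:
  assumes M: "manifold M" and S: "mopen M S" "x \<in> S" "\<And>y. y \<in> S \<Longrightarrow> f y = g y"
    and f: "smooth_at M N x f"
  shows "smooth_at M N x g"
proof -
  obtain U \<phi> V \<psi> T where *: "(U, \<phi>) \<in> atlas M" "(V, \<psi>) \<in> atlas N"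
    "mopen M T" "x \<in> T" "T \<subseteq> U" "f ` T \<subseteq> V"
    "smooth_on (\<phi> ` T) (\<lambda>z. \<psi> (f (inv_into U \<phi> z)))"
    using f unfolding smooth_at_def by blast
  note c = manifold_chart[OF M *(1)]
  have o: "mopen M (S \<inter> T)" using S *(3) by blast
  have "smooth_on (\<phi> ` (S \<inter> T)) (\<lambda>z. \<psi> (f (inv_into U \<phi> z)))"
    by (rule smooth_on_subset[OF *(7)]) auto
  then have "smooth_on (\<phi> ` (S \<inter> T)) (\<lambda>z. \<psi> (g (inv_into U \<phi> z)))"
  proof (rule smooth_on_cong_open[rotated 2])
    show "open (\<phi> ` (S \<inter> T))" by (rule chartD(3)[OF c o]) (use *(5) in auto)
    show "\<psi> (f (inv_into U \<phi> z)) = \<psi> (g (inv_into U \<phi> z))" if z: "z \<in> \<phi> ` (S \<inter> T)" for z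
    proof -
      obtain y where y: "z = \<phi> y" "y \<in> S \<inter> T" using z by blast
      then have "inv_into U \<phi> z = y" using *(5) chartD(2)[OF c] by auto
      then show ?thesis using S(3) y by simp
    qed
  qed
  moreover have "g ` (S \<inter> T) \<subseteq> V"
  proof
    fix w assume "w \<in> g ` (S \<inter> T)"
    then obtain y where "w = g y" "y \<in> S" "y \<in> T" by blast
    then show "w \<in> V" using S(3)[of y] *(6) by (metis image_subset_iff)
  qed
  ultimately show ?thesis
    unfolding smooth_at_def using * o S(2) by (meson IntI le_infI2)
qed

lemma smooth_at_eqI:
  assumes "manifold M" "smooth_at M N x f" "\<And>y. y \<in> points M \<Longrightarrow> f y = g y"
  shows "smooth_at M N x g"
proof (rule smooth_at_cong[OF assms(1) openin_topspace _ assms(3,2)])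
  show "x \<in> points M"
    using assms(2) openin_subset unfolding smooth_at_def by blast
qed

lemma smooth_at_compose:
  assumes M: "manifold M" and N: "manifold N" and P: "manifold P"
    and f: "smooth_at M N x f" and g: "smooth_at N P (f x) g"
  shows "smooth_at M P x (\<lambda>y. g (f y))"
proof -
  obtain V \<psi> W \<theta> T where *: "(V, \<psi>) \<in> atlas N" "(W, \<theta>) \<in> atlas P"
    "mopen N T" "f x \<in> T" "T \<subseteq> V" "g ` T \<subseteq> W"
    and g': "smooth_on (\<psi> ` T) (\<lambda>z. \<theta> (g (inv_into V \<psi> z)))"
    using g unfolding smooth_at_def by blast
  obtain U \<phi> where U: "(U, \<phi>) \<in> atlas M" "x \<in> U"
    by (rule manifold_chart_at[OF M smooth_at_topspace(1)[OF M N f]])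
  obtain S' where S': "mopen M S'" "x \<in> S'" "S' \<subseteq> U" "f ` S' \<subseteq> V"
    and f': "smooth_on (\<phi> ` S') (\<lambda>z. \<psi> (f (inv_into U \<phi> z)))"
    by (rule smooth_at_charts[OF M N f U *(1)]) (use *(4,5) in auto)
  note cU = manifold_chart[OF M U(1)] and cV = manifold_chart[OF N *(1)]
  define S where "S = {x \<in> S'. f x \<in> T}"
  have S: "mopen M S"
    unfolding S_def by (rule chart_preimage_open[OF cU cV S'(1,3,4) f' *(3)])
  have inv: "inv_into U \<phi> (\<phi> y) = y" "inv_into V \<psi> (\<psi> (f y)) = f y" if "y \<in> S" for y
    using that chartD(2)[OF cU] chartD(2)[OF cV] S'(3,4) unfolding S_def by auto
  have op: "open (\<phi> ` S)" "open (\<psi> ` T)"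
    using chartD(3)[OF cU S] chartD(3)[OF cV *(3,5)] S'(3) unfolding S_def by auto
  have "smooth_on (\<phi> ` S) (\<lambda>z. \<psi> (f (inv_into U \<phi> z)))"
    by (rule smooth_on_subset[OF f']) (auto simp: S_def)
  then have "smooth_on (\<phi> ` S) (\<lambda>z. \<theta> (g (inv_into V \<psi> (\<psi> (f (inv_into U \<phi> z))))))"
    by (rule smooth_on_compose[OF op _ g']) (auto simp: inv S_def)
  then have "smooth_on (\<phi> ` S) (\<lambda>z. \<theta> (g (f (inv_into U \<phi> z))))"
    by (rule smooth_on_cong_open[OF op(1), rotated]) (auto simp: inv)
  moreover have "(\<lambda>y. g (f y)) ` S \<subseteq> W" "S \<subseteq> U" "x \<in> S"
    using *(4,6) S' by (auto simp: S_def)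
  ultimately show ?thesis
    unfolding smooth_at_def using U(1) *(2) S by blast
qed

lemma smooth_at_id:
  assumes M: "manifold M" and x: "x \<in> points M"
  shows "smooth_at M M x (\<lambda>y. y)"
proof -
  obtain U \<phi> where U: "(U, \<phi>) \<in> atlas M" "x \<in> U"
    by (rule manifold_chart_at[OF M x])
  show ?thesis
    by (rule smooth_atI[OF U(1) U(1) chartD(1)[OF manifold_chart[OF M U(1)]] U(2)])
      (use manifold_transition[OF M U(1) U(1)] in auto)
qed

lemma smooth_at_const:
  assumes M: "manifold M" and N: "manifold N" and x: "x \<in> points M"
    and y: "y \<in> points N"
  shows "smooth_at M N x (\<lambda>_. y)"
proof -
  obtain U \<phi> where U: "(U, \<phi>) \<in> atlas M" "x \<in> U"
    by (rule manifold_chart_at[OF M x])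
  obtain V \<psi> where V: "(V, \<psi>) \<in> atlas N" "y \<in> V"
    by (rule manifold_chart_at[OF N y])
  show ?thesis
    by (rule smooth_atI[OF U(1) V(1) chartD(1)[OF manifold_chart[OF M U(1)]] U(2)])
      (use V(2) in \<open>auto simp: smooth_on_const\<close>)
qed

text \<open>Trades the global definition, with its continuity and its quantifier over all pairs of
  charts, for germs, which compose without any bookkeeping of domains.\<close>

lemma smooth_map_iff:
  assumes M: "manifold M" and N: "manifold N"
  shows "smooth_map M N f \<longleftrightarrow> (\<forall>x\<in>points M. smooth_at M N x f)"
proof
  assume f: "smooth_map M N f"
  show "\<forall>x\<in>points M. smooth_at M N x f"
  proof
    fix x assume x: "x \<in> points M"
    obtain U \<phi> where U: "(U, \<phi>) \<in> atlas M" "x \<in> U"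
      by (rule manifold_chart_at[OF M x])
    have c: "continuous_map (mtop M) (mtop N) f" using f by (simp add: smooth_map_def)
    then have "f x \<in> points N" using x by (auto simp: continuous_map_def)
    then obtain V \<psi> where V: "(V, \<psi>) \<in> atlas N" "f x \<in> V"
      using manifold_chart_at[OF N] by blast
    note cU = manifold_chart[OF M U(1)] and cV = manifold_chart[OF N V(1)]
    have "mopen M (U \<inter> {x \<in> points M. f x \<in> V})"
      by (intro openin_Int chartD(1)[OF cU] openin_continuous_map_preimage[OF c chartD(1)[OF cV]])
    moreover have "U \<inter> {x \<in> points M. f x \<in> V} = U \<inter> f -` V"
      using chart_subset_topspace[OF cU] by auto
    moreover have "smooth_on (\<phi> ` (U \<inter> f -` V)) (\<lambda>x. \<psi> (f (inv_into U \<phi> x)))"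
      using f U(1) V(1) by (fastforce simp: smooth_map_def)
    ultimately show "smooth_at M N x f"
      using U V by (intro smooth_atI[OF U(1) V(1), where S = "U \<inter> f -` V"]) auto
  qed
next
  assume f: "\<forall>x\<in>points M. smooth_at M N x f"
  show "smooth_map M N f"
  proof -
    have 1: "continuous_map (mtop M) (mtop N) f"
      unfolding continuous_map_def
    proof (intro conjI allI impI)
      show "f \<in> points M \<rightarrow> points N"
        using f smooth_at_topspace(2)[OF M N] by auto
      fix W assume W: "mopen N W"
      show "mopen M {x \<in> points M. f x \<in> W}"
      proof (subst openin_subopen, clarify)
        fix x assume "x \<in> points M" "f x \<in> W"
        then obtain S where "mopen M S" "x \<in> S" "f ` S \<subseteq> W"
          using smooth_at_continuous[OF M N _ W] f by blast
        then show "\<exists>T. mopen M T \<and> x \<in> T \<and> T \<subseteq> {x \<in> points M. f x \<in> W}"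
          using openin_subset by blast
      qed
    qed
    have 2: "smooth_on (\<phi> ` (U \<inter> f -` V)) (\<lambda>x. \<psi> (f (inv_into U \<phi> x)))"
      if U: "(U, \<phi>) \<in> atlas M" and V: "(V, \<psi>) \<in> atlas N" for U \<phi> V \<psi>
    proof (rule smooth_on_local)
      note cU = manifold_chart[OF M U(1)]
      fix z assume "z \<in> \<phi> ` (U \<inter> f -` V)"
      then obtain x where x: "z = \<phi> x" "x \<in> U" "f x \<in> V" by auto
      then have fx: "smooth_at M N x f" using f chart_subset_topspace[OF cU] by auto
      obtain S where "mopen M S" "x \<in> S" "S \<subseteq> U"
        "smooth_on (\<phi> ` S) (\<lambda>z. \<psi> (f (inv_into U \<phi> z)))"
        by (rule smooth_at_charts[OF M N fx U x(2) V x(3)])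
      then show "\<exists>T. open T \<and> z \<in> T \<and> smooth_on T (\<lambda>x. \<psi> (f (inv_into U \<phi> x)))"
        using x chartD(3)[OF cU] by blast
    qed
    show ?thesis unfolding smooth_map_def using 1 2 by auto
  qed
qed

subsection \<open>Open submanifolds\<close>

lemma topspace_open_submfd [simp]:
  "points (open_submfd M W) = points M \<inter> W"
  by (simp add: open_submfd_def)

lemma openin_open_submfd:
  "mopen M W \<Longrightarrow> mopen (open_submfd M W) S \<longleftrightarrow> mopen M S \<and> S \<subseteq> W"
  by (simp add: open_submfd_def openin_open_subtopology)

lemma atlas_open_submfd: "(U, \<phi>) \<in> atlas M \<Longrightarrow> (U \<inter> W, \<phi>) \<in> atlas (open_submfd M W)"
  by (force simp: open_submfd_def)

lemma manifold_open_submfd: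
  assumes M: "manifold M" and W: "mopen M W"
  shows "manifold (open_submfd M W)"
  unfolding manifold_iff
proof (intro conjI allI impI)
  show "Hausdorff_space (mtop (open_submfd M W))"
    using manifold_Hausdorff[OF M] by (simp add: open_submfd_def Hausdorff_space_subtopology)
  show "\<Union> (fst ` atlas (open_submfd M W)) = points (open_submfd M W)"
    using M unfolding manifold_iff by (auto simp: open_submfd_def image_image case_prod_unfold)
next
  fix U' \<phi> assume "(U', \<phi>) \<in> atlas (open_submfd M W)"
  then obtain U where U: "(U, \<phi>) \<in> atlas M" "U' = U \<inter> W"
    by (auto simp: open_submfd_def)
  note c = manifold_chart[OF M U(1)]
  show "chart (open_submfd M W) U' \<phi>"
    unfolding chart_def openin_open_submfd[OF W] U(2)
  proof (intro conjI allI impI)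
    show "mopen M (U \<inter> W)" using chartD(1)[OF c] W by blast
    show "inj_on \<phi> (U \<inter> W)" using chartD(2)[OF c] by (rule inj_on_subset) blast
    show "open (\<phi> ` S)" if "mopen M S \<and> S \<subseteq> W" "S \<subseteq> U \<inter> W" for S
      using chartD(3)[OF c] that by blast
    show "mopen M {x \<in> U \<inter> W. \<phi> x \<in> S}" if "open S" for S
    proof -
      have "{x \<in> U \<inter> W. \<phi> x \<in> S} = {x \<in> U. \<phi> x \<in> S} \<inter> W" by auto
      then show ?thesis using chartD(4)[OF c that] W by auto
    qed
  qed auto
next
  fix U' \<phi> V' \<psi>
  assume "(U', \<phi>) \<in> atlas (open_submfd M W)" "(V', \<psi>) \<in> atlas (open_submfd M W)"
  then obtain U V where U: "(U, \<phi>) \<in> atlas M" "U' = U \<inter> W" and V: "(V, \<psi>) \<in> atlas M" "V' = V \<inter> W"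
    by (auto simp: open_submfd_def)
  note c = manifold_chart[OF M U(1)] and d = manifold_chart[OF M V(1)]
  have inj: "inj_on \<phi> (U \<inter> W)" using chartD(2)[OF c] by (rule inj_on_subset) blast
  show "smooth_on (\<phi> ` (U' \<inter> V')) (\<lambda>x. \<psi> (inv_into U' \<phi> x))"
  proof (rule smooth_on_cong_open)
    show "open (\<phi> ` (U' \<inter> V'))"
      unfolding U V by (rule chartD(3)[OF c]) (use chartD(1)[OF c] chartD(1)[OF d] W in auto)
    show "smooth_on (\<phi> ` (U' \<inter> V')) (\<lambda>x. \<psi> (inv_into U \<phi> x))"
      by (rule smooth_on_subset[OF manifold_transition[OF M U(1) V(1)]]) (auto simp: U V)
    show "\<psi> (inv_into U \<phi> x) = \<psi> (inv_into U' \<phi> x)" if "x \<in> \<phi> ` (U' \<inter> V')" for x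
      using that inj chartD(2)[OF c] by (auto simp: U V)
  qed
qed

text \<open>The charts of the submanifold are charts of M with a smaller domain, so both maps are
  the identity in coordinates. Germs can thereby be moved freely between M and W.\<close>

lemma smooth_at_open_submfd_id:
  assumes M: "manifold M" and W: "mopen M W" "x \<in> W"
  shows "smooth_at (open_submfd M W) M x (\<lambda>y. y)" "smooth_at M (open_submfd M W) x (\<lambda>y. y)"
proof -
  obtain U \<phi> where U: "(U, \<phi>) \<in> atlas M" "x \<in> U"
    using manifold_chart_at[OF M] W openin_subset by blast
  note c = manifold_chart[OF M U(1)]
  have inj: "inj_on \<phi> (U \<inter> W)" using chartD(2)[OF c] by (rule inj_on_subset) blast
  have o: "mopen M (U \<inter> W)" using chartD(1)[OF c] W by blast
  have op: "open (\<phi> ` (U \<inter> W))" using chartD(3)[OF c o] by blast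
  have "smooth_on (\<phi> ` (U \<inter> W)) (\<lambda>z. \<phi> (inv_into (U \<inter> W) \<phi> z))"
    "smooth_on (\<phi> ` (U \<inter> W)) (\<lambda>z. \<phi> (inv_into U \<phi> z))"
    by (rule smooth_on_cong_open[OF op _ smooth_on_id]; use inj chartD(2)[OF c] in auto)+
  note s = this
  show "smooth_at (open_submfd M W) M x (\<lambda>y. y)"
    using U(2) W o s(1) openin_open_submfd[OF W(1)]
    by (intro smooth_atI[OF atlas_open_submfd[OF U(1)] U(1), where S = "U \<inter> W"]) auto
  show "smooth_at M (open_submfd M W) x (\<lambda>y. y)"
    using U(2) W o s(2)
    by (intro smooth_atI[OF U(1) atlas_open_submfd[OF U(1)], where S = "U \<inter> W"]) auto
qed

lemma smooth_at_open_submfd_iff: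
  assumes M: "manifold M" and N: "manifold N" and W: "mopen M W" "x \<in> W"
  shows "smooth_at (open_submfd M W) N x f \<longleftrightarrow> smooth_at M N x f"
  using smooth_at_compose[OF manifold_open_submfd[OF M W(1)] M N smooth_at_open_submfd_id(1)[OF M W], of f]
    smooth_at_compose[OF M manifold_open_submfd[OF M W(1)] N smooth_at_open_submfd_id(2)[OF M W], of f]
  by blast

lemma smooth_at_into_open_submfd_iff:
  assumes M: "manifold M" and N: "manifold N" and W: "mopen N W" "f x \<in> W"
  shows "smooth_at M (open_submfd N W) x f \<longleftrightarrow> smooth_at M N x f"
  using smooth_at_compose[where f = f and x = x, OF M manifold_open_submfd[OF N W(1)] N _
      smooth_at_open_submfd_id(1)[OF N W]]
    smooth_at_compose[where f = f and x = x, OF M N manifold_open_submfd[OF N W(1)] _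
      smooth_at_open_submfd_id(2)[OF N W]]
  by blast

text \<open>Smoothness of a germ is an open condition, so it persists on a neighbourhood, and there
  f is a smooth map.\<close>

lemma smooth_near_iff:
  assumes M: "manifold M" and N: "manifold N"
  shows "smooth_near M N x f \<longleftrightarrow> smooth_at M N x f"
proof
  assume "smooth_near M N x f"
  then obtain W where W: "mopen M W" "x \<in> W" "smooth_map (open_submfd M W) N f"
    unfolding smooth_near_def by blast
  have "x \<in> points M" using W(1,2) openin_subset by blast
  then have "smooth_at (open_submfd M W) N x f"
    using W smooth_map_iff[OF manifold_open_submfd[OF M W(1)] N] by auto
  then show "smooth_at M N x f" using smooth_at_open_submfd_iff[OF M N W(1,2)] by blast
next
  assume "smooth_at M N x f"
  then obtain S where S: "mopen M S" "x \<in> S" "\<And>y. y \<in> S \<Longrightarrow> smooth_at M N y f"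
    by (rule smooth_at_nearby) blast
  have "smooth_map (open_submfd M S) N f"
    unfolding smooth_map_iff[OF manifold_open_submfd[OF M S(1)] N]
    using S smooth_at_open_submfd_iff[OF M N S(1)] by simp
  then show "smooth_near M N x f" unfolding smooth_near_def using S by blast
qed

subsection \<open>Products\<close>

lemma mtop_prod_mfd [simp]: "mtop (M \<times>\<^sub>M N) = prod_topology (mtop M) (mtop N)"
  by (simp add: prod_mfd_def)

lemma atlas_prod_mfd:
  "(U, \<phi>) \<in> atlas M \<Longrightarrow> (V, \<psi>) \<in> atlas N \<Longrightarrow> (U \<times> V, map_prod \<phi> \<psi>) \<in> atlas (M \<times>\<^sub>M N)"
  by (force simp: prod_mfd_def)

lemma inv_into_map_prod:
  assumes "inj_on \<phi> U" "inj_on \<psi> V" "x \<in> U" "y \<in> V"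
  shows "inv_into (U \<times> V) (map_prod \<phi> \<psi>) (\<phi> x, \<psi> y) = (x, y)"
  using inv_into_f_f[OF map_prod_inj_on[OF assms(1,2)], of "(x, y)"] assms(3,4) by simp

lemma chart_prod:
  assumes c: "chart M U \<phi>" and d: "chart N V \<psi>"
  shows "chart (M \<times>\<^sub>M N) (U \<times> V) (map_prod \<phi> \<psi>)"
  unfolding chart_def mtop_prod_mfd
proof (intro conjI allI impI)
  show "openin (prod_topology (mtop M) (mtop N)) (U \<times> V)"
    using chartD(1)[OF c] chartD(1)[OF d] by (simp add: openin_prod_Times_iff)
  show "inj_on (map_prod \<phi> \<psi>) (U \<times> V)"
    by (rule map_prod_inj_on[OF chartD(2)[OF c] chartD(2)[OF d]])
next
  fix S assume S: "openin (prod_topology (mtop M) (mtop N)) S" "S \<subseteq> U \<times> V"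
  show "open (map_prod \<phi> \<psi> ` S)"
  proof (subst open_subopen, intro ballI)
    fix z assume "z \<in> map_prod \<phi> \<psi> ` S"
    then obtain x y where z: "z = (\<phi> x, \<psi> y)" and xy: "(x, y) \<in> S" by auto
    then obtain A B where AB: "mopen M A" "mopen N B" "x \<in> A" "y \<in> B" "A \<times> B \<subseteq> S"
      using S(1)[unfolded openin_prod_topology_alt, rule_format, OF xy] by blast
    then have "A \<subseteq> U" "B \<subseteq> V" using S(2) by blast+
    then have "open (\<phi> ` A \<times> \<psi> ` B)"
      by (intro open_Times chartD(3)[OF c AB(1)] chartD(3)[OF d AB(2)])
    moreover have "\<phi> ` A \<times> \<psi> ` B \<subseteq> map_prod \<phi> \<psi> ` S"
      using AB(5) by (auto simp flip: map_prod_surj_on[OF refl refl])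
    ultimately show "\<exists>T. open T \<and> z \<in> T \<and> T \<subseteq> map_prod \<phi> \<psi> ` S"
      using AB(3,4) by (intro exI[of _ "\<phi> ` A \<times> \<psi> ` B"]) (auto simp: z)
  qed
next
  fix S :: "('b \<times> 'd) set" assume S: "open S"
  show "openin (prod_topology (mtop M) (mtop N)) {x \<in> U \<times> V. map_prod \<phi> \<psi> x \<in> S}"
    unfolding openin_prod_topology_alt
  proof (intro allI impI, clarsimp)
    fix x y assume xy: "x \<in> U" "y \<in> V" "(\<phi> x, \<psi> y) \<in> S"
    then obtain A B where AB: "open A" "open B" "\<phi> x \<in> A" "\<psi> y \<in> B" "A \<times> B \<subseteq> S"
      using open_prod_elim[OF S] by (metis mem_Sigma_iff)
    show "\<exists>C. mopen M C \<and> (\<exists>D. mopen N D \<and> x \<in> C \<and> y \<in> D \<and>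
        C \<times> D \<subseteq> {x \<in> U \<times> V. map_prod \<phi> \<psi> x \<in> S})"
      using chartD(4)[OF c AB(1)] chartD(4)[OF d AB(2)] AB(3-5) xy
      by (intro exI[of _ "{x \<in> U. \<phi> x \<in> A}"] exI[of _ "{y \<in> V. \<psi> y \<in> B}"] conjI) auto
  qed
qed

lemma manifold_prod:
  assumes M: "manifold M" and N: "manifold N"
  shows "manifold (M \<times>\<^sub>M N)"
  unfolding manifold_iff
proof (intro conjI allI impI)
  show "Hausdorff_space (mtop (M \<times>\<^sub>M N))"
    using manifold_Hausdorff[OF M] manifold_Hausdorff[OF N]
    by (simp add: Hausdorff_space_prod_topology)
  have "\<Union> (fst ` atlas (M \<times>\<^sub>M N)) = \<Union> (fst ` atlas M) \<times> \<Union> (fst ` atlas N)"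
  proof (intro equalityI subsetI)
    fix z assume "z \<in> \<Union> (fst ` atlas M) \<times> \<Union> (fst ` atlas N)"
    then obtain U \<phi> V \<psi> where *: "(U, \<phi>) \<in> atlas M" "(V, \<psi>) \<in> atlas N" "z \<in> U \<times> V" by auto
    show "z \<in> \<Union> (fst ` atlas (M \<times>\<^sub>M N))"
      by (rule UN_I[OF atlas_prod_mfd[OF *(1,2)]]) (use *(3) in simp)
  qed (auto simp: prod_mfd_def)
  then show "\<Union> (fst ` atlas (M \<times>\<^sub>M N)) = points (M \<times>\<^sub>M N)"
    using M N unfolding manifold_iff by simp
next
  fix X \<alpha> assume "(X, \<alpha>) \<in> atlas (M \<times>\<^sub>M N)"
  then obtain U \<phi> V \<psi> where "(U, \<phi>) \<in> atlas M" "(V, \<psi>) \<in> atlas N" "X = U \<times> V" "\<alpha> = map_prod \<phi> \<psi>"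
    by (auto simp: prod_mfd_def)
  then show "chart (M \<times>\<^sub>M N) X \<alpha>"
    using chart_prod[OF manifold_chart[OF M] manifold_chart[OF N]] by simp
next
  fix X \<alpha> Y \<beta> assume "(X, \<alpha>) \<in> atlas (M \<times>\<^sub>M N)" "(Y, \<beta>) \<in> atlas (M \<times>\<^sub>M N)"
  then obtain U \<phi> V \<psi> U' \<phi>' V' \<psi>' where
    U: "(U, \<phi>) \<in> atlas M" "(V, \<psi>) \<in> atlas N" "X = U \<times> V" "\<alpha> = map_prod \<phi> \<psi>" and
    U': "(U', \<phi>') \<in> atlas M" "(V', \<psi>') \<in> atlas N" "Y = U' \<times> V'" "\<beta> = map_prod \<phi>' \<psi>'"
    by (auto simp: prod_mfd_def)
  note c = manifold_chart[OF M U(1)] and d = manifold_chart[OF N U(2)]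
    and c' = manifold_chart[OF M U'(1)] and d' = manifold_chart[OF N U'(2)]
  have im: "\<alpha> ` (X \<inter> Y) = \<phi> ` (U \<inter> U') \<times> \<psi> ` (V \<inter> V')"
    by (simp add: U U' Times_Int_Times map_prod_surj_on)
  have o: "open (\<phi> ` (U \<inter> U'))" "open (\<psi> ` (V \<inter> V'))"
    using chartD(3)[OF c openin_Int[OF chartD(1)[OF c] chartD(1)[OF c']]]
      chartD(3)[OF d openin_Int[OF chartD(1)[OF d] chartD(1)[OF d']]] by auto
  then have op: "open (\<phi> ` (U \<inter> U') \<times> \<psi> ` (V \<inter> V'))" by (rule open_Times)
  have "smooth_on (\<phi> ` (U \<inter> U') \<times> \<psi> ` (V \<inter> V'))
      (\<lambda>z. (\<phi>' (inv_into U \<phi> (fst z)), \<psi>' (inv_into V \<psi> (snd z))))"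
    by (intro smooth_on_Pair op
        smooth_on_compose[OF op o(1) smooth_on_fst manifold_transition[OF M U(1) U'(1)]]
        smooth_on_compose[OF op o(2) smooth_on_snd manifold_transition[OF N U(2) U'(2)]]) auto
  then show "smooth_on (\<alpha> ` (X \<inter> Y)) (\<lambda>x. \<beta> (inv_into X \<alpha> x))"
    unfolding im
    by (rule smooth_on_cong_open[OF op, rotated])
      (use chartD(2)[OF c] chartD(2)[OF d] in \<open>auto simp: U U' inv_into_map_prod\<close>)
qed

lemma smooth_at_fst_snd:
  assumes M: "manifold M" and N: "manifold N"
    and x: "x \<in> points M \<times> points N"
  shows "smooth_at (M \<times>\<^sub>M N) M x fst" "smooth_at (M \<times>\<^sub>M N) N x snd"
proof -
  obtain U \<phi> where U: "(U, \<phi>) \<in> atlas M" "fst x \<in> U"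
    using manifold_chart_at[OF M] x by (metis mem_Times_iff)
  obtain V \<psi> where V: "(V, \<psi>) \<in> atlas N" "snd x \<in> V"
    using manifold_chart_at[OF N] x by (metis mem_Times_iff)
  note c = manifold_chart[OF M U(1)] and d = manifold_chart[OF N V(1)]
  note cd = chart_prod[OF c d]
  have op: "open (map_prod \<phi> \<psi> ` (U \<times> V))"
    using chartD(3)[OF cd chartD(1)[OF cd]] by simp
  have "smooth_on (map_prod \<phi> \<psi> ` (U \<times> V)) (\<lambda>z. \<phi> (fst (inv_into (U \<times> V) (map_prod \<phi> \<psi>) z)))"
    by (rule smooth_on_cong_open[OF op _ smooth_on_fst])
      (use chartD(2)[OF c] chartD(2)[OF d] in \<open>auto simp: inv_into_map_prod\<close>)
  then show "smooth_at (M \<times>\<^sub>M N) M x fst"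
    using U V by (intro smooth_atI[OF atlas_prod_mfd[OF U(1) V(1)] U(1) chartD(1)[OF cd]])
      (auto simp: mem_Times_iff)
  have "smooth_on (map_prod \<phi> \<psi> ` (U \<times> V)) (\<lambda>z. \<psi> (snd (inv_into (U \<times> V) (map_prod \<phi> \<psi>) z)))"
    by (rule smooth_on_cong_open[OF op _ smooth_on_snd])
      (use chartD(2)[OF c] chartD(2)[OF d] in \<open>auto simp: inv_into_map_prod\<close>)
  then show "smooth_at (M \<times>\<^sub>M N) N x snd"
    using U V by (intro smooth_atI[OF atlas_prod_mfd[OF U(1) V(1)] V(1) chartD(1)[OF cd]])
      (auto simp: mem_Times_iff)
qed

lemma smooth_at_Pair:
  assumes M: "manifold M" and N: "manifold N" and P: "manifold P"
    and f: "smooth_at M N x f" and g: "smooth_at M P x g"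
  shows "smooth_at M (N \<times>\<^sub>M P) x (\<lambda>y. (f y, g y))"
proof -
  obtain U \<phi> where U: "(U, \<phi>) \<in> atlas M" "x \<in> U"
    by (rule manifold_chart_at[OF M smooth_at_topspace(1)[OF M N f]])
  obtain V \<psi> where V: "(V, \<psi>) \<in> atlas N" "f x \<in> V"
    by (rule manifold_chart_at[OF N smooth_at_topspace(2)[OF M N f]])
  obtain W \<theta> where W: "(W, \<theta>) \<in> atlas P" "g x \<in> W"
    by (rule manifold_chart_at[OF P smooth_at_topspace(2)[OF M P g]])
  obtain S where S: "mopen M S" "x \<in> S" "S \<subseteq> U" "f ` S \<subseteq> V"
    "smooth_on (\<phi> ` S) (\<lambda>z. \<psi> (f (inv_into U \<phi> z)))"
    by (rule smooth_at_charts[OF M N f U V])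
  obtain T where T: "mopen M T" "x \<in> T" "T \<subseteq> U" "g ` T \<subseteq> W"
    "smooth_on (\<phi> ` T) (\<lambda>z. \<theta> (g (inv_into U \<phi> z)))"
    by (rule smooth_at_charts[OF M P g U W])
  have o: "mopen M (S \<inter> T)" using S(1) T(1) by blast
  have "open (\<phi> ` (S \<inter> T))"
    by (rule chartD(3)[OF manifold_chart[OF M U(1)] o]) (use S(3) in auto)
  then have "smooth_on (\<phi> ` (S \<inter> T)) (\<lambda>z. map_prod \<psi> \<theta> (f (inv_into U \<phi> z), g (inv_into U \<phi> z)))"
    unfolding map_prod_simp
    by (intro smooth_on_Pair smooth_on_subset[OF S(5)] smooth_on_subset[OF T(5)]) auto
  then show ?thesis
    using S T by (intro smooth_atI[OF U(1) atlas_prod_mfd[OF V(1) W(1)] o]) auto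
qed

section \<open>Lie groups\<close>

subsection \<open>Pointwise smoothness of the group operations\<close>

lemma lie_groupD:
  assumes "lie_group G"
  shows "group G" "manifold (mfd G)" "points (mfd G) = carrier G"
  using assms unfolding lie_group_def by auto

lemma smooth_at_mult:
  assumes G: "lie_group G" and M: "manifold M"
    and f: "smooth_at M (mfd G) x f" and g: "smooth_at M (mfd G) x g"
  shows "smooth_at M (mfd G) x (\<lambda>y. f y \<otimes>\<^bsub>G\<^esub> g y)"
proof -
  note MG = lie_groupD(2)[OF G]
  have "smooth_at (mfd G \<times>\<^sub>M mfd G) (mfd G) (f x, g x) (\<lambda>(x, y). x \<otimes>\<^bsub>G\<^esub> y)"
    using G smooth_map_iff[OF manifold_prod[OF MG MG] MG]
      smooth_at_topspace(2)[OF M MG f] smooth_at_topspace(2)[OF M MG g]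
    unfolding lie_group_def by auto
  from smooth_at_compose[OF M manifold_prod[OF MG MG] MG smooth_at_Pair[OF M MG MG f g] this]
  show ?thesis by simp
qed

lemma smooth_at_inv:
  assumes G: "lie_group G" and M: "manifold M" and f: "smooth_at M (mfd G) x f"
  shows "smooth_at M (mfd G) x (\<lambda>y. inv\<^bsub>G\<^esub> f y)"
proof -
  note MG = lie_groupD(2)[OF G]
  have "smooth_at (mfd G) (mfd G) (f x) (\<lambda>x. inv\<^bsub>G\<^esub> x)"
    using G smooth_map_iff[OF MG MG] smooth_at_topspace(2)[OF M MG f]
    unfolding lie_group_def by auto
  then show ?thesis
    by (rule smooth_at_compose[OF M MG MG f])
qed

lemma smooth_at_lie_const:
  assumes "lie_group G" "manifold M" "x \<in> points M" "c \<in> carrier G"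
  shows "smooth_at M (mfd G) x (\<lambda>_. c)"
  using smooth_at_const[OF assms(2) lie_groupD(2)[OF assms(1)] assms(3)] assms(4)
  by (simp add: lie_groupD(3)[OF assms(1)])

lemma smooth_at_lie_id:
  assumes "lie_group G" "x \<in> carrier G"
  shows "smooth_at (mfd G) (mfd G) x (\<lambda>y. y)"
  using smooth_at_id[OF lie_groupD(2)[OF assms(1)]] assms(2)
  by (simp add: lie_groupD(3)[OF assms(1)])

text \<open>By phi(y) = phi(x) phi(x^-1 y), the germ of a homomorphism at x is its germ at the
  identity between two left translations, and these are smooth.\<close>

lemma lie_homI:
  assumes K: "lie_group K" and H: "lie_group H" and \<phi>: "\<phi> \<in> hom K H"
    and s: "smooth_at (mfd K) (mfd H) \<one>\<^bsub>K\<^esub> \<phi>"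
  shows "\<phi> \<in> lie_hom K H"
proof -
  interpret K: group K by (rule lie_groupD(1)[OF K])
  interpret H: group H by (rule lie_groupD(1)[OF H])
  note MK = lie_groupD(2)[OF K] and MH = lie_groupD(2)[OF H]
  have "smooth_at (mfd K) (mfd H) x \<phi>" if x: "x \<in> carrier K" for x
  proof (rule smooth_at_eqI[OF MK])
    show "\<phi> x \<otimes>\<^bsub>H\<^esub> \<phi> (inv\<^bsub>K\<^esub> x \<otimes>\<^bsub>K\<^esub> y) = \<phi> y" if "y \<in> points (mfd K)" for y
    proof -
      have y: "y \<in> carrier K" using that lie_groupD(3)[OF K] by simp
      have "\<phi> x \<otimes>\<^bsub>H\<^esub> \<phi> (inv\<^bsub>K\<^esub> x \<otimes>\<^bsub>K\<^esub> y) = \<phi> (x \<otimes>\<^bsub>K\<^esub> (inv\<^bsub>K\<^esub> x \<otimes>\<^bsub>K\<^esub> y))"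
        using hom_mult[OF \<phi>] x y by simp
      then show ?thesis using x y by (simp flip: K.m_assoc)
    qed
    have "\<phi> x \<in> carrier H" using \<phi> x by (auto simp: hom_def)
    moreover have "smooth_at (mfd K) (mfd K) x (\<lambda>y. inv\<^bsub>K\<^esub> x \<otimes>\<^bsub>K\<^esub> y)"
      using x lie_groupD(3)[OF K]
      by (intro smooth_at_mult[OF K MK] smooth_at_lie_const[OF K MK] smooth_at_lie_id[OF K]) auto
    then have "smooth_at (mfd K) (mfd H) x (\<lambda>y. \<phi> (inv\<^bsub>K\<^esub> x \<otimes>\<^bsub>K\<^esub> y))"
      by (rule smooth_at_compose[OF MK MK MH]) (use x s in simp)
    ultimately show "smooth_at (mfd K) (mfd H) x (\<lambda>y. \<phi> x \<otimes>\<^bsub>H\<^esub> \<phi> (inv\<^bsub>K\<^esub> x \<otimes>\<^bsub>K\<^esub> y))"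
      using x lie_groupD(3)[OF K]
      by (intro smooth_at_mult[OF H MK] smooth_at_lie_const[OF H MK]) auto
  qed
  then show ?thesis
    using \<phi> smooth_map_iff[OF MK MH] lie_groupD(3)[OF K] unfolding lie_hom_def by auto
qed

lemma lie_hom_smooth_at:
  assumes "lie_group K" "lie_group H" "\<phi> \<in> lie_hom K H" "x \<in> carrier K"
  shows "smooth_at (mfd K) (mfd H) x \<phi>"
  using assms smooth_map_iff[OF lie_groupD(2) lie_groupD(2), of K H] lie_groupD(3)[OF assms(1)]
  unfolding lie_hom_def by auto

subsection \<open>Lie groups from local data\<close>

text \<open>The topology is the final one for the maps p |-> k p from P into K, one for each k in K;
  the charts are those of P carried along by left translation.\<close>

definition translate_mfd :: "('k, 'm) monoid_scheme \<Rightarrow> ('k, 'v::lcs) manifold \<Rightarrow> ('k, 'v) manifold" where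
  "translate_mfd K P = \<lparr>mtop = topology (\<lambda>S. S \<subseteq> carrier K \<and>
      (\<forall>k\<in>carrier K. mopen P {p \<in> points P. k \<otimes>\<^bsub>K\<^esub> p \<in> S})),
    atlas = {((\<otimes>\<^bsub>K\<^esub>) k ` U, \<lambda>x. \<phi> (inv\<^bsub>K\<^esub> k \<otimes>\<^bsub>K\<^esub> x)) | k U \<phi>. k \<in> carrier K \<and> (U, \<phi>) \<in> atlas P}\<rparr>"

text \<open>
  The manifold \<open>P\<close> on a subset of \<open>K\<close> plays the role of an identity neighbourhood; all its left
  translates are to be charts. The map \<open>q\<close> separates points that do not lie in a common translate.
\<close>

locale local_lie_group = group K for K :: "('k, 'm) monoid_scheme" (structure) +
  fixes P :: "('k, 'v::lcs) manifold" and q :: "'k \<Rightarrow> 'y" and Q :: "'y topology"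
  assumes manifold_P: "manifold P"
    and P_subset: "points P \<subseteq> carrier K"
    and one_P: "\<one> \<in> points P"
    and smooth_translation: "m \<in> carrier K \<Longrightarrow> p \<in> points P \<Longrightarrow>
      m \<otimes> p \<in> points P \<Longrightarrow> smooth_at P P p (\<lambda>x. m \<otimes> x)"
    and Hausdorff_Q: "Hausdorff_space Q"
    and continuous_q: "k \<in> carrier K \<Longrightarrow> continuous_map (mtop P) Q (\<lambda>p. q (k \<otimes> p))"
    and q_eq: "x \<in> carrier K \<Longrightarrow> y \<in> carrier K \<Longrightarrow> q x = q y \<Longrightarrow> inv x \<otimes> y \<in> points P"
begin

abbreviation "M \<equiv> translate_mfd K P"
abbreviation "B \<equiv> points P"

lemma PK [simp]: "p \<in> B \<Longrightarrow> p \<in> carrier K"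
  using P_subset by blast

lemma openin_M:
  "mopen M S \<longleftrightarrow> S \<subseteq> carrier K \<and> (\<forall>k\<in>carrier K. mopen P {p \<in> B. k \<otimes> p \<in> S})"
proof -
  have "istopology (\<lambda>S. S \<subseteq> carrier K \<and> (\<forall>k\<in>carrier K. mopen P {p \<in> B. k \<otimes> p \<in> S}))"
    unfolding istopology_def
  proof (intro conjI allI impI ballI)
    fix S T k
    assume *: "S \<subseteq> carrier K \<and> (\<forall>k\<in>carrier K. mopen P {p \<in> B. k \<otimes> p \<in> S})"
      "T \<subseteq> carrier K \<and> (\<forall>k\<in>carrier K. mopen P {p \<in> B. k \<otimes> p \<in> T})" "k \<in> carrier K"
    have "{p \<in> B. k \<otimes> p \<in> S \<inter> T} = {p \<in> B. k \<otimes> p \<in> S} \<inter> {p \<in> B. k \<otimes> p \<in> T}" by auto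
    then show "mopen P {p \<in> B. k \<otimes> p \<in> S \<inter> T}" using * by auto
  next
    fix \<K> k
    assume *: "\<forall>S\<in>\<K>. S \<subseteq> carrier K \<and> (\<forall>k\<in>carrier K. mopen P {p \<in> B. k \<otimes> p \<in> S})"
      "k \<in> carrier K"
    have "{p \<in> B. k \<otimes> p \<in> \<Union>\<K>} = (\<Union>S\<in>\<K>. {p \<in> B. k \<otimes> p \<in> S})" by auto
    then show "mopen P {p \<in> B. k \<otimes> p \<in> \<Union>\<K>}" using * by auto
  qed auto
  then show ?thesis by (simp add: translate_mfd_def)
qed

lemma topspace_M [simp]: "points M = carrier K"
proof
  show "points M \<subseteq> carrier K"
    unfolding topspace_def openin_M by auto
  have "{p \<in> B. k \<otimes> p \<in> carrier K} = B" if "k \<in> carrier K" for k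
    using that by auto
  then have "mopen M (carrier K)" by (simp add: openin_M)
  then show "carrier K \<subseteq> points M" by (rule openin_subset)
qed

text \<open>The preimage of k S under p |-> l p consists of the p with (k^-1 l) p in S. Openness of
  k S thus amounts to continuity of left translations between points of P, which
  \<open>smooth_translation\<close> supplies.\<close>

lemma openin_translate:
  assumes k: "k \<in> carrier K" and S: "mopen P S"
  shows "mopen M ((\<otimes>) k ` S)"
  unfolding openin_M
proof (intro conjI ballI)
  have SB: "S \<subseteq> B" by (rule openin_subset[OF S])
  show "(\<otimes>) k ` S \<subseteq> carrier K" using SB k by auto
  fix l assume l: "l \<in> carrier K"
  have eq: "{p \<in> B. l \<otimes> p \<in> (\<otimes>) k ` S} = {p \<in> B. (inv k \<otimes> l) \<otimes> p \<in> S}"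
  proof (intro Collect_cong conj_cong refl iffI)
    fix p assume p: "p \<in> B"
    show "(inv k \<otimes> l) \<otimes> p \<in> S" if lp: "l \<otimes> p \<in> (\<otimes>) k ` S"
    proof -
      obtain s where "s \<in> S" "l \<otimes> p = k \<otimes> s" using lp by auto
      moreover from this have "(inv k \<otimes> l) \<otimes> p = s"
        using k l p SB by (auto simp: m_assoc simp flip: m_assoc[of "inv k" k])
      ultimately show ?thesis by simp
    qed
    show "l \<otimes> p \<in> (\<otimes>) k ` S" if "(inv k \<otimes> l) \<otimes> p \<in> S"
      by (rule image_eqI[OF _ that]) (use k l p in \<open>simp flip: m_assoc\<close>)
  qed
  show "mopen P {p \<in> B. l \<otimes> p \<in> (\<otimes>) k ` S}"
    unfolding eq
  proof (subst openin_subopen, clarify)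
    fix p assume p: "p \<in> B" "(inv k \<otimes> l) \<otimes> p \<in> S"
    have sm: "smooth_at P P p (\<lambda>x. (inv k \<otimes> l) \<otimes> x)"
      using p k l SB by (intro smooth_translation) auto
    obtain T where "mopen P T" "p \<in> T" "(\<lambda>x. (inv k \<otimes> l) \<otimes> x) ` T \<subseteq> S"
      by (rule smooth_at_continuous[OF manifold_P manifold_P sm S p(2)])
    then show "\<exists>T. mopen P T \<and> p \<in> T \<and> T \<subseteq> {p \<in> B. (inv k \<otimes> l) \<otimes> p \<in> S}"
      using openin_subset by blast
  qed
qed

lemma atlas_M:
  "k \<in> carrier K \<Longrightarrow> (U, \<phi>) \<in> atlas P \<Longrightarrow> ((\<otimes>) k ` U, \<lambda>x. \<phi> (inv k \<otimes> x)) \<in> atlas M"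
  by (auto simp: translate_mfd_def)

lemma chart_translate:
  assumes k: "k \<in> carrier K" and U: "(U, \<phi>) \<in> atlas P"
  shows "chart M ((\<otimes>) k ` U) (\<lambda>x. \<phi> (inv k \<otimes> x))"
    and "p \<in> U \<Longrightarrow> inv k \<otimes> (k \<otimes> p) = p"
    and "p \<in> U \<Longrightarrow> inv_into ((\<otimes>) k ` U) (\<lambda>x. \<phi> (inv k \<otimes> x)) (\<phi> p) = k \<otimes> p"
proof -
  note c = manifold_chart[OF manifold_P U]
  have UB: "U \<subseteq> B" by (rule chart_subset_topspace[OF c])
  have [simp]: "inv k \<otimes> (k \<otimes> p) = p" if "p \<in> U" for p
    using that k UB by (auto simp flip: m_assoc)
  show "p \<in> U \<Longrightarrow> inv k \<otimes> (k \<otimes> p) = p" by simp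
  have inj: "inj_on (\<lambda>x. \<phi> (inv k \<otimes> x)) ((\<otimes>) k ` U)"
    using chartD(2)[OF c] by (auto simp: inj_on_def)
  then show "p \<in> U \<Longrightarrow> inv_into ((\<otimes>) k ` U) (\<lambda>x. \<phi> (inv k \<otimes> x)) (\<phi> p) = k \<otimes> p"
    using inv_into_f_f[OF inj, of "k \<otimes> p"] by simp
  show "chart M ((\<otimes>) k ` U) (\<lambda>x. \<phi> (inv k \<otimes> x))"
    unfolding chart_def
  proof (intro conjI allI impI inj)
    show "mopen M ((\<otimes>) k ` U)"
      by (rule openin_translate[OF k chartD(1)[OF c]])
    fix S assume S: "mopen M S" "S \<subseteq> (\<otimes>) k ` U"
    have "(\<lambda>x. \<phi> (inv k \<otimes> x)) ` S = \<phi> ` (U \<inter> {p \<in> B. k \<otimes> p \<in> S})"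
    proof (intro equalityI subsetI)
      fix z assume "z \<in> (\<lambda>x. \<phi> (inv k \<otimes> x)) ` S"
      then obtain x where x: "x \<in> S" "z = \<phi> (inv k \<otimes> x)" by blast
      then obtain p where "p \<in> U" "x = k \<otimes> p" using S(2) by blast
      then show "z \<in> \<phi> ` (U \<inter> {p \<in> B. k \<otimes> p \<in> S})" using x UB by auto
    next
      fix z assume "z \<in> \<phi> ` (U \<inter> {p \<in> B. k \<otimes> p \<in> S})"
      then obtain p where "p \<in> U" "k \<otimes> p \<in> S" "z = \<phi> p" by blast
      then show "z \<in> (\<lambda>x. \<phi> (inv k \<otimes> x)) ` S" by (intro image_eqI[of _ _ "k \<otimes> p"]) auto
    qed
    moreover have "mopen P (U \<inter> {p \<in> B. k \<otimes> p \<in> S})"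
      using S(1) k chartD(1)[OF c] by (auto simp: openin_M)
    ultimately show "open ((\<lambda>x. \<phi> (inv k \<otimes> x)) ` S)"
      using chartD(3)[OF c] by simp
  next
    fix S :: "'v set" assume S: "open S"
    have "{x \<in> (\<otimes>) k ` U. \<phi> (inv k \<otimes> x) \<in> S} = (\<otimes>) k ` {p \<in> U. \<phi> p \<in> S}" by auto
    then show "mopen M {x \<in> (\<otimes>) k ` U. \<phi> (inv k \<otimes> x) \<in> S}"
      using openin_translate[OF k chartD(4)[OF c S]] by simp
  qed
qed

lemma Hausdorff_M: "Hausdorff_space (mtop M)"
  unfolding Hausdorff_space_def topspace_M
proof (intro allI impI, elim conjE)
  fix x y assume xy: "x \<in> carrier K" "y \<in> carrier K" "x \<noteq> y"
  show "\<exists>U V. mopen M U \<and> mopen M V \<and> x \<in> U \<and> y \<in> V \<and> disjnt U V"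
  proof (cases "q x = q y")
    case True
    \<comment> \<open>Both points lie in the translate of P by \<open>x\<close>, where they
      correspond to the identity and to x^-1 y.\<close>
    then have b: "inv x \<otimes> y \<in> B" using q_eq xy by blast
    have "x \<otimes> (inv x \<otimes> y) = y" using xy by (simp flip: m_assoc)
    then have "\<one> \<noteq> inv x \<otimes> y" using xy(3) r_one[OF xy(1)] by metis
    then obtain U V where UV: "mopen P U" "mopen P V" "\<one> \<in> U"
      "inv x \<otimes> y \<in> V" "disjnt U V"
      using manifold_Hausdorff[OF manifold_P, unfolded Hausdorff_space_def, rule_format,
          of \<one> "inv x \<otimes> y"] one_P b by auto
    have "inj_on ((\<otimes>) x) (carrier K)" using xy(1) by (simp add: inj_on_def)
    moreover have "U \<subseteq> carrier K" "V \<subseteq> carrier K"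
      using openin_subset[OF UV(1)] openin_subset[OF UV(2)] P_subset by auto
    ultimately have "disjnt ((\<otimes>) x ` U) ((\<otimes>) x ` V)"
      using UV(5) inj_on_image_Int[of "(\<otimes>) x" "carrier K" U V] unfolding disjnt_def by simp
    moreover have "x \<in> (\<otimes>) x ` U"
      using image_eqI[OF _ UV(3), of x "(\<otimes>) x"] xy(1) by simp
    moreover have "y \<in> (\<otimes>) x ` V"
      using image_eqI[OF _ UV(4), of y "(\<otimes>) x"] xy by (simp flip: m_assoc)
    ultimately show ?thesis
      using openin_translate[OF xy(1) UV(1)] openin_translate[OF xy(1) UV(2)] by blast
  next
    case False
    have q: "q k \<in> topspace Q" if k: "k \<in> carrier K" for k
    proof -
      have "q (k \<otimes> \<one>) \<in> topspace Q"
        using continuous_q[OF k] one_P by (auto simp: continuous_map_def Pi_iff)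
      then show ?thesis using k by simp
    qed
    obtain U V where UV: "openin Q U" "openin Q V" "q x \<in> U" "q y \<in> V" "disjnt U V"
      using Hausdorff_Q[unfolded Hausdorff_space_def, rule_format, of "q x" "q y"] q xy False by auto
    have "mopen M {x \<in> carrier K. q x \<in> U}" if U: "openin Q U" for U
      unfolding openin_M
    proof (intro conjI ballI)
      fix k assume k: "k \<in> carrier K"
      have "{p \<in> B. k \<otimes> p \<in> {x \<in> carrier K. q x \<in> U}} = {p \<in> B. q (k \<otimes> p) \<in> U}"
        using k by auto
      then show "mopen P {p \<in> B. k \<otimes> p \<in> {x \<in> carrier K. q x \<in> U}}"
        using openin_continuous_map_preimage[OF continuous_q[OF k] U] by simp
    qed auto
    from this[OF UV(1)] this[OF UV(2)] show ?thesis
      using UV(3-5) xy unfolding disjnt_iff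
      by (intro exI[of _ "{x \<in> carrier K. q x \<in> U}"] exI[of _ "{x \<in> carrier K. q x \<in> V}"]) auto
  qed
qed

text \<open>In the coordinates of P, the change from the k-chart to the l-chart is left translation
  by m = l^-1 k, which is smooth wherever it takes a point of P into P.\<close>

lemma transition_M:
  assumes k: "k \<in> carrier K" and U: "(U, \<phi>) \<in> atlas P" and l: "l \<in> carrier K" and V: "(V, \<psi>) \<in> atlas P"
  shows "smooth_on ((\<lambda>x. \<phi> (inv k \<otimes> x)) ` ((\<otimes>) k ` U \<inter> (\<otimes>) l ` V))
    (\<lambda>z. \<psi> (inv l \<otimes> inv_into ((\<otimes>) k ` U) (\<lambda>x. \<phi> (inv k \<otimes> x)) z))"
proof -
  note c = manifold_chart[OF manifold_P U] and d = manifold_chart[OF manifold_P V]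
  note ck = chart_translate[OF k U] and cl = chart_translate[OF l V]
  let ?I = "(\<otimes>) k ` U \<inter> (\<otimes>) l ` V"
  have op: "open ((\<lambda>x. \<phi> (inv k \<otimes> x)) ` ?I)"
    by (rule chartD(3)[OF ck(1) openin_Int[OF chartD(1)[OF ck(1)] chartD(1)[OF cl(1)]]]) auto
  have UB: "U \<subseteq> carrier K" "V \<subseteq> carrier K" "U \<subseteq> B" "V \<subseteq> B"
    using chart_subset_topspace[OF c] chart_subset_topspace[OF d] P_subset by auto
  define m where "m = inv l \<otimes> k"
  have m: "m \<in> carrier K" using k l by (simp add: m_def)
  have "smooth_on ((\<lambda>x. \<phi> (inv k \<otimes> x)) ` ?I) (\<lambda>z. \<psi> (m \<otimes> inv_into U \<phi> z))"
  proof (rule smooth_on_local)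
    fix z assume "z \<in> (\<lambda>x. \<phi> (inv k \<otimes> x)) ` ?I"
    then obtain p r where "z = \<phi> (inv k \<otimes> (k \<otimes> p))" and p': "p \<in> U" "k \<otimes> p = l \<otimes> r" "r \<in> V"
      by fastforce
    then have p: "z = \<phi> p" "p \<in> U" "k \<otimes> p = l \<otimes> r" "r \<in> V"
      using ck(2)[OF p'(1)] by simp_all
    have mp: "m \<otimes> p = r"
      using p k l UB cl(2)[OF p(4)] by (simp add: m_def m_assoc subset_iff)
    have mV: "m \<otimes> p \<in> V" using mp p(4) by simp
    have sm: "smooth_at P P p (\<lambda>x. m \<otimes> x)"
      using p mV UB by (intro smooth_translation m) auto
    obtain S where "mopen P S" "p \<in> S" "S \<subseteq> U"
      "smooth_on (\<phi> ` S) (\<lambda>z. \<psi> (m \<otimes> inv_into U \<phi> z))"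
      by (rule smooth_at_charts[OF manifold_P manifold_P sm U p(2) V mV]) 
    then show "\<exists>S. open S \<and> z \<in> S \<and> smooth_on S (\<lambda>z. \<psi> (m \<otimes> inv_into U \<phi> z))"
      using chartD(3)[OF c] p(1) by blast
  qed
  then show ?thesis
  proof (rule smooth_on_cong_open[OF op, rotated])
    fix z assume "z \<in> (\<lambda>x. \<phi> (inv k \<otimes> x)) ` ?I"
    then obtain p where "z = \<phi> (inv k \<otimes> (k \<otimes> p))" and p': "p \<in> U" by auto
    then have p: "z = \<phi> p" "p \<in> U" using ck(2)[OF p'] by simp_all
    then have "inv_into U \<phi> z = p" using chartD(2)[OF c] by auto
    then show "\<psi> (m \<otimes> inv_into U \<phi> z) =
        \<psi> (inv l \<otimes> inv_into ((\<otimes>) k ` U) (\<lambda>x. \<phi> (inv k \<otimes> x)) z)"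
      using p ck(3)[OF p(2)] k l UB by (simp add: m_def m_assoc subset_iff)
  qed
qed

lemma manifold_M: "manifold M"
  unfolding manifold_iff
proof (intro conjI allI impI Hausdorff_M)
  show "\<Union> (fst ` atlas M) = points M"
    unfolding topspace_M
  proof (intro equalityI subsetI)
    fix x assume "x \<in> \<Union> (fst ` atlas M)"
    then obtain k U \<phi> where "k \<in> carrier K" "(U, \<phi>) \<in> atlas P" "x \<in> (\<otimes>) k ` U"
      by (auto simp: translate_mfd_def)
    then show "x \<in> carrier K"
      using chart_subset_topspace[OF manifold_chart[OF manifold_P]] P_subset by blast
  next
    fix x assume x: "x \<in> carrier K"
    obtain U \<phi> where U: "(U, \<phi>) \<in> atlas P" "\<one> \<in> U"
      by (rule manifold_chart_at[OF manifold_P one_P])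
    show "x \<in> \<Union> (fst ` atlas M)"
      by (rule UN_I[OF atlas_M[OF x U(1)]]) (use image_eqI[OF _ U(2), of x "(\<otimes>) x"] x in simp)
  qed
next
  fix U \<phi> assume "(U, \<phi>) \<in> atlas M"
  then show "chart M U \<phi>"
    using chart_translate(1) unfolding translate_mfd_def by auto
next
  fix U \<phi> V \<psi> assume "(U, \<phi>) \<in> atlas M" "(V, \<psi>) \<in> atlas M"
  then show "smooth_on (\<phi> ` (U \<inter> V)) (\<lambda>x. \<psi> (inv_into U \<phi> x))"
    using transition_M unfolding translate_mfd_def by auto
qed

text \<open>Left translation by k identifies P with a piece of M. The second map brings germs on M
  to the identity, the first takes them back.\<close>

lemma smooth_at_from_P:
  assumes k: "k \<in> carrier K" and p: "p \<in> B"
  shows "smooth_at P M p (\<lambda>x. k \<otimes> x)" "smooth_at M P (k \<otimes> p) (\<lambda>x. inv k \<otimes> x)"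
proof -
  obtain U \<phi> where U: "(U, \<phi>) \<in> atlas P" "p \<in> U"
    by (rule manifold_chart_at[OF manifold_P p])
  note c = manifold_chart[OF manifold_P U(1)] and ck = chart_translate[OF k U(1)]
  have op: "open (\<phi> ` U)" using chartD(3)[OF c chartD(1)[OF c]] by simp
  have im: "(\<lambda>x. \<phi> (inv k \<otimes> x)) ` (\<otimes>) k ` U = \<phi> ` U"
    using ck(2) by (auto simp: image_image)
  have "smooth_on (\<phi> ` U) (\<lambda>z. \<phi> (inv k \<otimes> (k \<otimes> inv_into U \<phi> z)))"
    by (rule smooth_on_cong_open[OF op _ smooth_on_id]) (use ck(2) chartD(2)[OF c] in auto)
  then show "smooth_at P M p (\<lambda>x. k \<otimes> x)"
    using U(2) by (intro smooth_atI[OF U(1) atlas_M[OF k U(1)] chartD(1)[OF c]]) auto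
  have "smooth_on (\<phi> ` U) (\<lambda>z. \<phi> (inv k \<otimes> inv_into ((\<otimes>) k ` U) (\<lambda>x. \<phi> (inv k \<otimes> x)) z))"
    by (rule smooth_on_cong_open[OF op _ smooth_on_id]) (use ck(2,3) in auto)
  then show "smooth_at M P (k \<otimes> p) (\<lambda>x. inv k \<otimes> x)"
    using U(2) ck(2) im by (intro smooth_atI[OF atlas_M[OF k U(1)] U(1) chartD(1)[OF ck(1)]]) auto
qed

text \<open>With x = k u and y = l v, the product x y is (k l)((l^-1 u l) v) and the inverse of x is
  k^-1 (k u^-1 k^-1), so the germs at (k, l) and at k come from germs at the identity. Conjugation
  enters because u has to be moved past l before the left translation by k l can be split
  off.\<close>

lemma smooth_at_translate_mfd:
  assumes mult: "smooth_at (P \<times>\<^sub>M P) P (\<one>, \<one>) (\<lambda>(x, y). x \<otimes> y)"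
    and inv: "smooth_at P P \<one> (\<lambda>x. inv x)"
    and conj: "\<And>k. k \<in> carrier K \<Longrightarrow> smooth_at P P \<one> (\<lambda>x. k \<otimes> x \<otimes> inv k)"
  shows "smooth_map (M \<times>\<^sub>M M) M (\<lambda>(x, y). x \<otimes> y)" "smooth_map M M (\<lambda>x. inv x)"
proof -
  note MM = manifold_M and MP = manifold_P
  note MMM = manifold_prod[OF MM MM] and MPP = manifold_prod[OF MP MP]
  have near: "smooth_at M P k (\<lambda>x. inv k \<otimes> x)" if "k \<in> carrier K" for k
    using smooth_at_from_P(2)[OF that one_P] that by simp
  show "smooth_map (M \<times>\<^sub>M M) M (\<lambda>(x, y). x \<otimes> y)"
    unfolding smooth_map_iff[OF MMM MM]
  proof
    fix z assume "z \<in> points (M \<times>\<^sub>M M)"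
    then obtain k l where z: "z = (k, l)" "k \<in> carrier K" "l \<in> carrier K" by auto
    have 1: "smooth_at (M \<times>\<^sub>M M) P z (\<lambda>p. inv l \<otimes> (inv k \<otimes> fst p) \<otimes> inv (inv l))"
      by (rule smooth_at_compose[OF MMM MP MP, where f = "\<lambda>p. inv k \<otimes> fst p"],
          rule smooth_at_compose[OF MMM MM MP, where f = fst])
        (use z near conj[of "inv l"] smooth_at_fst_snd(1)[OF MM MM, of z] in auto)
    have 2: "smooth_at (M \<times>\<^sub>M M) P z (\<lambda>p. inv l \<otimes> snd p)"
      by (rule smooth_at_compose[OF MMM MM MP, where f = snd])
        (use z near smooth_at_fst_snd(2)[OF MM MM, of z] in auto)
    have 3: "smooth_at (M \<times>\<^sub>M M) P z
        (\<lambda>p. (\<lambda>(x, y). x \<otimes> y) (inv l \<otimes> (inv k \<otimes> fst p) \<otimes> inv (inv l), inv l \<otimes> snd p))"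
      by (rule smooth_at_compose[OF MMM MPP MP smooth_at_Pair[OF MMM MP MP 1 2]])
        (use z mult in simp)
    have "smooth_at (M \<times>\<^sub>M M) M z (\<lambda>p. (k \<otimes> l) \<otimes>
        (\<lambda>(x, y). x \<otimes> y) (inv l \<otimes> (inv k \<otimes> fst p) \<otimes> inv (inv l), inv l \<otimes> snd p))"
      by (rule smooth_at_compose[OF MMM MP MM 3 smooth_at_from_P(1)]) (use z one_P in auto)
    then show "smooth_at (M \<times>\<^sub>M M) M z (\<lambda>(x, y). x \<otimes> y)"
    proof (rule smooth_at_eqI[OF MMM])
      fix p assume "p \<in> points (M \<times>\<^sub>M M)"
      then obtain x y where xy: "p = (x, y)" "x \<in> carrier K" "y \<in> carrier K" by auto
      have "(k \<otimes> l) \<otimes> ((inv l \<otimes> (inv k \<otimes> x) \<otimes> l) \<otimes> (inv l \<otimes> y)) =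
          k \<otimes> (l \<otimes> inv l) \<otimes> inv k \<otimes> x \<otimes> (l \<otimes> inv l) \<otimes> y"
        using xy z by (simp only: m_assoc m_closed inv_closed)
      also have "\<dots> = x \<otimes> y" using xy z by simp
      finally show "(k \<otimes> l) \<otimes> (case (inv l \<otimes> (inv k \<otimes> fst p) \<otimes> inv (inv l), inv l \<otimes> snd p) of (x, y) \<Rightarrow> x \<otimes> y) =
          (case p of (x, y) \<Rightarrow> x \<otimes> y)"
        using xy z by simp
    qed
  qed
  show "smooth_map M M (\<lambda>x. inv x)"
    unfolding smooth_map_iff[OF MM MM] topspace_M
  proof
    fix k assume k: "k \<in> carrier K"
    have 1: "smooth_at M P k (\<lambda>x. inv (inv k \<otimes> x))"
      by (rule smooth_at_compose[OF MM MP MP near[OF k]]) (use k inv in simp)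
    have 2: "smooth_at M P k (\<lambda>x. k \<otimes> inv (inv k \<otimes> x) \<otimes> inv k)"
      by (rule smooth_at_compose[OF MM MP MP 1]) (use k conj in simp)
    have "smooth_at M M k (\<lambda>x. inv k \<otimes> (k \<otimes> inv (inv k \<otimes> x) \<otimes> inv k))"
      by (rule smooth_at_compose[OF MM MP MM 2 smooth_at_from_P(1)]) (use k one_P in auto)
    then show "smooth_at M M k (\<lambda>x. inv x)"
    proof (rule smooth_at_eqI[OF MM])
      fix x assume "x \<in> points M"
      then have x: "x \<in> carrier K" by simp
      have "inv k \<otimes> (k \<otimes> inv (inv k \<otimes> x) \<otimes> inv k) = inv k \<otimes> k \<otimes> inv x \<otimes> (k \<otimes> inv k)"
        using k x by (simp only: m_assoc m_closed inv_closed inv_mult_group inv_inv)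
      then show "inv k \<otimes> (k \<otimes> inv (inv k \<otimes> x) \<otimes> inv k) = inv x" using k x by simp
    qed
  qed
qed

end

section \<open>The crossed product of a smooth module and a cocycle\<close>

locale lie_module =
  fixes G :: "('g, 'v::lcs) lie_group" (structure) and A :: "('a, 'u::lcs) lie_group" and \<rho> :: "'g \<Rightarrow> 'a \<Rightarrow> 'a"
  assumes lie_G: "lie_group G" and smooth_module: "smooth_module G A \<rho>"
begin

abbreviation add_A (infixl "\<oplus>" 70) where "a \<oplus> b \<equiv> a \<otimes>\<^bsub>A\<^esub> b"
abbreviation zero_A ("\<zero>") where "\<zero> \<equiv> \<one>\<^bsub>A\<^esub>"
abbreviation uminus_A ("\<ominus> _" [81] 80) where "\<ominus> a \<equiv> inv\<^bsub>A\<^esub> a"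
abbreviation "crossed f M \<equiv> crossed_ext G A \<rho> f M"
abbreviation "MG \<equiv> mfd G"
abbreviation "MA \<equiv> mfd A"
abbreviation "GG \<equiv> mfd G \<times>\<^sub>M mfd G"

lemma lie_A: "lie_group A"
  and comm_group_A: "comm_group A"
  and \<rho>_hom: "\<rho> \<in> hom G (AutoGroup A)"
  using smooth_module by (auto simp: smooth_module_def)

sublocale G: group G by (rule lie_groupD(1)[OF lie_G])
sublocale A: comm_group A by (rule comm_group_A)

section \<open>Rules for the module action\<close>

lemma \<rho>_auto: "g \<in> carrier G \<Longrightarrow> \<rho> g \<in> hom A A \<inter> Bij (carrier A)"
  using \<rho>_hom by (auto simp: hom_def AutoGroup_def auto_def)

lemma \<rho>_closed [simp]: "g \<in> carrier G \<Longrightarrow> a \<in> carrier A \<Longrightarrow> \<rho> g a \<in> carrier A"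
  using \<rho>_auto[of g] by (auto simp: hom_def)

lemma \<rho>_mult: "g \<in> carrier G \<Longrightarrow> a \<in> carrier A \<Longrightarrow> b \<in> carrier A \<Longrightarrow>
    \<rho> g (a \<oplus> b) = \<rho> g a \<oplus> \<rho> g b"
  using \<rho>_auto[of g] by (auto simp: hom_def)

lemma \<rho>_hom_one [simp]: "g \<in> carrier G \<Longrightarrow> \<rho> g \<zero> = \<zero>"
  using \<rho>_auto[of g] hom_one[of "\<rho> g" A A] by (auto simp: A.is_group)

lemma \<rho>_hom_inv: "g \<in> carrier G \<Longrightarrow> a \<in> carrier A \<Longrightarrow> \<rho> g (\<ominus> a) = \<ominus> \<rho> g a"
  using \<rho>_mult[of g a "\<ominus> a"] by (intro A.inv_equality[symmetric]) (simp_all add: A.m_comm)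

lemma \<rho>_act: "g \<in> carrier G \<Longrightarrow> h \<in> carrier G \<Longrightarrow> a \<in> carrier A \<Longrightarrow>
    \<rho> (g \<otimes> h) a = \<rho> g (\<rho> h a)"
  using \<rho>_hom \<rho>_auto[of g] \<rho>_auto[of h]
  by (auto simp: hom_def AutoGroup_def BijGroup_def compose_def)

lemma \<rho>_one [simp]: "a \<in> carrier A \<Longrightarrow> \<rho> \<one> a = a"
  using hom_one[OF \<rho>_hom G.is_group A.AutoGroup] by (simp add: AutoGroup_def BijGroup_def)

lemma manifold_G: "manifold MG" and manifold_A: "manifold MA"
  and topspace_G [simp]: "points MG = carrier G"
  and topspace_A [simp]: "points MA = carrier A"
  using lie_groupD[OF lie_G] lie_groupD[OF lie_A] by auto

lemma manifold_GG: "manifold GG" by (rule manifold_prod[OF manifold_G manifold_G])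

lemma smooth_at_act:
  assumes M: "manifold M" and g: "smooth_at M MG x g" and a: "smooth_at M MA x a"
  shows "smooth_at M MA x (\<lambda>y. \<rho> (g y) (a y))"
proof -
  have "smooth_at (mfd G \<times>\<^sub>M mfd A) MA (g x, a x) (\<lambda>(g, a). \<rho> g a)"
    using smooth_module smooth_map_iff[OF manifold_prod[OF manifold_G manifold_A] manifold_A]
      smooth_at_topspace(2)[OF M manifold_G g] smooth_at_topspace(2)[OF M manifold_A a]
    unfolding smooth_module_def by auto
  from smooth_at_compose[OF M manifold_prod[OF manifold_G manifold_A] manifold_A
      smooth_at_Pair[OF M manifold_G manifold_A g a] this]
  show ?thesis by simp
qed

lemmas smooth_G = smooth_at_mult[OF lie_G] smooth_at_inv[OF lie_G] smooth_at_lie_const[OF lie_G]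
  smooth_at_lie_id[OF lie_G]
  and smooth_A = smooth_at_mult[OF lie_A] smooth_at_inv[OF lie_A] smooth_at_lie_const[OF lie_A]
  smooth_at_lie_id[OF lie_A] smooth_at_act

lemma diff_eq_iff:
  assumes "a \<in> carrier A" "b \<in> carrier A" "c \<in> carrier A"
  shows "a \<oplus> \<ominus> b = c \<longleftrightarrow> a = c \<oplus> b"
proof
  assume "a \<oplus> \<ominus> b = c"
  then show "a = c \<oplus> b" using assms by (auto simp: A.m_assoc)
qed (use assms in \<open>auto simp: A.m_assoc\<close>)

section \<open>Two-cochains and the operations of crossed products\<close>

lemma cochain2D:
  assumes "f \<in> C2s G A"
  shows "g \<in> carrier G \<Longrightarrow> h \<in> carrier G \<Longrightarrow> f (g, h) \<in> carrier A"
    and "g \<in> carrier G \<Longrightarrow> f (g, \<one>) = \<zero>" "g \<in> carrier G \<Longrightarrow> f (\<one>, g) = \<zero>"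
    and "smooth_at GG MA (\<one>, \<one>) f"
  using assms smooth_near_iff[OF manifold_GG manifold_A]
  by (auto simp: C2s_def PiE_iff)

text \<open>Clears the inverses; in this form the condition is what associativity of a crossed
  product uses and what a section of an extension provides.\<close>

lemma d2_eq_one_iff:
  assumes "f \<in> C2s G A" "g \<in> carrier G" "h \<in> carrier G" "k \<in> carrier G"
  shows "d2 G A \<rho> f (g, h, k) = \<zero> \<longleftrightarrow>
    \<rho> g (f (h, k)) \<oplus> f (g, h \<otimes> k) = f (g \<otimes> h, k) \<oplus> f (g, h)"
proof -
  note c = cochain2D(1)[OF assms(1)]
  have "d2 G A \<rho> f (g, h, k) = (\<rho> g (f (h, k)) \<oplus> f (g, h \<otimes> k) \<oplus> \<ominus> f (g, h))
      \<oplus> \<ominus> f (g \<otimes> h, k)"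
    using assms(2-4) c by (simp add: d2_def A.m_ac)
  then show ?thesis
    using assms(2-4) c by (simp add: diff_eq_iff)
qed

lemma Z2s_iff:
  "f \<in> Z2s G A \<rho> \<longleftrightarrow> f \<in> C2s G A \<and> (\<forall>g\<in>carrier G. \<forall>h\<in>carrier G. \<forall>k\<in>carrier G.
    \<rho> g (f (h, k)) \<oplus> f (g, h \<otimes> k) = f (g \<otimes> h, k) \<oplus> f (g, h))"
  unfolding Z2s_def using d2_eq_one_iff by auto

lemma carrier_crossed [simp]: "carrier (tot (crossed f M)) = carrier A \<times> carrier G"
  and mult_crossed: "x \<otimes>\<^bsub>tot (crossed f M)\<^esub> y =
    (fst x \<oplus> \<rho> (snd x) (fst y) \<oplus> f (snd x, snd y), snd x \<otimes> snd y)"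
  and one_crossed [simp]: "\<one>\<^bsub>tot (crossed f M)\<^esub> = (\<zero>, \<one>)"
  and mfd_crossed [simp]: "mfd (tot (crossed f M)) = M"
  and inc_crossed [simp]: "inc (crossed f M) = (\<lambda>a. (a, \<one>))"
  and proj_crossed [simp]: "proj (crossed f M) = snd"
  by (simp_all add: crossed_ext_def case_prod_unfold)

text \<open>The group operations ignore the manifold component, so the group can be studied with the
  placeholder \<open>undefined\<close> before a manifold structure has been built.\<close>

lemma inv_crossed_mfd: "inv\<^bsub>tot (crossed f M)\<^esub> x = inv\<^bsub>tot (crossed f M')\<^esub> x"
  by (simp add: m_inv_def mult_crossed)

end

locale lie_cocycle = lie_module G A \<rho>
  for G :: "('g, 'v::lcs) lie_group" (structure) and A :: "('a, 'u::lcs) lie_group" and \<rho> +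
  fixes f
  assumes f_Z2s: "f \<in> Z2s G A \<rho>"
begin

abbreviation "K M \<equiv> tot (crossed f M)"

lemma f_C2s: "f \<in> C2s G A" using f_Z2s by (simp add: Z2s_def)

lemmas f_closed [simp] = cochain2D(1)[OF f_C2s]
  and f_one [simp] = cochain2D(2,3)[OF f_C2s]
  and f_smooth = cochain2D(4)[OF f_C2s]

lemma cocycle: "g \<in> carrier G \<Longrightarrow> h \<in> carrier G \<Longrightarrow> k \<in> carrier G \<Longrightarrow>
    \<rho> g (f (h, k)) \<oplus> f (g, h \<otimes> k) = f (g \<otimes> h, k) \<oplus> f (g, h)"
  using f_Z2s unfolding Z2s_iff by blast

lemma crossed_left_inverse:
  assumes "x \<in> carrier A \<times> carrier G"
  defines "g \<equiv> inv snd x"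
  shows "(\<ominus> (\<rho> g (fst x) \<oplus> f (g, snd x)), g) \<otimes>\<^bsub>K M\<^esub> x = (\<zero>, \<one>)"
  using assms by (auto simp: mult_crossed A.m_assoc)

lemma group_crossed: "group (K M)"
proof (rule groupI)
  fix x y z assume "x \<in> carrier (K M)" "y \<in> carrier (K M)" "z \<in> carrier (K M)"
  then obtain a g b h c k where xyz: "x = (a, g)" "y = (b, h)" "z = (c, k)"
    and c [simp]: "a \<in> carrier A" "b \<in> carrier A" "c \<in> carrier A"
      "g \<in> carrier G" "h \<in> carrier G" "k \<in> carrier G" by auto
  \<comment> \<open>The two bracketings differ exactly by the two sides of the cocycle
    identity.\<close>
  have "a \<oplus> \<rho> g b \<oplus> f (g, h) \<oplus> \<rho> (g \<otimes> h) c \<oplus> f (g \<otimes> h, k) =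
      a \<oplus> \<rho> g b \<oplus> \<rho> g (\<rho> h c) \<oplus> (f (g \<otimes> h, k) \<oplus> f (g, h))"
    by (simp add: A.m_ac \<rho>_act)
  also have "\<dots> = a \<oplus> \<rho> g (b \<oplus> \<rho> h c \<oplus> f (h, k)) \<oplus> f (g, h \<otimes> k)"
    by (simp add: \<rho>_mult A.m_assoc flip: cocycle)
  finally show "x \<otimes>\<^bsub>K M\<^esub> y \<otimes>\<^bsub>K M\<^esub> z = x \<otimes>\<^bsub>K M\<^esub> (y \<otimes>\<^bsub>K M\<^esub> z)"
    by (simp add: xyz mult_crossed G.m_assoc)
next
  fix x assume x: "x \<in> carrier (K M)"
  show "\<exists>y\<in>carrier (K M). y \<otimes>\<^bsub>K M\<^esub> x = \<one>\<^bsub>K M\<^esub>"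
    using crossed_left_inverse[of x M] x
    by (intro bexI[of _ "(\<ominus> (\<rho> (inv snd x) (fst x) \<oplus> f (inv snd x, snd x)), inv snd x)"])
      auto
qed (auto simp: mult_crossed)

lemma inv_crossed:
  assumes "x \<in> carrier A \<times> carrier G"
  shows "inv\<^bsub>K M\<^esub> x =
    (\<ominus> (\<rho> (inv snd x) (fst x) \<oplus> f (inv snd x, snd x)), inv snd x)"
  using crossed_left_inverse[OF assms, of M] assms
  by (intro group.inv_equality[OF group_crossed]) auto

lemma snd_crossed:
  "snd (x \<otimes>\<^bsub>K M\<^esub> y) = snd x \<otimes> snd y"
  "x \<in> carrier A \<times> carrier G \<Longrightarrow> snd (inv\<^bsub>K M\<^esub> x) = inv snd x"
  by (simp_all add: mult_crossed inv_crossed)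

text \<open>The source of f_g: conjugation of (a, g) by (c, z) has A-component c + z.a + f_z(g) - (z
  g z^-1).c, in which f_z(g) is the only term whose smoothness does not already come from the module
  and the group. The formula is verified after multiplying by \<open>k\<close> on the right, which
  keeps inverses out of the computation.\<close>

lemma conj_crossed:
  assumes "k \<in> carrier A \<times> carrier G" "x \<in> carrier A \<times> carrier G"
  shows "k \<otimes>\<^bsub>K M\<^esub> x \<otimes>\<^bsub>K M\<^esub> inv\<^bsub>K M\<^esub> k =
    (fst k \<oplus> \<rho> (snd k) (fst x) \<oplus> conj_defect G A f (snd k) (snd x)
        \<oplus> \<ominus> \<rho> (snd k \<otimes> snd x \<otimes> inv snd k) (fst k),
      snd k \<otimes> snd x \<otimes> inv snd k)" (is "_ = ?y")
proof -
  interpret K: group "K M" by (rule group_crossed)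
  obtain c z a g where kx: "k = (c, z)" "x = (a, g)"
    and [simp]: "c \<in> carrier A" "z \<in> carrier G" "a \<in> carrier A" "g \<in> carrier G"
    using assms by auto
  define g' where "g' = z \<otimes> g \<otimes> inv z"
  have g' [simp]: "g' \<in> carrier G" "g' \<otimes> z = z \<otimes> g"
    by (simp_all add: g'_def G.m_assoc)
  have "c \<oplus> \<rho> z a \<oplus> (f (z, g) \<oplus> \<ominus> f (g', z)) \<oplus> \<ominus> \<rho> g' c
      \<oplus> \<rho> g' c \<oplus> f (g', z) = c \<oplus> \<rho> z a \<oplus> f (z, g)"
    by (simp add: A.m_assoc)
  then have "?y \<otimes>\<^bsub>K M\<^esub> k = k \<otimes>\<^bsub>K M\<^esub> x"
    by (simp add: kx mult_crossed conj_defect_def flip: g'_def)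
  moreover have "?y \<in> carrier (K M)"
    using assms by (auto simp: conj_defect_def)
  ultimately show ?thesis
    using assms K.inv_solve_right' K.m_closed by (metis carrier_crossed)
qed

section \<open>Smoothness over the product manifold A x G\<close>

abbreviation "AG \<equiv> mfd A \<times>\<^sub>M mfd G"

lemma manifold_AG: "manifold AG" by (rule manifold_prod[OF manifold_A manifold_G])

lemma smooth_at_AG:
  assumes M: "manifold M"
  shows "smooth_at M AG x F \<longleftrightarrow> smooth_at M MA x (\<lambda>y. fst (F y)) \<and> smooth_at M MG x (\<lambda>y. snd (F y))"
proof
  assume F: "smooth_at M AG x F"
  have Fx: "F x \<in> points MA \<times> points MG"
    using smooth_at_topspace(2)[OF M manifold_AG F] by simp
  show "smooth_at M MA x (\<lambda>y. fst (F y)) \<and> smooth_at M MG x (\<lambda>y. snd (F y))"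
    using smooth_at_compose[OF M manifold_AG manifold_A F smooth_at_fst_snd(1)[OF manifold_A manifold_G Fx]]
      smooth_at_compose[OF M manifold_AG manifold_G F smooth_at_fst_snd(2)[OF manifold_A manifold_G Fx]]
    by (rule conjI)
next
  assume "smooth_at M MA x (\<lambda>y. fst (F y)) \<and> smooth_at M MG x (\<lambda>y. snd (F y))"
  then have "smooth_at M AG x (\<lambda>y. (fst (F y), snd (F y)))"
    using smooth_at_Pair[OF M manifold_A manifold_G] by blast
  then show "smooth_at M AG x F" by simp
qed

lemma smooth_at_f:
  assumes M: "manifold M" and g: "smooth_at M MG x g" and h: "smooth_at M MG x h"
    and f: "smooth_at GG MA (g x, h x) f"
  shows "smooth_at M MA x (\<lambda>y. f (g y, h y))"
  by (rule smooth_at_compose[OF M manifold_GG manifold_A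
        smooth_at_Pair[OF M manifold_G manifold_G g h] f])

lemma smooth_at_crossed_mult:
  assumes M: "manifold M" and F: "smooth_at M AG x F" and F': "smooth_at M AG x F'"
    and f: "smooth_at GG MA (snd (F x), snd (F' x)) f"
  shows "smooth_at M AG x (\<lambda>y. F y \<otimes>\<^bsub>K M'\<^esub> F' y)"
  using F F' f unfolding smooth_at_AG[OF M] mult_crossed fst_conv snd_conv
  by (intro conjI smooth_A M smooth_G smooth_at_f[OF M]) auto

text \<open>Left translation by (c, z) involves f(z, g), and z is not chosen small. If g and z g
  both lie in U, however, then z = (z g) g^-1 is close to 1; U is taken so small that these
  quotients stay in the region where f is smooth.\<close>

lemma small_neighbourhood:
  obtains U where "mopen MG U" "\<one> \<in> U"
    "\<And>z g. z \<in> carrier G \<Longrightarrow> g \<in> U \<Longrightarrow> z \<otimes> g \<in> U \<Longrightarrow>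
      smooth_at GG MA (z, g) f"
proof -
  obtain S where S: "mopen GG S" "(\<one>, \<one>) \<in> S"
    "\<And>y. y \<in> S \<Longrightarrow> smooth_at GG MA y f"
    by (rule smooth_at_nearby[OF f_smooth]) blast
  obtain X Y where XY: "mopen MG X" "mopen MG Y"
    "\<one> \<in> X" "\<one> \<in> Y" "X \<times> Y \<subseteq> S"
    using S(1)[unfolded mtop_prod_mfd openin_prod_topology_alt, rule_format, OF S(2)] by blast
  have 1: "(\<one>, \<one>) \<in> points MG \<times> points MG" by simp
  have d: "smooth_at GG MG (\<one>, \<one>) (\<lambda>p. fst p \<otimes> inv snd p)"
    by (intro smooth_G manifold_GG smooth_at_fst_snd[OF manifold_G manifold_G 1])
  obtain T where T: "mopen GG T" "(\<one>, \<one>) \<in> T"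
    "(\<lambda>p. fst p \<otimes> inv snd p) ` T \<subseteq> X"
    by (rule smooth_at_continuous[OF manifold_GG manifold_G d XY(1)]) (use XY(3) in simp)
  obtain V W where VW: "mopen MG V" "mopen MG W"
    "\<one> \<in> V" "\<one> \<in> W" "V \<times> W \<subseteq> T"
    using T(1)[unfolded mtop_prod_mfd openin_prod_topology_alt, rule_format, OF T(2)] by blast
  show ?thesis
  proof (rule that[of "V \<inter> W \<inter> Y"])
    show "mopen MG (V \<inter> W \<inter> Y)" using VW XY by blast
    fix z g assume z: "z \<in> carrier G" "g \<in> V \<inter> W \<inter> Y" "z \<otimes> g \<in> V \<inter> W \<inter> Y"
    have g: "g \<in> carrier G" using z(2) openin_subset[OF VW(1)] by auto
    have "(z \<otimes> g) \<otimes> inv g \<in> X" using z VW(5) T(3) by force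
    then have "(z, g) \<in> S" using z g XY(5) by (auto simp: G.m_assoc)
    then show "smooth_at GG MA (z, g) f" by (rule S(3))
  qed (use VW XY in auto)
qed

end

text \<open>
  With \<open>U\<close> as in \<open>small_neighbourhood\<close>, the set \<open>A \<times> U\<close> is not small in the direction of \<open>A\<close>, so
  that the resulting manifold is locally trivial over \<open>G\<close> by construction.
\<close>

theorem (in lie_module) crossed_structure_exists:
  assumes f: "f \<in> Z2ss G A \<rho>"
  shows "\<exists>M. crossed_structure G A \<rho> f M"
proof -
  interpret lie_cocycle G A \<rho> f
    by unfold_locales (use f in \<open>simp add: Z2ss_def\<close>)
  have defect: "smooth_at MG MA \<one> (conj_defect G A f z)" if "z \<in> carrier G" for z
    using f that smooth_near_iff[OF manifold_G manifold_A] by (auto simp: Z2ss_def C1s_def)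
  obtain U where U: "mopen MG U" "\<one> \<in> U"
    and fU: "\<And>z g. z \<in> carrier G \<Longrightarrow> g \<in> U \<Longrightarrow> z \<otimes> g \<in> U \<Longrightarrow>
      smooth_at GG MA (z, g) f"
    by (rule small_neighbourhood) blast
  have UG: "U \<subseteq> carrier G" using openin_subset[OF U(1)] by simp
  have oAU: "mopen AG (carrier A \<times> U)"
    using openin_topspace[of "mtop MA"] U(1) by (simp add: openin_prod_Times_iff)
  define P where "P = open_submfd AG (carrier A \<times> U)"
  have MP: "manifold P" unfolding P_def by (rule manifold_open_submfd[OF manifold_AG oAU])
  have B: "points P = carrier A \<times> U" using UG by (auto simp: P_def)
  have from_P: "smooth_at P N x F \<longleftrightarrow> smooth_at AG N x F"
    if "manifold N" "x \<in> carrier A \<times> U" for N :: "('c, 'd::lcs) manifold" and x F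
    unfolding P_def by (rule smooth_at_open_submfd_iff[OF manifold_AG that(1) oAU that(2)])
  have into_P: "smooth_at N P x F \<longleftrightarrow> smooth_at N AG x F"
    if "manifold N" "F x \<in> carrier A \<times> U" for N :: "('c, 'd::lcs) manifold" and x F
    unfolding P_def by (rule smooth_at_into_open_submfd_iff[where f = F and x = x, OF that(1) manifold_AG oAU that(2)])
  have id_AG: "smooth_at AG AG x (\<lambda>x. x)" if "x \<in> carrier A \<times> carrier G" for x
    using smooth_at_id[OF manifold_AG] that by simp
  have id_P: "smooth_at P AG x (\<lambda>x. x)" if "x \<in> carrier A \<times> U" for x
    using from_P[OF manifold_AG that] id_AG that UG by auto
  have const_P: "smooth_at P AG x (\<lambda>_. k)" if "k \<in> carrier A \<times> carrier G" "x \<in> carrier A \<times> U" for x k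
    using that by (intro smooth_at_const[OF MP manifold_AG]) (simp_all add: B)
  let ?K = "K undefined"
  \<comment> \<open>The separating map is the projection to G: two points with the same G-component
    differ by an element of A x {1}, which lies in A x U.\<close>
  interpret L: local_lie_group ?K P snd "mtop MG"
  proof (unfold local_lie_group_def local_lie_group_axioms_def, intro conjI allI impI)
    show "group ?K" by (rule group_crossed)
    show "manifold P" by (rule MP)
    show "points P \<subseteq> carrier ?K" "\<one>\<^bsub>?K\<^esub> \<in> points P" using UG U(2) by (auto simp: B)
    show "Hausdorff_space (mtop MG)" by (rule manifold_Hausdorff[OF manifold_G])
  next
    fix m p assume m: "m \<in> carrier ?K" and p: "p \<in> points P" "m \<otimes>\<^bsub>?K\<^esub> p \<in> points P"
    \<comment> \<open>Both \<open>p\<close> and its translate have G-component in U, the situation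
      for which \<open>small_neighbourhood\<close> gives smoothness of f.\<close>
    then have "snd m \<in> carrier G" "snd p \<in> U" "snd m \<otimes> snd p \<in> U"
      by (auto simp: B mult_crossed)
    then show "smooth_at P P p (\<lambda>x. m \<otimes>\<^bsub>?K\<^esub> x)"
      using m p by (subst into_P[OF MP], simp only: B)
        (intro smooth_at_crossed_mult[OF MP] const_P id_P, auto simp: B fU)
  next
    fix k assume k: "k \<in> carrier ?K"
    have "smooth_map P MG (\<lambda>p. snd k \<otimes> snd p)"
      unfolding smooth_map_iff[OF MP manifold_G] B
    proof
      fix x assume x: "x \<in> carrier A \<times> U"
      show "smooth_at P MG x (\<lambda>p. snd k \<otimes> snd p)"
        using id_P[OF x] k x unfolding smooth_at_AG[OF MP]
        by (intro smooth_G MP ) (auto simp: B)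
    qed
    then show "continuous_map (mtop P) (mtop MG) (\<lambda>p. snd (k \<otimes>\<^bsub>?K\<^esub> p))"
      by (simp add: smooth_map_def mult_crossed)
  next
    fix x y assume xy: "x \<in> carrier ?K" "y \<in> carrier ?K" "snd x = snd y"
    interpret K: group ?K by (rule group_crossed)
    have "inv\<^bsub>?K\<^esub> x \<otimes>\<^bsub>?K\<^esub> y \<in> carrier ?K" using xy by (intro K.m_closed K.inv_closed)
    moreover have "snd (inv\<^bsub>?K\<^esub> x \<otimes>\<^bsub>?K\<^esub> y) = \<one>"
      using xy by (auto simp: snd_crossed)
    ultimately show "inv\<^bsub>?K\<^esub> x \<otimes>\<^bsub>?K\<^esub> y \<in> points P"
      using U(2) by (simp add: B mem_Times_iff)
  qed
  define M where "M = translate_mfd ?K P"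
  have MM: "manifold M" unfolding M_def by (rule L.manifold_M)
  have TM: "points M = carrier A \<times> carrier G" unfolding M_def by simp
  let ?e = "(\<zero>, \<one>)"
  have e: "?e \<in> carrier A \<times> U" using U(2) by simp
  have f1: "smooth_at GG MA (\<one>, \<one>) f" by (rule f_smooth)
  note MPP = manifold_prod[OF MP MP]
  have smooth: "smooth_map (M \<times>\<^sub>M M) M (\<lambda>(x, y). x \<otimes>\<^bsub>?K\<^esub> y)" "smooth_map M M (\<lambda>x. inv\<^bsub>?K\<^esub> x)"
  proof -
    have ee: "(?e, ?e) \<in> points P \<times> points P" using e by (simp add: B)
    have 1: "smooth_at (P \<times>\<^sub>M P) AG (?e, ?e) fst" "smooth_at (P \<times>\<^sub>M P) AG (?e, ?e) snd"
      using smooth_at_compose[OF MPP MP manifold_AG smooth_at_fst_snd(1)[OF MP MP ee] id_P]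
        smooth_at_compose[OF MPP MP manifold_AG smooth_at_fst_snd(2)[OF MP MP ee] id_P] e by simp_all
    have "smooth_at (P \<times>\<^sub>M P) AG (?e, ?e) (\<lambda>p. fst p \<otimes>\<^bsub>?K\<^esub> snd p)"
      by (rule smooth_at_crossed_mult[OF MPP 1]) (use f1 in simp)
    then have mult: "smooth_at (P \<times>\<^sub>M P) P (?e, ?e) (\<lambda>(x, y). x \<otimes>\<^bsub>?K\<^esub> y)"
      unfolding case_prod_unfold using U(2) by (subst into_P[OF MPP]) (auto simp: mult_crossed)
    note id1 = id_P[OF e, unfolded smooth_at_AG[OF MP], THEN conjunct1]
      and id2 = id_P[OF e, unfolded smooth_at_AG[OF MP], THEN conjunct2]
    have 2: "smooth_at P AG ?e (\<lambda>x. (\<ominus> (\<rho> (inv snd x) (fst x) \<oplus> f (inv snd x, snd x)),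
        inv snd x))"
      unfolding smooth_at_AG[OF MP] fst_conv snd_conv
      by (intro conjI smooth_A MP smooth_G smooth_at_f[OF MP] id1 id2) (use f1 in simp)
    have "smooth_at P AG ?e (\<lambda>x. inv\<^bsub>?K\<^esub> x)"
      by (rule smooth_at_eqI[OF MP 2]) (use UG in \<open>auto simp: B inv_crossed\<close>)
    then have inv: "smooth_at P P ?e (\<lambda>x. inv\<^bsub>?K\<^esub> x)"
      using U(2) by (subst into_P[OF MP]) (auto simp: inv_crossed)
    have conj: "smooth_at P P ?e (\<lambda>x. k \<otimes>\<^bsub>?K\<^esub> x \<otimes>\<^bsub>?K\<^esub> inv\<^bsub>?K\<^esub> k)" if k: "k \<in> carrier ?K" for k
    proof -
      have cG: "smooth_at P MG ?e (\<lambda>x. snd k \<otimes> snd x \<otimes> inv snd k)"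
        using k e by (intro smooth_G MP id2 ) (auto simp: B)
      \<comment> \<open>Here the condition that distinguishes Z2ss from Z2s enters.\<close>
      have cf: "smooth_at P MA ?e (\<lambda>x. conj_defect G A f (snd k) (snd x))"
        by (rule smooth_at_compose[OF MP manifold_G manifold_A id2]) (use k defect in auto)
      have 3: "smooth_at P AG ?e (\<lambda>x. (fst k \<oplus> \<rho> (snd k) (fst x) \<oplus> conj_defect G A f (snd k) (snd x)
          \<oplus> \<ominus> \<rho> (snd k \<otimes> snd x \<otimes> inv snd k) (fst k),
        snd k \<otimes> snd x \<otimes> inv snd k))"
        unfolding smooth_at_AG[OF MP] fst_conv snd_conv using k e
        by (intro conjI smooth_A MP id1 cG cf smooth_G ) (auto simp: B)
      have "smooth_at P AG ?e (\<lambda>x. k \<otimes>\<^bsub>?K\<^esub> x \<otimes>\<^bsub>?K\<^esub> inv\<^bsub>?K\<^esub> k)"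
        by (rule smooth_at_eqI[OF MP 3]) (use UG k conj_crossed in \<open>auto simp: B\<close>)
      moreover have "k \<otimes>\<^bsub>?K\<^esub> ?e \<otimes>\<^bsub>?K\<^esub> inv\<^bsub>?K\<^esub> k = ?e"
        using L.r_inv[OF k] L.r_one[OF k] by simp
      ultimately show ?thesis
        using e by (subst into_P[OF MP]) auto
    qed
    show "smooth_map (M \<times>\<^sub>M M) M (\<lambda>(x, y). x \<otimes>\<^bsub>?K\<^esub> y)" "smooth_map M M (\<lambda>x. inv\<^bsub>?K\<^esub> x)"
      unfolding M_def using L.smooth_at_translate_mfd[unfolded one_crossed, OF mult inv conj] by auto
  qed
  have lie_K: "lie_group (K M)"
    unfolding lie_group_def mfd_crossed
  proof (intro conjI group_crossed MM)
    show "smooth_map (M \<times>\<^sub>M M) M (\<lambda>(x, y). x \<otimes>\<^bsub>K M\<^esub> y)"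
      using smooth(1) by (simp add: mult_crossed)
    show "smooth_map M M (\<lambda>x. inv\<^bsub>K M\<^esub> x)"
      unfolding inv_crossed_mfd[of f M _ undefined] by (rule smooth(2))
  qed (simp add: TM)
  have oM: "mopen M (carrier A \<times> U)"
  proof -
    have "(\<otimes>\<^bsub>?K\<^esub>) \<one>\<^bsub>?K\<^esub> ` (carrier A \<times> U) = carrier A \<times> U"
      using L.l_one UG by (intro image_cong[THEN trans, OF refl _ image_ident]) auto
    then show ?thesis
      using L.openin_translate[OF L.one_closed, of "carrier A \<times> U"] openin_topspace[of "mtop P"]
      unfolding M_def B by simp
  qed
  have l_one: "\<one>\<^bsub>?K\<^esub> \<otimes>\<^bsub>?K\<^esub> x = x" if "x \<in> carrier A \<times> U" for x
    using L.l_one[of x] that UG by auto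
  \<comment> \<open>On A x U the constructed manifold and the product A x G have the same smooth
    germs. The inclusion, the projection, the section and the trivialisation are all tested
    there.\<close>
  have id_MAG: "smooth_at M AG x (\<lambda>x. x)" "smooth_at AG M x (\<lambda>x. x)" if x: "x \<in> carrier A \<times> U" for x
  proof -
    have xK: "x \<in> carrier ?K" using x UG by auto
    have 1: "smooth_at P M x (\<lambda>x. \<one>\<^bsub>?K\<^esub> \<otimes>\<^bsub>?K\<^esub> x)"
      unfolding M_def by (rule L.smooth_at_from_P(1)[OF L.one_closed]) (use x B in simp)
    then have "smooth_at AG M x (\<lambda>x. \<one>\<^bsub>?K\<^esub> \<otimes>\<^bsub>?K\<^esub> x)"
      using from_P[OF MM x] by blast
    then show "smooth_at AG M x (\<lambda>x. x)"
      by (rule smooth_at_cong[OF manifold_AG oAU x, rotated]) (rule l_one)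
    have "smooth_at M P (\<one>\<^bsub>?K\<^esub> \<otimes>\<^bsub>?K\<^esub> x) (\<lambda>x. inv\<^bsub>?K\<^esub> \<one>\<^bsub>?K\<^esub> \<otimes>\<^bsub>?K\<^esub> x)"
      unfolding M_def by (rule L.smooth_at_from_P(2)[OF L.one_closed]) (use x B in simp)
    then have "smooth_at M P x (\<lambda>x. \<one>\<^bsub>?K\<^esub> \<otimes>\<^bsub>?K\<^esub> x)" using L.l_one[OF xK] L.inv_one by simp
    then have "smooth_at M P x (\<lambda>x. x)"
      by (rule smooth_at_cong[OF MM oM x, rotated]) (rule l_one)
    then show "smooth_at M AG x (\<lambda>x. x)" using into_P[OF MM, of "\<lambda>x. x" x] x by blast
  qed
  have from_AG: "smooth_at N M x (\<lambda>y. (a y, g y))"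
    if N: "manifold N" and "smooth_at N MA x a" "smooth_at N MG x g" "g x \<in> U"
    for N :: "('c, 'd::lcs) manifold" and x a g
    using smooth_at_compose[OF N manifold_AG MM smooth_at_Pair[OF N manifold_A manifold_G that(2,3)]
        id_MAG(2)] smooth_at_topspace(2)[OF N manifold_A that(2)] that(4) by simp
  have into_AG: "smooth_at M MA x fst" "smooth_at M MG x snd" if "x \<in> carrier A \<times> U" for x
    using id_MAG(1)[OF that] unfolding smooth_at_AG[OF MM] by auto
  have section_smooth: "smooth_at MG M g (\<lambda>g. (\<zero>, g))" if "g \<in> U" for g
    using that UG by (intro from_AG manifold_G smooth_A smooth_G) auto
  let ?E = "crossed f M"
  have inc_smooth: "smooth_at MA M a (\<lambda>a. (a, \<one>))" if "a \<in> carrier A" for a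
    using that U by (intro from_AG manifold_A smooth_G smooth_A) auto
  have "lie_extension A G ?E"
    unfolding lie_extension_def
  proof (intro conjI lie_A lie_G lie_K)
    show "proj ?E \<in> lie_hom (tot ?E) G"
      by (rule lie_homI[OF lie_K lie_G]) (use into_AG(2)[OF e] in \<open>auto simp: hom_def mult_crossed\<close>)
    show "proj ?E ` carrier (tot ?E) = carrier G" by force
    show "inc ?E \<in> hom A (tot ?E)" by (auto simp: hom_def mult_crossed)
    show "inj_on (inc ?E) (carrier A)" by (simp add: inj_on_def)
    show "inc ?E ` carrier A = kernel (tot ?E) G (proj ?E)" by (auto simp: kernel_def)
    note AM = manifold_prod[OF manifold_A MM]
    show "smooth_map (mfd A \<times>\<^sub>M mfd (tot ?E)) (mfd (tot ?E)) (\<lambda>(n, x). inc ?E n \<otimes>\<^bsub>tot ?E\<^esub> x)"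
      unfolding mfd_crossed smooth_map_iff[OF AM MM] case_prod_unfold
    proof
      fix z assume "z \<in> points (mfd A \<times>\<^sub>M M)"
      then have z: "z \<in> points MA \<times> points M" by simp
      have "smooth_at (mfd A \<times>\<^sub>M M) M z (\<lambda>p. inc ?E (fst p))"
        unfolding inc_crossed
        by (rule smooth_at_compose[OF AM manifold_A MM smooth_at_fst_snd(1)[OF manifold_A MM z] inc_smooth])
          (use z in auto)
      then show "smooth_at (mfd A \<times>\<^sub>M M) M z (\<lambda>p. inc ?E (fst p) \<otimes>\<^bsub>tot ?E\<^esub> snd p)"
        using smooth_at_mult[OF lie_K AM, unfolded mfd_crossed] smooth_at_fst_snd(2)[OF manifold_A MM z]
        by blast
    qed
    have pre: "{x \<in> carrier (tot ?E). proj ?E x \<in> U} = carrier A \<times> U" using UG by auto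
    \<comment> \<open>For the section g |-> (0, g) the trivialisation (n, g) |-> (n, 1)(0, g) is the
      identity map of A x U.\<close>
    let ?D = "\<lambda>(n, g). inc ?E n \<otimes>\<^bsub>tot ?E\<^esub> (\<zero>, g)"
    let ?X = "mfd A \<times>\<^sub>M open_submfd MG U" and ?Y = "open_submfd M (carrier A \<times> U)"
    note GU = manifold_open_submfd[OF manifold_G U(1)]
    note MX = manifold_prod[OF manifold_A GU] and MY = manifold_open_submfd[OF MM oM]
    have TX: "points ?X = carrier A \<times> U" and TY: "points ?Y = carrier A \<times> U"
      using UG by (auto simp: TM)
    have D: "?D x = x" if "x \<in> carrier A \<times> U" for x
      using that UG by (auto simp: mult_crossed)
    have bij: "bij_betw ?D (carrier A \<times> U) (carrier A \<times> U)"
      using bij_betw_id[of "carrier A \<times> U"] D by (subst bij_betw_cong[of _ _ id]) auto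
    have inv: "inv_into (carrier A \<times> U) ?D x = x" if "x \<in> carrier A \<times> U" for x
      by (rule inv_into_f_eq[OF bij_betw_imp_inj_on[OF bij] that D[OF that]])
    have snd_X: "smooth_at ?X MG x snd" if "x \<in> carrier A \<times> U" for x
      using smooth_at_compose[OF MX GU manifold_G smooth_at_fst_snd(2)[OF manifold_A GU]
          smooth_at_open_submfd_id(1)[OF manifold_G U(1)]] that UG by auto
    have "diffeo ?X ?Y ?D"
      unfolding diffeo_def TX TY
    proof (intro conjI bij)
      show "smooth_map ?X ?Y ?D"
        unfolding smooth_map_iff[OF MX MY] TX
      proof
        fix x assume x: "x \<in> carrier A \<times> U"
        have "smooth_at ?X M x (\<lambda>p. (fst p, snd p))"
          using x UG snd_X by (intro from_AG MX smooth_at_fst_snd(1)[OF manifold_A GU]) auto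
        then have "smooth_at ?X ?Y x (\<lambda>p. p)"
          using x by (subst smooth_at_into_open_submfd_iff[OF MX MM oM]) auto
        then show "smooth_at ?X ?Y x ?D"
          by (rule smooth_at_eqI[OF MX]) (simp only: TX D)
      qed
      show "smooth_map ?Y ?X (inv_into (carrier A \<times> U) ?D)"
        unfolding smooth_map_iff[OF MY MX] TY
      proof
        fix x assume x: "x \<in> carrier A \<times> U"
        have "smooth_at M (open_submfd MG U) x snd"
          using x by (subst smooth_at_into_open_submfd_iff[OF MM manifold_G U(1)]) (auto intro: into_AG)
        then have "smooth_at M ?X x (\<lambda>p. (fst p, snd p))"
          using x by (intro smooth_at_Pair[OF MM manifold_A GU] into_AG)
        then have "smooth_at ?Y ?X x (\<lambda>p. p)"
          using smooth_at_open_submfd_iff[OF MM MX oM x] by simp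
        then show "smooth_at ?Y ?X x (inv_into (carrier A \<times> U) ?D)"
          by (rule smooth_at_eqI[OF MY]) (simp only: TY inv)
      qed
    qed
    moreover have "smooth_map (open_submfd MG U) M (\<lambda>g. (\<zero>, g))"
      unfolding smooth_map_iff[OF GU MM]
      using smooth_at_open_submfd_iff[OF manifold_G MM U(1)] section_smooth by simp
    ultimately show "\<exists>U \<sigma>. mopen MG U \<and> \<one> \<in> U \<and>
      smooth_map (open_submfd MG U) (mfd (tot ?E)) \<sigma> \<and> (\<forall>g\<in>U. proj ?E (\<sigma> g) = g) \<and>
      diffeo (mfd A \<times>\<^sub>M open_submfd MG U)
        (open_submfd (mfd (tot ?E)) {x \<in> carrier (tot ?E). proj ?E x \<in> U})
        (\<lambda>(n, g). inc ?E n \<otimes>\<^bsub>tot ?E\<^esub> \<sigma> g)"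
      using U pre by (intro exI[of _ U] exI[of _ "\<lambda>g. (\<zero>, g)"]) simp
  qed
  moreover have "x \<otimes>\<^bsub>tot ?E\<^esub> inc ?E a \<otimes>\<^bsub>tot ?E\<^esub> inv\<^bsub>tot ?E\<^esub> x = inc ?E (\<rho> (proj ?E x) a)"
    if "x \<in> carrier (tot ?E)" "a \<in> carrier A" for x a
  proof -
    interpret K: group "tot ?E" by (rule group_crossed)
    have "inc ?E (\<rho> (proj ?E x) a) \<otimes>\<^bsub>tot ?E\<^esub> x = x \<otimes>\<^bsub>tot ?E\<^esub> inc ?E a"
      using that by (auto simp: mult_crossed A.m_comm)
    moreover have "inc ?E (\<rho> (proj ?E x) a) \<in> carrier (tot ?E)" "inc ?E a \<in> carrier (tot ?E)"
      using that by auto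
    ultimately show ?thesis
      using that K.inv_solve_right' K.m_closed by metis
  qed
  ultimately have "module_extension G A \<rho> ?E" unfolding module_extension_def by blast
  then have "crossed_structure G A \<rho> f M"
    unfolding crossed_structure_def using section_smooth U(2) smooth_near_iff[OF manifold_G MM] by blast
  then show ?thesis by blast
qed

section \<open>Extensions of Lie groups\<close>

locale module_ext = lie_module G A \<rho>
  for G :: "('g, 'v::lcs) lie_group" (structure) and A :: "('a, 'u::lcs) lie_group" and \<rho> +
  fixes E :: "('a, 'g, 'e, 'w::lcs) lie_ext"
  assumes ext: "module_extension G A \<rho> E"
begin

abbreviation "T \<equiv> tot E"
abbreviation "MT \<equiv> mfd T"
abbreviation "i \<equiv> inc E"
abbreviation "q \<equiv> proj E"
abbreviation mult_T (infixl "\<cdot>" 70) where "x \<cdot> y \<equiv> x \<otimes>\<^bsub>T\<^esub> y"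

definition "j = inv_into (carrier A) i"

lemma lie_extension: "lie_extension A G E"
  using ext by (simp add: module_extension_def)

section \<open>Algebra of the inclusion, the projection and the kernel\<close>

lemma lie_T: "lie_group T"
  and q_lie_hom: "q \<in> lie_hom T G"
  and q_surj: "q ` carrier T = carrier G"
  and i_hom: "i \<in> hom A T"
  and i_inj: "inj_on i (carrier A)"
  and i_kernel: "i ` carrier A = kernel T G q"
  using lie_extension unfolding lie_extension_def by blast+

sublocale T: group T by (rule lie_groupD(1)[OF lie_T])

lemma manifold_T: "manifold MT" and topspace_T [simp]: "points MT = carrier T"
  using lie_groupD[OF lie_T] by auto

lemma q_hom: "q \<in> hom T G" using q_lie_hom by (simp add: lie_hom_def)

lemma q_closed [simp]: "x \<in> carrier T \<Longrightarrow> q x \<in> carrier G"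
  and q_mult [simp]: "x \<in> carrier T \<Longrightarrow> y \<in> carrier T \<Longrightarrow> q (x \<cdot> y) = q x \<otimes> q y"
  using q_hom by (auto simp: hom_def)

lemma q_one [simp]: "q \<one>\<^bsub>T\<^esub> = \<one>"
  by (rule hom_one[OF q_hom T.is_group G.is_group])

lemma q_inv [simp]: "x \<in> carrier T \<Longrightarrow> q (inv\<^bsub>T\<^esub> x) = inv q x"
  using group_hom.hom_inv[of T G q x] q_hom by (simp add: group_hom_def group_hom_axioms_def)

lemma i_closed [simp]: "a \<in> carrier A \<Longrightarrow> i a \<in> carrier T"
  and i_mult: "a \<in> carrier A \<Longrightarrow> b \<in> carrier A \<Longrightarrow> i (a \<oplus> b) = i a \<cdot> i b"
  using i_hom by (auto simp: hom_def)

lemma i_one [simp]: "i \<zero> = \<one>\<^bsub>T\<^esub>"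
  by (rule hom_one[OF i_hom A.is_group T.is_group])

lemma i_inv: "a \<in> carrier A \<Longrightarrow> i (\<ominus> a) = inv\<^bsub>T\<^esub> i a"
  using group_hom.hom_inv[of A T i a] i_hom by (simp add: group_hom_def group_hom_axioms_def)

lemma q_i [simp]: "a \<in> carrier A \<Longrightarrow> q (i a) = \<one>"
  using i_kernel by (auto simp: kernel_def)

lemma j_i [simp]: "a \<in> carrier A \<Longrightarrow> j (i a) = a"
  unfolding j_def by (rule inv_into_f_f[OF i_inj])

lemma i_j:
  assumes "x \<in> carrier T" "q x = \<one>"
  shows "j x \<in> carrier A" "i (j x) = x"
proof -
  have "x \<in> i ` carrier A" using assms unfolding i_kernel by (simp add: kernel_def)
  then show "j x \<in> carrier A" "i (j x) = x" by auto
qed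

lemma conj_i:
  assumes "x \<in> carrier T" "a \<in> carrier A"
  shows "x \<cdot> i a \<cdot> inv\<^bsub>T\<^esub> x = i (\<rho> (q x) a)"
  using ext assms unfolding module_extension_def by blast

lemma mult_i:
  assumes "x \<in> carrier T" "a \<in> carrier A"
  shows "x \<cdot> i a = i (\<rho> (q x) a) \<cdot> x"
  using assms by (simp add: T.m_assoc flip: conj_i)

lemmas smooth_T = smooth_at_mult[OF lie_T] smooth_at_inv[OF lie_T] smooth_at_lie_const[OF lie_T]
  smooth_at_lie_id[OF lie_T]

lemma smooth_at_q: "x \<in> carrier T \<Longrightarrow> smooth_at MT MG x q"
  by (rule lie_hom_smooth_at[OF lie_T lie_G q_lie_hom])

text \<open>The definition of an extension makes (n, x) |-> n x smooth; at x = 1 this map is the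
  inclusion.\<close>

lemma smooth_at_i:
  assumes a: "a \<in> carrier A"
  shows "smooth_at MA MT a i"
proof -
  note AT = manifold_prod[OF manifold_A manifold_T]
  have "smooth_at (mfd A \<times>\<^sub>M mfd T) MT (a, \<one>\<^bsub>T\<^esub>) (\<lambda>(n, x). i n \<cdot> x)"
    using lie_extension a smooth_map_iff[OF AT manifold_T] unfolding lie_extension_def by auto
  moreover have "smooth_at MA (mfd A \<times>\<^sub>M mfd T) a (\<lambda>a. (a, \<one>\<^bsub>T\<^esub>))"
    using a by (intro smooth_at_Pair manifold_A manifold_T smooth_A smooth_T) auto
  ultimately have "smooth_at MA MT a (\<lambda>a. (\<lambda>(n, x). i n \<cdot> x) (a, \<one>\<^bsub>T\<^esub>))"
    by (intro smooth_at_compose[OF manifold_A AT manifold_T])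
  then show ?thesis
    by (rule smooth_at_eqI[OF manifold_A]) simp
qed

text \<open>
  The local trivialisation exhibits the \<open>A\<close>-component of \<open>y \<sigma>(1)\<close> as a smooth function of \<open>y\<close>; for
  \<open>y\<close> in the kernel this component is \<open>j y\<close>.
\<close>

lemma smooth_at_j:
  assumes M: "manifold M" and F: "smooth_at M MT x F"
    and S: "\<And>y. y \<in> points M \<Longrightarrow> F y \<in> carrier T \<and> q (F y) = \<one>"
  shows "smooth_at M MA x (\<lambda>y. j (F y))"
proof -
  let ?D = "\<lambda>\<sigma> (n, g). i n \<cdot> \<sigma> g"
  obtain U \<sigma> where U: "mopen MG U" "\<one> \<in> U"
    and \<sigma>: "smooth_map (open_submfd MG U) MT \<sigma>" "\<forall>g\<in>U. q (\<sigma> g) = g"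
    and diffeo: "diffeo (mfd A \<times>\<^sub>M open_submfd MG U)
      (open_submfd MT {x \<in> carrier T. q x \<in> U}) (?D \<sigma>)"
    using lie_extension unfolding lie_extension_def by blast
  have UG: "U \<subseteq> carrier G" using openin_subset[OF U(1)] by simp
  let ?V = "{x \<in> carrier T. q x \<in> U}" and ?X = "mfd A \<times>\<^sub>M open_submfd MG U"
  have V: "mopen MT ?V"
    using q_lie_hom openin_continuous_map_preimage[of "mtop MT" "mtop MG" q U] U(1)
    by (simp add: lie_hom_def smooth_map_def)
  note GU = manifold_open_submfd[OF manifold_G U(1)]
  note MX = manifold_prod[OF manifold_A GU] and MY = manifold_open_submfd[OF manifold_T V]
  have TX: "points ?X = carrier A \<times> U" using UG by auto
  have \<sigma>1: "\<sigma> \<one> \<in> carrier T" "q (\<sigma> \<one>) = \<one>"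
    using \<sigma> U smooth_at_topspace(2)[OF GU manifold_T, of "\<one>" \<sigma>]
    unfolding smooth_map_iff[OF GU manifold_T] by auto
  let ?I = "inv_into (carrier A \<times> U) (?D \<sigma>)"
  have inj: "inj_on (?D \<sigma>) (carrier A \<times> U)"
    using diffeo unfolding diffeo_def TX by (blast dest: bij_betw_imp_inj_on)
  \<comment> \<open>The element \<open>\<sigma> \<one>\<close> lies in the kernel but may differ
    from the identity. The trivialisation sends (j(F y), 1) to the product of F y and
    \<open>\<sigma> \<one>\<close>, hence the shift.\<close>
  have I: "?I (F y \<cdot> \<sigma> \<one>) = (j (F y), \<one>)" if "y \<in> points M" for y
    using i_j S[OF that] U(2) by (intro inv_into_f_eq[OF inj]) auto
  have x: "x \<in> points M" by (rule smooth_at_topspace(1)[OF M manifold_T F])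
  have Fx: "F x \<cdot> \<sigma> \<one> \<in> ?V" using S[OF x] \<sigma>1 U(2) by simp
  have "smooth_at (open_submfd MT ?V) ?X (F x \<cdot> \<sigma> \<one>) ?I"
    using diffeo Fx unfolding diffeo_def TX smooth_map_iff[OF MY MX] by auto
  then have 1: "smooth_at MT ?X (F x \<cdot> \<sigma> \<one>) ?I"
    by (simp only: smooth_at_open_submfd_iff[OF manifold_T MX V Fx])
  have 2: "smooth_at M MT x (\<lambda>y. F y \<cdot> \<sigma> \<one>)"
    by (intro smooth_at_mult[OF lie_T M F] smooth_at_lie_const[OF lie_T M x] \<sigma>1)
  have 3: "smooth_at M ?X x (\<lambda>y. ?I (F y \<cdot> \<sigma> \<one>))"
    by (rule smooth_at_compose[OF M manifold_T MX 2 1])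
  have "smooth_at M MA x (\<lambda>y. fst (?I (F y \<cdot> \<sigma> \<one>)))"
    by (rule smooth_at_compose[OF M MX manifold_A 3 smooth_at_fst_snd(1)[OF manifold_A GU]])
      (use smooth_at_topspace(2)[OF M MX 3] in simp)
  then show ?thesis
    by (rule smooth_at_eqI[OF M]) (simp add: I)
qed

text \<open>The value of the given local section at 1 lies in the kernel, so dividing by it keeps a
  section and normalises it. Off U arbitrary preimages are chosen: a nontrivial principal bundle has
  no global smooth section, and a cocycle only has to be smooth near the identity.\<close>

lemma section_exists:
  obtains s where "\<And>g. g \<in> carrier G \<Longrightarrow> s g \<in> carrier T" "\<And>g. g \<in> carrier G \<Longrightarrow> q (s g) = g"
    "s \<one> = \<one>\<^bsub>T\<^esub>" "smooth_at MG MT \<one> s"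
proof -
  obtain U \<sigma> where U: "mopen MG U" "\<one> \<in> U"
    and \<sigma>: "smooth_map (open_submfd MG U) MT \<sigma>" "\<forall>g\<in>U. q (\<sigma> g) = g"
    using lie_extension unfolding lie_extension_def by blast
  have UG: "U \<subseteq> carrier G" using openin_subset[OF U(1)] by simp
  note GU = manifold_open_submfd[OF manifold_G U(1)]
  have \<sigma>_at: "smooth_at MG MT g \<sigma>" if "g \<in> U" for g
    using \<sigma>(1) that UG smooth_at_open_submfd_iff[OF manifold_G manifold_T U(1) that, of \<sigma>]
    unfolding smooth_map_iff[OF GU manifold_T] by auto
  have \<sigma>_closed: "\<sigma> g \<in> carrier T" if "g \<in> U" for g
    using smooth_at_topspace(2)[OF manifold_G manifold_T \<sigma>_at[OF that]] by simp
  define s where "s g = (if g \<in> U then inv\<^bsub>T\<^esub> \<sigma> \<one> \<cdot> \<sigma> g else inv_into (carrier T) q g)" for g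
  show ?thesis
  proof (rule that[of s])
    show "s \<one> = \<one>\<^bsub>T\<^esub>" using U(2) \<sigma>_closed by (simp add: s_def)
    fix g assume g: "g \<in> carrier G"
    then have "g \<in> q ` carrier T" by (simp add: q_surj)
    then show "s g \<in> carrier T" "q (s g) = g"
      using g U(2) \<sigma>_closed \<sigma>(2) by (auto simp: s_def inv_into_into f_inv_into_f)
  next
    have "smooth_at MG MT \<one> (\<lambda>g. inv\<^bsub>T\<^esub> \<sigma> \<one> \<cdot> \<sigma> g)"
      using \<sigma>_at U(2) \<sigma>_closed
      by (intro smooth_T manifold_G ) auto
    then show "smooth_at MG MT \<one> s"
      by (rule smooth_at_cong[OF manifold_G U, rotated]) (simp add: s_def)
  qed
qed

lemma decompose:
  assumes "x \<in> carrier T" "s (q x) \<in> carrier T" "q (s (q x)) = q x"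
  shows "j (x \<cdot> inv\<^bsub>T\<^esub> s (q x)) \<in> carrier A"
    "x = i (j (x \<cdot> inv\<^bsub>T\<^esub> s (q x))) \<cdot> s (q x)"
  using assms i_j[of "x \<cdot> inv\<^bsub>T\<^esub> s (q x)"] by (simp_all add: T.m_assoc)

end

text \<open>A morphism over \<open>A\<close> is determined near the identity by its values on a smooth local section.\<close>

lemma ext_hom_smooth:
  assumes E: "module_ext G A \<rho> E" and E': "module_ext G A \<rho> E'"
    and \<phi>: "\<phi> \<in> hom (tot E) (tot E')" "\<And>a. a \<in> carrier A \<Longrightarrow> \<phi> (inc E a) = inc E' a"
    and s: "\<And>g. g \<in> carrier G \<Longrightarrow> s g \<in> carrier (tot E)" "\<And>g. g \<in> carrier G \<Longrightarrow> proj E (s g) = g"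
      "smooth_at (mfd G) (mfd (tot E)) \<one>\<^bsub>G\<^esub> s"
    and \<phi>s: "smooth_at (mfd G) (mfd (tot E')) \<one>\<^bsub>G\<^esub> (\<lambda>g. \<phi> (s g))"
  shows "\<phi> \<in> lie_hom (tot E) (tot E')"
proof -
  interpret E: module_ext G A \<rho> E by (rule E)
  interpret E': module_ext G A \<rho> E' by (rule E')
  note MT = E.manifold_T and MT' = E'.manifold_T and one = E.T.one_closed
  have q: "smooth_at E.MT (mfd G) \<one>\<^bsub>E.T\<^esub> (proj E)" by (rule E.smooth_at_q[OF one])
  have sq: "smooth_at E.MT E.MT \<one>\<^bsub>E.T\<^esub> (\<lambda>x. s (proj E x))"
    by (rule smooth_at_compose[OF MT E.manifold_G MT q]) (simp add: s(3))
  \<comment> \<open>\<open>b x\<close> is the A-component in x = i(b x) s(q x). A homomorphism that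
    respects A satisfies phi(x) = i'(b x) phi(s(q x)), with i' the inclusion of E', and both factors
    are smooth at the identity.\<close>
  define b where "b x = E.j (x \<otimes>\<^bsub>E.T\<^esub> inv\<^bsub>E.T\<^esub> s (proj E x))" for x
  have "smooth_at E.MT E.MT \<one>\<^bsub>E.T\<^esub> (\<lambda>x. x \<otimes>\<^bsub>E.T\<^esub> inv\<^bsub>E.T\<^esub> s (proj E x))"
    by (intro smooth_at_mult[OF E.lie_T MT] smooth_at_inv[OF E.lie_T MT] sq smooth_at_lie_id[OF E.lie_T] one)
  then have a: "smooth_at E.MT (mfd A) \<one>\<^bsub>E.T\<^esub> b"
    unfolding b_def by (rule E.smooth_at_j[OF MT]) (simp add: s(1,2))
  have 1: "smooth_at E.MT E'.MT \<one>\<^bsub>E.T\<^esub> (\<lambda>x. inc E' (b x))"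
    by (rule smooth_at_compose[OF MT E.manifold_A MT' a E'.smooth_at_i])
      (use E.decompose(1)[of "\<one>\<^bsub>E.T\<^esub>" s] s in \<open>simp add: b_def\<close>)
  have 2: "smooth_at E.MT E'.MT \<one>\<^bsub>E.T\<^esub> (\<lambda>x. \<phi> (s (proj E x)))"
    by (rule smooth_at_compose[OF MT E.manifold_G MT' q]) (simp add: \<phi>s)
  have "smooth_at E.MT E'.MT \<one>\<^bsub>E.T\<^esub>
      (\<lambda>x. inc E' (b x) \<otimes>\<^bsub>E'.T\<^esub> \<phi> (s (proj E x)))"
    by (rule smooth_at_mult[OF E'.lie_T MT 1 2])
  then have "smooth_at E.MT E'.MT \<one>\<^bsub>E.T\<^esub> \<phi>"
  proof (rule smooth_at_eqI[OF MT])
    fix x assume "x \<in> points E.MT"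
    then have x: "x \<in> carrier E.T" by simp
    have d: "b x \<in> carrier A" "x = inc E (b x) \<otimes>\<^bsub>E.T\<^esub> s (proj E x)"
      using E.decompose[OF x, of s] s x by (auto simp: b_def)
    show "inc E' (b x) \<otimes>\<^bsub>E'.T\<^esub> \<phi> (s (proj E x)) = \<phi> x"
      using arg_cong[OF d(2), of \<phi>] hom_mult[OF \<phi>(1), OF E.i_closed[OF d(1)], of "s (proj E x)"]
        \<phi>(2)[OF d(1)] s(1)[of "proj E x"] x by simp
  qed
  then show ?thesis by (rule lie_homI[OF E.lie_T E'.lie_T \<phi>(1)])
qed

subsection \<open>Equivalence of extensions\<close>

lemma ext_equiv_refl:
  assumes "module_extension G A \<rho> E"
  shows "ext_equiv A E E"
proof -
  have L: "lie_group (tot E)"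
    using assms by (simp add: module_extension_def lie_extension_def)
  have "(\<lambda>x. x) \<in> lie_hom (tot E) (tot E)"
  proof (rule lie_homI[OF L L _ smooth_at_lie_id[OF L]])
    show "\<one>\<^bsub>tot E\<^esub> \<in> carrier (tot E)"
      by (rule monoid.one_closed[OF group.is_monoid[OF lie_groupD(1)[OF L]]])
  qed (simp add: hom_def)
  then show ?thesis unfolding ext_equiv_def by (intro bexI[of _ "\<lambda>x. x"]) simp_all
qed

lemma ext_equiv_trans:
  assumes E: "lie_group (tot E)" and E': "lie_group (tot E')" and E'': "lie_group (tot E'')"
    and "ext_equiv A E E'" "ext_equiv A E' E''"
  shows "ext_equiv A E E''"
proof -
  obtain \<phi> where \<phi>: "\<phi> \<in> lie_hom (tot E) (tot E')" "\<forall>n\<in>carrier A. \<phi> (inc E n) = inc E' n"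
    "\<forall>x\<in>carrier (tot E). proj E' (\<phi> x) = proj E x"
    using assms(4) unfolding ext_equiv_def by blast
  obtain \<psi> where \<psi>: "\<psi> \<in> lie_hom (tot E') (tot E'')" "\<forall>n\<in>carrier A. \<psi> (inc E' n) = inc E'' n"
    "\<forall>x\<in>carrier (tot E'). proj E'' (\<psi> x) = proj E' x"
    using assms(5) unfolding ext_equiv_def by blast
  have h: "\<phi> \<in> hom (tot E) (tot E')" "\<psi> \<in> hom (tot E') (tot E'')"
    using \<phi>(1) \<psi>(1) by (auto simp: lie_hom_def)
  have c: "\<phi> x \<in> carrier (tot E')" if "x \<in> carrier (tot E)" for x
    using h(1) that by (auto simp: hom_def)
  have one: "\<one>\<^bsub>tot E\<^esub> \<in> carrier (tot E)"
    by (rule monoid.one_closed[OF group.is_monoid[OF lie_groupD(1)[OF E]]])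
  have "smooth_at (mfd (tot E)) (mfd (tot E'')) \<one>\<^bsub>tot E\<^esub> (\<lambda>x. \<psi> (\<phi> x))"
    by (rule smooth_at_compose[OF lie_groupD(2)[OF E] lie_groupD(2)[OF E'] lie_groupD(2)[OF E'']
          lie_hom_smooth_at[OF E E' \<phi>(1) one] lie_hom_smooth_at[OF E' E'' \<psi>(1) c[OF one]]])
  moreover have "(\<lambda>x. \<psi> (\<phi> x)) \<in> hom (tot E) (tot E'')"
    using h by (auto simp: hom_def Pi_iff)
  ultimately have "(\<lambda>x. \<psi> (\<phi> x)) \<in> lie_hom (tot E) (tot E'')"
    by (intro lie_homI[OF E E''])
  then show ?thesis unfolding ext_equiv_def using \<phi> \<psi> c by (intro bexI[of _ "\<lambda>x. \<psi> (\<phi> x)"]) auto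
qed

text \<open>The morphism is bijective by the short five lemma, carried out on elements. Smoothness
  of its inverse is tested on the section phi o s of E', along which the inverse is the smooth germ
  s.\<close>

lemma ext_equiv_sym:
  assumes E: "module_ext G A \<rho> E" and E': "module_ext G A \<rho> E'" and eq: "ext_equiv A E E'"
  shows "ext_equiv A E' E"
proof -
  interpret E: module_ext G A \<rho> E by (rule E)
  interpret E': module_ext G A \<rho> E' by (rule E')
  obtain \<phi> where \<phi>: "\<phi> \<in> lie_hom E.T E'.T" "\<And>n. n \<in> carrier A \<Longrightarrow> \<phi> (inc E n) = inc E' n"
    "\<And>x. x \<in> carrier E.T \<Longrightarrow> proj E' (\<phi> x) = proj E x"
    using eq unfolding ext_equiv_def by blast
  have h: "\<phi> \<in> hom E.T E'.T" using \<phi>(1) by (simp add: lie_hom_def)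
  interpret \<phi>: group_hom "tot E" "tot E'" \<phi>
    by unfold_locales (rule h)
  obtain s where s: "\<And>g. g \<in> carrier G \<Longrightarrow> s g \<in> carrier E.T"
    "\<And>g. g \<in> carrier G \<Longrightarrow> proj E (s g) = g" "smooth_at (mfd G) E.MT \<one>\<^bsub>G\<^esub> s"
    by (rule E.section_exists) blast
  have inj: "inj_on \<phi> (carrier E.T)"
  proof (rule \<phi>.inj_on_one_iff[THEN iffD2], intro allI impI)
    fix x assume x: "x \<in> carrier E.T" "\<phi> x = \<one>\<^bsub>E'.T\<^esub>"
    then have "proj E x = \<one>\<^bsub>G\<^esub>" using \<phi>(3)[of x] by simp
    then have "E.j x \<in> carrier A" "inc E (E.j x) = x" using x E.i_j by auto
    moreover from this have "inc E' (E.j x) = \<one>\<^bsub>E'.T\<^esub>" using \<phi>(2) x(2) by metis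
    ultimately show "x = \<one>\<^bsub>E.T\<^esub>"
      using E'.j_i[of "E.j x"] E'.j_i[of "\<one>\<^bsub>A\<^esub>"] by (metis E.i_one E'.i_one E.A.one_closed)
  qed
  have surj: "y \<in> \<phi> ` carrier E.T" if y: "y \<in> carrier E'.T" for y
  proof -
    let ?g = "proj E' y"
    have g: "?g \<in> carrier G" using y by simp
    have sg: "\<phi> (s ?g) \<in> carrier E'.T" "proj E' (\<phi> (s ?g)) = ?g"
      using s(1,2)[OF g] \<phi>(3)[of "s ?g"] by auto
    let ?a = "E'.j (y \<otimes>\<^bsub>E'.T\<^esub> inv\<^bsub>E'.T\<^esub> \<phi> (s ?g))"
    have a: "?a \<in> carrier A" "y = inc E' ?a \<otimes>\<^bsub>E'.T\<^esub> \<phi> (s ?g)"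
      using E'.decompose[OF y, of "\<lambda>g. \<phi> (s g)"] sg by auto
    have "\<phi> (inc E ?a \<otimes>\<^bsub>E.T\<^esub> s ?g) = y"
      using \<phi>(2)[OF a(1)] a s(1)[OF g] by simp
    then show ?thesis using a(1) s(1)[OF g] by (metis E.T.m_closed E.i_closed image_eqI)
  qed
  have bij: "bij_betw \<phi> (carrier E.T) (carrier E'.T)"
    unfolding bij_betw_def using inj surj by auto
  define \<psi> where "\<psi> = inv_into (carrier E.T) \<phi>"
  have iso: "\<phi> \<in> iso E.T E'.T" using h bij by (simp add: iso_def)
  then have "\<psi> \<in> iso E'.T E.T"
    unfolding \<psi>_def by (rule E.T.iso_set_sym)
  then have \<psi>_hom: "\<psi> \<in> hom E'.T E.T" by (simp add: iso_def)
  have \<psi>\<phi>: "\<psi> (\<phi> x) = x" if "x \<in> carrier E.T" for x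
    unfolding \<psi>_def by (rule inv_into_f_f[OF inj that])
  have \<phi>\<psi>: "\<phi> (\<psi> y) = y" "\<psi> y \<in> carrier E.T" if "y \<in> carrier E'.T" for y
    unfolding \<psi>_def using surj[OF that] by (auto intro: f_inv_into_f inv_into_into)
  have \<psi>_inc: "\<psi> (inc E' a) = inc E a" if "a \<in> carrier A" for a
    using \<psi>\<phi>[of "inc E a"] \<phi>(2)[OF that] that by simp
  have "\<psi> \<in> lie_hom E'.T E.T"
  proof (rule ext_hom_smooth[OF E' E \<psi>_hom \<psi>_inc, where s = "\<lambda>g. \<phi> (s g)"])
    show "smooth_at (mfd G) E'.MT \<one>\<^bsub>G\<^esub> (\<lambda>g. \<phi> (s g))"
      using s(1) by (intro smooth_at_compose[OF E.manifold_G E.manifold_T E'.manifold_T s(3)]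
          lie_hom_smooth_at[OF E.lie_T E'.lie_T \<phi>(1)]) simp
    show "smooth_at (mfd G) E.MT \<one>\<^bsub>G\<^esub> (\<lambda>g. \<psi> (\<phi> (s g)))"
      by (rule smooth_at_eqI[OF E.manifold_G s(3)]) (simp add: \<psi>\<phi> s(1))
  qed (use s \<phi>(3) in auto)
  moreover have "proj E (\<psi> y) = proj E' y" if "y \<in> carrier E'.T" for y
    using \<phi>(3)[OF \<phi>\<psi>(2)[OF that]] \<phi>\<psi>(1)[OF that] by simp
  ultimately show ?thesis
    unfolding ext_equiv_def using \<psi>_inc by blast
qed

subsection \<open>The cocycle of an extension\<close>

context module_ext
begin

text \<open>The cocycle is the factor system f(g, h) = s(g) s(h) s(g h)^-1 of a section normalised
  at 1. The inclusion takes f_g(g') to s(g) s(g') s(g)^-1 s(g g' g^-1)^-1. For g' near 1 the section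
  is evaluated near 1 except in the constant s(g), so f_g is smooth there even for distant g, and f
  lies in Z2ss. The equivalence reads off the coordinates (a, g) of i(a) s(g).\<close>

theorem equivalent_crossed:
  obtains f M where "f \<in> Z2ss G A \<rho>" "crossed_structure G A \<rho> f M" "ext_equiv A E (crossed f M)"
proof -
  obtain s where s [simp]: "\<And>g. g \<in> carrier G \<Longrightarrow> s g \<in> carrier T"
    "\<And>g. g \<in> carrier G \<Longrightarrow> q (s g) = g" "s \<one> = \<one>\<^bsub>T\<^esub>" and s_smooth: "smooth_at MG MT \<one> s"
    by (rule section_exists) blast
  define F where "F p = s (fst p) \<cdot> s (snd p) \<cdot> inv\<^bsub>T\<^esub> s (fst p \<otimes> snd p)" for p
  define f where "f = (\<lambda>p\<in>carrier G \<times> carrier G. j (F p))"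
  have F: "F p \<in> carrier T" "q (F p) = \<one>" if "p \<in> carrier G \<times> carrier G" for p
    using that by (auto simp: F_def)
  have f_closed [simp]: "f (g, h) \<in> carrier A"
    and i_f: "i (f (g, h)) \<cdot> s (g \<otimes> h) = s g \<cdot> s h"
    if "g \<in> carrier G" "h \<in> carrier G" for g h
    using that i_j[OF F, of "(g, h)"] by (simp_all add: f_def F_def T.m_assoc)
  have f_one: "f (g, \<one>) = \<zero>" "f (\<one>, g) = \<zero>" if "g \<in> carrier G" for g
    using that j_i[of "\<zero>"] by (simp_all add: f_def F_def)
  have i_cancel: "a = b" if "a \<in> carrier A" "b \<in> carrier A" "x \<in> carrier T"
    "i a \<cdot> x = i b \<cdot> x" for a b x
    using that T.right_cancel[of x "i a" "i b"] inj_onD[OF i_inj] by simp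
  have "smooth_at GG MA (\<one>, \<one>) f"
  proof -
    note fs = smooth_at_fst_snd[OF manifold_G manifold_G, of "(\<one>, \<one>)"]
    have s': "smooth_at GG MT (\<one>, \<one>) (\<lambda>p. s (r p))"
      if "smooth_at GG MG (\<one>, \<one>) r" "r (\<one>, \<one>) = \<one>" for r
      by (rule smooth_at_compose[OF manifold_GG manifold_G manifold_T that(1)]) (simp add: that(2) s_smooth)
    have "smooth_at GG MT (\<one>, \<one>) F"
      unfolding F_def[abs_def]
      by (intro smooth_T manifold_GG s' smooth_G fs)
        auto
    then have "smooth_at GG MA (\<one>, \<one>) (\<lambda>p. j (F p))"
      by (rule smooth_at_j[OF manifold_GG]) (use F in simp)
    then show ?thesis
      by (rule smooth_at_eqI[OF manifold_GG]) (simp add: f_def)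
  qed
  then have f_C2s: "f \<in> C2s G A"
    using f_one smooth_near_iff[OF manifold_GG manifold_A] i_j(1)[OF F] by (auto simp: C2s_def f_def)
  have "\<rho> g (f (h, k)) \<oplus> f (g, h \<otimes> k) = f (g \<otimes> h, k) \<oplus> f (g, h)"
    if [simp]: "g \<in> carrier G" "h \<in> carrier G" "k \<in> carrier G" for g h k
  proof (rule i_cancel[where x = "s (g \<otimes> (h \<otimes> k))"])
    \<comment> \<open>After multiplication by s(g h k), both sides become s(g) s(h) s(k): the
      cocycle identity is associativity in the total group.\<close>
    have "i (\<rho> g (f (h, k)) \<oplus> f (g, h \<otimes> k)) \<cdot> s (g \<otimes> (h \<otimes> k)) =
        i (\<rho> g (f (h, k))) \<cdot> s g \<cdot> s (h \<otimes> k)"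
      by (simp add: i_mult T.m_assoc i_f)
    also have "\<dots> = s g \<cdot> i (f (h, k)) \<cdot> s (h \<otimes> k)"
      by (simp add: mult_i)
    also have "\<dots> = s g \<cdot> s h \<cdot> s k"
      by (simp add: T.m_assoc i_f)
    finally have 1: "i (\<rho> g (f (h, k)) \<oplus> f (g, h \<otimes> k)) \<cdot> s (g \<otimes> (h \<otimes> k)) =
        s g \<cdot> s h \<cdot> s k" .
    have "i (f (g \<otimes> h, k) \<oplus> f (g, h)) \<cdot> s (g \<otimes> (h \<otimes> k)) =
        i (f (g, h)) \<cdot> (i (f (g \<otimes> h, k)) \<cdot> s (g \<otimes> h \<otimes> k))"
      by (simp add: i_mult T.m_assoc G.m_assoc A.m_comm[of "f (g \<otimes> h, k)"])
    also have "\<dots> = i (f (g, h)) \<cdot> s (g \<otimes> h) \<cdot> s k"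
      by (subst i_f) (simp_all add: T.m_assoc)
    also have "\<dots> = s g \<cdot> s h \<cdot> s k" by (simp add: i_f)
    finally show "i (\<rho> g (f (h, k)) \<oplus> f (g, h \<otimes> k)) \<cdot> s (g \<otimes> (h \<otimes> k)) =
        i (f (g \<otimes> h, k) \<oplus> f (g, h)) \<cdot> s (g \<otimes> (h \<otimes> k))"
      using 1 by simp
  qed simp_all
  then have f_Z2s: "f \<in> Z2s G A \<rho>" unfolding Z2s_iff using f_C2s by blast
  have "conj_defect G A f g \<in> C1s G A" if g [simp]: "g \<in> carrier G" for g
  proof -
    define c where "c g' = g \<otimes> g' \<otimes> inv g" for g'
    define H where "H g' = s g \<cdot> s g' \<cdot> inv\<^bsub>T\<^esub> s g \<cdot> inv\<^bsub>T\<^esub> s (c g')" for g'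
    have c [simp]: "c g' \<in> carrier G" "c g' \<otimes> g = g \<otimes> g'" if "g' \<in> carrier G" for g'
      using that by (simp_all add: c_def G.m_assoc)
    have H: "H g' \<in> carrier T \<and> q (H g') = \<one>" if "g' \<in> carrier G" for g'
      using that by (auto simp: H_def c_def)
    have jH: "conj_defect G A f g g' = j (H g')" if [simp]: "g' \<in> carrier G" for g'
    proof -
      have cd: "conj_defect G A f g g' = f (g, g') \<oplus> \<ominus> f (c g', g)"
        by (simp add: conj_defect_def c_def)
      have "i (f (g, g')) = s g \<cdot> s g' \<cdot> inv\<^bsub>T\<^esub> s (g \<otimes> g')"
        using i_f[of g g'] by (simp add: T.inv_solve_right)
      moreover have "i (f (c g', g)) = s (c g') \<cdot> s g \<cdot> inv\<^bsub>T\<^esub> s (g \<otimes> g')"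
        using i_f[of "c g'" g] by (simp add: T.inv_solve_right)
      \<comment> \<open>Both values of f carry the factor s(g g')^-1, because c(g') g = g g'; it
        cancels in their difference.\<close>
      ultimately have "i (conj_defect G A f g g') = H g'"
        by (simp add: cd i_mult i_inv T.inv_mult_group T.m_assoc H_def)
          (simp flip: T.m_assoc)
      moreover have "conj_defect G A f g g' \<in> carrier A" by (simp add: cd)
      ultimately show ?thesis using j_i by metis
    qed
    have "smooth_at MG MG \<one> c"
      unfolding c_def[abs_def]
      by (intro smooth_G manifold_G ) auto
    then have "smooth_at MG MT \<one> (\<lambda>g'. s (c g'))"
      by (rule smooth_at_compose[OF manifold_G manifold_G manifold_T]) (simp add: c_def s_smooth)
    then have "smooth_at MG MT \<one> H"
      unfolding H_def[abs_def]
      by (intro smooth_T manifold_G s_smooth) auto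
    then have "smooth_at MG MA \<one> (\<lambda>g'. j (H g'))"
      by (rule smooth_at_j[OF manifold_G]) (simp add: H)
    then have "smooth_at MG MA \<one> (conj_defect G A f g)"
      by (rule smooth_at_eqI[OF manifold_G]) (simp add: jH)
    moreover have "conj_defect G A f g \<in> carrier G \<rightarrow>\<^sub>E carrier A"
      by (auto simp: conj_defect_def)
    moreover have "conj_defect G A f g \<one> = \<zero>"
      by (simp add: conj_defect_def f_one)
    ultimately show ?thesis
      using smooth_near_iff[OF manifold_G manifold_A] by (simp add: C1s_def)
  qed
  then have f: "f \<in> Z2ss G A \<rho>" using f_Z2s by (simp add: Z2ss_def)
  obtain M where M: "crossed_structure G A \<rho> f M"
    using crossed_structure_exists[OF f] by blast
  let ?C = "crossed f M"
  have C: "module_ext G A \<rho> ?C"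
    by unfold_locales (use M in \<open>simp add: crossed_structure_def\<close>)
  interpret C: module_ext G A \<rho> ?C by (rule C)
  define \<phi> where "\<phi> x = (j (x \<cdot> inv\<^bsub>T\<^esub> s (q x)), q x)" for x
  have \<phi>: "\<phi> (i a \<cdot> s g) = (a, g)" if "a \<in> carrier A" "g \<in> carrier G" for a g
    using that by (simp add: \<phi>_def T.m_assoc)
  have dec: "\<exists>a\<in>carrier A. \<exists>g\<in>carrier G. x = i a \<cdot> s g" if "x \<in> carrier T" for x
    using decompose[OF that, of s] that by (metis q_closed s(1,2))
  have \<phi>_hom: "\<phi> \<in> hom T (tot ?C)"
  proof (rule homI)
    fix x assume "x \<in> carrier T"
    then obtain a g where x: "a \<in> carrier A" "g \<in> carrier G" "x = i a \<cdot> s g"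
      using dec by blast
    then show "\<phi> x \<in> carrier (tot ?C)" by (simp add: \<phi>)
    fix y assume "y \<in> carrier T"
    then obtain b h where y: "b \<in> carrier A" "h \<in> carrier G" "y = i b \<cdot> s h"
      using dec by blast
    have "x \<cdot> y = i a \<cdot> (s g \<cdot> i b) \<cdot> s h"
      using x y by (simp add: T.m_assoc)
    also have "\<dots> = i a \<cdot> i (\<rho> g b) \<cdot> (s g \<cdot> s h)"
      using x y mult_i[of "s g" b] by (simp add: T.m_assoc)
    also have "\<dots> = i (a \<oplus> \<rho> g b \<oplus> f (g, h)) \<cdot> s (g \<otimes> h)"
      using x y by (simp add: i_mult T.m_assoc flip: i_f)
    finally show "\<phi> (x \<cdot> y) = \<phi> x \<otimes>\<^bsub>tot ?C\<^esub> \<phi> y"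
      using x y by (simp add: \<phi> mult_crossed)
  qed
  have \<phi>_i: "\<phi> (i a) = inc ?C a" if "a \<in> carrier A" for a
    using \<phi>[of a "\<one>"] that by simp
  have \<phi>_s: "\<phi> (s g) = (\<zero>, g)" if "g \<in> carrier G" for g
    using \<phi>[of "\<zero>" g] that by simp
  have "\<phi> \<in> lie_hom T (tot ?C)"
  proof (rule ext_hom_smooth[OF module_ext_axioms C \<phi>_hom \<phi>_i _ _ s_smooth])
    have "smooth_at MG (mfd (tot ?C)) \<one> (\<lambda>g. (\<zero>, g))"
      using M smooth_near_iff[OF manifold_G C.manifold_T] by (simp add: crossed_structure_def)
    then show "smooth_at MG (mfd (tot ?C)) \<one> (\<lambda>g. \<phi> (s g))"
      by (rule smooth_at_eqI[OF manifold_G]) (simp add: \<phi>_s)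
  qed auto
  then have "ext_equiv A E ?C"
    unfolding ext_equiv_def using \<phi>_i by (intro bexI[of _ \<phi>]) (simp_all add: \<phi>_def)
  then show ?thesis using that f M by blast
qed

end

section \<open>The classification\<close>

context lie_module
begin

subsection \<open>Coboundaries\<close>

lemma C1s_iff:
  "h \<in> C1s G A \<longleftrightarrow> h \<in> carrier G \<rightarrow>\<^sub>E carrier A \<and> smooth_at MG MA \<one> h \<and> h \<one> = \<zero>"
  by (simp add: C1s_def smooth_near_iff[OF manifold_G manifold_A])

lemma C1s_closed: "h \<in> C1s G A \<Longrightarrow> g \<in> carrier G \<Longrightarrow> h g \<in> carrier A"
  by (auto simp: C1s_def)

lemma C1s_restrict:
  assumes "\<And>g. g \<in> carrier G \<Longrightarrow> h g \<in> carrier A" "smooth_at MG MA \<one> h" "h \<one> = \<zero>"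
  shows "restrict h (carrier G) \<in> C1s G A"
proof -
  have "smooth_at MG MA \<one> (restrict h (carrier G))"
    by (rule smooth_at_eqI[OF manifold_G assms(2)]) simp
  then show ?thesis using assms(1,3) by (auto simp: C1s_iff)
qed

lemma C1s_one: "(\<lambda>g\<in>carrier G. \<zero>) \<in> C1s G A"
  by (intro C1s_restrict smooth_A manifold_G) auto

lemma C1s_mult:
  assumes "h \<in> C1s G A" "h' \<in> C1s G A"
  shows "(\<lambda>g\<in>carrier G. h g \<oplus> h' g) \<in> C1s G A"
  using assms by (intro C1s_restrict smooth_A manifold_G) (auto simp: C1s_iff PiE_iff)

lemma C1s_inv:
  assumes "h \<in> C1s G A"
  shows "(\<lambda>g\<in>carrier G. \<ominus> h g) \<in> C1s G A"
  using assms by (intro C1s_restrict smooth_A manifold_G) (auto simp: C1s_iff PiE_iff)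

lemma d1_closed:
  "h \<in> C1s G A \<Longrightarrow> g \<in> carrier G \<Longrightarrow> k \<in> carrier G \<Longrightarrow> d1 G A \<rho> h (g, k) \<in> carrier A"
  by (simp add: d1_def C1s_closed)

lemma d1_one: "g \<in> carrier G \<Longrightarrow> k \<in> carrier G \<Longrightarrow> d1 G A \<rho> (\<lambda>g\<in>carrier G. \<zero>) (g, k) = \<zero>"
  by (simp add: d1_def)

lemma d1_mult:
  assumes "h \<in> C1s G A" "h' \<in> C1s G A" "g \<in> carrier G" "k \<in> carrier G"
  shows "d1 G A \<rho> (\<lambda>g\<in>carrier G. h g \<oplus> h' g) (g, k) = d1 G A \<rho> h (g, k) \<oplus> d1 G A \<rho> h' (g, k)"
  using assms by (simp add: d1_def C1s_closed \<rho>_mult A.inv_mult A.m_ac)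

lemma d1_inv:
  assumes "h \<in> C1s G A" "g \<in> carrier G" "k \<in> carrier G"
  shows "d1 G A \<rho> (\<lambda>g\<in>carrier G. \<ominus> h g) (g, k) = \<ominus> d1 G A \<rho> h (g, k)"
  using assms by (simp add: d1_def C1s_closed \<rho>_hom_inv A.inv_mult A.m_ac)

text \<open>Clears the inverse: with a = f(g, k) and b = f'(g, k), the right-hand side is the
  condition on A-components for (a, g) |-> (a + h(g), g) to be multiplicative, which is how both
  directions of the comparison of crossed products use it.\<close>

lemma eq_d1_mult_iff:
  assumes "h \<in> C1s G A" "a \<in> carrier A" "b \<in> carrier A" "g \<in> carrier G" "k \<in> carrier G"
  shows "a = d1 G A \<rho> h (g, k) \<oplus> b \<longleftrightarrow> a \<oplus> h (g \<otimes> k) = h g \<oplus> \<rho> g (h k) \<oplus> b"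
proof -
  have "d1 G A \<rho> h (g, k) \<oplus> b = h g \<oplus> \<rho> g (h k) \<oplus> b \<oplus> \<ominus> h (g \<otimes> k)"
    using assms by (simp add: d1_def C1s_closed A.m_ac)
  moreover have "a = h g \<oplus> \<rho> g (h k) \<oplus> b \<oplus> \<ominus> h (g \<otimes> k) \<longleftrightarrow>
      h g \<oplus> \<rho> g (h k) \<oplus> b = a \<oplus> h (g \<otimes> k)"
    using diff_eq_iff[of "h g \<oplus> \<rho> g (h k) \<oplus> b" "h (g \<otimes> k)" a] assms
    by (auto simp: C1s_closed)
  ultimately show ?thesis by auto
qed

definition cohomologous :: "('g \<times> 'g \<Rightarrow> 'a) \<Rightarrow> ('g \<times> 'g \<Rightarrow> 'a) \<Rightarrow> bool" where
  "cohomologous f f' \<longleftrightarrow> (\<exists>h\<in>C1s G A. \<forall>g\<in>carrier G. \<forall>k\<in>carrier G.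
    f (g, k) = d1 G A \<rho> h (g, k) \<oplus> f' (g, k))"

lemma cohomologous_sym:
  assumes f': "f' \<in> C2s G A" and "cohomologous f f'"
  shows "cohomologous f' f"
proof -
  obtain h where h: "h \<in> C1s G A" "\<And>g k. g \<in> carrier G \<Longrightarrow> k \<in> carrier G \<Longrightarrow>
      f (g, k) = d1 G A \<rho> h (g, k) \<oplus> f' (g, k)"
    using assms(2) unfolding cohomologous_def by blast
  show ?thesis
    unfolding cohomologous_def
    by (rule bexI[OF _ C1s_inv[OF h(1)]])
      (simp add: d1_inv[OF h(1)] h d1_closed[OF h(1)] cochain2D(1)[OF f'] flip: A.m_assoc)
qed

abbreviation coset :: "('g \<times> 'g \<Rightarrow> 'a) \<Rightarrow> ('g \<times> 'g \<Rightarrow> 'a) set" where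
  "coset f \<equiv> (\<lambda>b. \<lambda>x\<in>carrier G \<times> carrier G. b x \<oplus> f x) ` B2s G A \<rho>"

text \<open>A coset involves the product of cochains but not the carrier \<open>F\<close>, so f has
  the same class as a set whether it is regarded in Z2s or in Z2ss.\<close>

lemma r_coset_cochain_group:
  "B2s G A \<rho> #>\<^bsub>cochain_group (carrier G \<times> carrier G) A F\<^esub> f = coset f"
  by (auto simp: r_coset_def cochain_group_def)

lemma coset_subset:
  assumes f': "f' \<in> C2s G A" and "cohomologous f f'"
  shows "coset f \<subseteq> coset f'"
proof -
  obtain h where h: "h \<in> C1s G A" "\<And>g k. g \<in> carrier G \<Longrightarrow> k \<in> carrier G \<Longrightarrow>
      f (g, k) = d1 G A \<rho> h (g, k) \<oplus> f' (g, k)"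
    using assms(2) unfolding cohomologous_def by blast
  show ?thesis
  proof
    fix c assume "c \<in> coset f"
    then obtain h' where h': "h' \<in> C1s G A"
      and c: "c = (\<lambda>x\<in>carrier G \<times> carrier G. d1 G A \<rho> h' x \<oplus> f x)"
      by (auto simp: B2s_def)
    let ?h = "\<lambda>g\<in>carrier G. h' g \<oplus> h g"
    have "c = (\<lambda>x\<in>carrier G \<times> carrier G. d1 G A \<rho> ?h x \<oplus> f' x)"
      unfolding c
    proof (rule restrict_ext)
      fix x assume "x \<in> carrier G \<times> carrier G"
      then obtain g k where x: "x = (g, k)" "g \<in> carrier G" "k \<in> carrier G" by auto
      show "d1 G A \<rho> h' x \<oplus> f x = d1 G A \<rho> ?h x \<oplus> f' x"
        using x by (simp add: d1_mult[OF h' h(1)] h(2) A.m_assoc d1_closed h' h(1) cochain2D(1)[OF f'])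
    qed
    moreover have "d1 G A \<rho> ?h \<in> B2s G A \<rho>"
      unfolding B2s_def by (intro imageI C1s_mult h' h(1))
    ultimately show "c \<in> coset f'" by blast
  qed
qed

lemma coset_eq_iff:
  assumes f: "f \<in> C2s G A" and f': "f' \<in> C2s G A"
  shows "coset f = coset f' \<longleftrightarrow> cohomologous f f'"
proof
  assume eq: "coset f = coset f'"
  \<comment> \<open>Cochains are extensional, so restricting the sum of f and the zero coboundary
    returns f itself, and f lies in its own coset.\<close>
  have "f = (\<lambda>x\<in>carrier G \<times> carrier G. d1 G A \<rho> (\<lambda>g\<in>carrier G. \<zero>) x \<oplus> f x)"
  proof (rule extensionalityI[of _ "carrier G \<times> carrier G"])
    show "f \<in> extensional (carrier G \<times> carrier G)" using f by (auto simp: C2s_def PiE_iff)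
    fix x assume "x \<in> carrier G \<times> carrier G"
    then show "f x = (\<lambda>x\<in>carrier G \<times> carrier G. d1 G A \<rho> (\<lambda>g\<in>carrier G. \<zero>) x \<oplus> f x) x"
      using cochain2D(1)[OF f] by (auto simp: d1_one)
  qed auto
  then have "f \<in> coset f" unfolding B2s_def using C1s_one by blast
  then obtain h where "h \<in> C1s G A" "f = (\<lambda>x\<in>carrier G \<times> carrier G. d1 G A \<rho> h x \<oplus> f' x)"
    unfolding eq by (auto simp: B2s_def)
  then show "cohomologous f f'"
    unfolding cohomologous_def by (intro bexI[of _ h]) simp_all
next
  assume "cohomologous f f'"
  then show "coset f = coset f'"
    using coset_subset[OF f'] coset_subset[OF f] cohomologous_sym[OF f'] by blast
qed

subsection \<open>Equivalence of crossed products\<close>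

lemma module_ext_crossed:
  "crossed_structure G A \<rho> f M \<Longrightarrow> module_ext G A \<rho> (crossed f M)"
  by (simp add: crossed_structure_def module_ext_def module_ext_axioms_def lie_module_axioms)

lemma crossed_section_smooth:
  assumes "crossed_structure G A \<rho> f M"
  shows "smooth_at MG M \<one> (\<lambda>g. (\<zero>, g))"
proof -
  interpret C: module_ext G A \<rho> "crossed f M" by (rule module_ext_crossed[OF assms])
  show ?thesis
    using assms smooth_near_iff[OF manifold_G C.manifold_T] by (simp add: crossed_structure_def)
qed

lemma crossed_mult_section:
  assumes "f \<in> C2s G A" "a \<in> carrier A" "g \<in> carrier G"
  shows "(a, \<one>) \<otimes>\<^bsub>tot (crossed f M)\<^esub> (\<zero>, g) = (a, g)"
  using assms by (simp add: mult_crossed cochain2D)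

text \<open>The morphism is the identity on A and covers the identity of G, so it sends (0, g) to
  (h(g), g). Applied to (0, g)(0, k) = (f(g, k), 1)(0, g k), it yields the coboundary equation for
  h.\<close>

lemma ext_equiv_crossed_imp_cohomologous:
  assumes f: "f \<in> C2s G A" and f': "f' \<in> C2s G A"
    and M: "crossed_structure G A \<rho> f M" and M': "crossed_structure G A \<rho> f' M'"
    and eq: "ext_equiv A (crossed f M) (crossed f' M')"
  shows "cohomologous f f'"
proof -
  let ?E = "crossed f M" and ?E' = "crossed f' M'"
  interpret C: module_ext G A \<rho> ?E by (rule module_ext_crossed[OF M])
  interpret C': module_ext G A \<rho> ?E' by (rule module_ext_crossed[OF M'])
  obtain \<phi> where \<phi>: "\<phi> \<in> lie_hom (tot ?E) (tot ?E')" "\<And>n. n \<in> carrier A \<Longrightarrow> \<phi> (n, \<one>) = (n, \<one>)"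
    "\<And>x. x \<in> carrier A \<times> carrier G \<Longrightarrow> snd (\<phi> x) = snd x"
    using eq unfolding ext_equiv_def by auto
  have \<phi>_hom: "\<phi> \<in> hom (tot ?E) (tot ?E')" using \<phi>(1) by (simp add: lie_hom_def)
  define h where "h g = fst (\<phi> (\<zero>, g))" for g
  have \<phi>_closed: "\<phi> x \<in> carrier A \<times> carrier G" if "x \<in> carrier A \<times> carrier G" for x
    using \<phi>_hom that by (auto simp: hom_def)
  have h_closed [simp]: "h g \<in> carrier A" and \<phi>_s: "\<phi> (\<zero>, g) = (h g, g)" if "g \<in> carrier G" for g
    using \<phi>_closed[of "(\<zero>, g)"] \<phi>(3)[of "(\<zero>, g)"] that unfolding h_def
    by (auto simp: prod_eq_iff mem_Times_iff)
  note MC = C.manifold_T[unfolded mfd_crossed] and MC' = C'.manifold_T[unfolded mfd_crossed]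
  have s: "smooth_at MG M \<one> (\<lambda>g. (\<zero>, g))" "smooth_at MG M' \<one> (\<lambda>g. (\<zero>, g))"
    by (rule crossed_section_smooth[OF M], rule crossed_section_smooth[OF M'])
  have "smooth_at M M' (\<zero>, \<one>) \<phi>"
    using lie_hom_smooth_at[OF C.lie_T C'.lie_T \<phi>(1), of "(\<zero>, \<one>)"] by simp
  then have \<phi>s: "smooth_at MG M' \<one> (\<lambda>g. \<phi> (\<zero>, g))"
    by (rule smooth_at_compose[OF manifold_G MC MC' s(1)])
  \<comment> \<open>M' is an arbitrary admissible structure, so smoothness of h is not read off from
    a product chart. Dividing by the section (0, g), which is smooth near 1 by the normalisation of
    M', moves the value into the kernel, where \<open>smooth_at_j\<close> applies.\<close>
  let ?F = "\<lambda>g. \<phi> (\<zero>, g) \<otimes>\<^bsub>tot ?E'\<^esub> inv\<^bsub>tot ?E'\<^esub> (\<zero>, g)"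
  have F: "?F g = (h g, \<one>)" if g: "g \<in> carrier G" for g
  proof -
    have c: "(h g, \<one>) \<in> carrier (tot ?E')" "(\<zero>, g) \<in> carrier (tot ?E')"
      using g by simp_all
    have "?F g = (h g, \<one>) \<otimes>\<^bsub>tot ?E'\<^esub> (\<zero>, g) \<otimes>\<^bsub>tot ?E'\<^esub> inv\<^bsub>tot ?E'\<^esub> (\<zero>, g)"
      using g by (simp only: \<phi>_s crossed_mult_section[OF f'] h_closed)
    then show ?thesis
      by (simp only: C'.T.m_assoc C'.T.r_inv C'.T.r_one C'.T.inv_closed c)
  qed
  have "smooth_at MG M' \<one> ?F"
    using smooth_at_mult[OF C'.lie_T manifold_G _ smooth_at_inv[OF C'.lie_T manifold_G]] \<phi>s s(2) by simp
  then have "smooth_at MG MA \<one> (\<lambda>g. C'.j (?F g))"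
    by (intro C'.smooth_at_j[OF manifold_G]) (simp_all add: F)
  then have "smooth_at MG MA \<one> h"
    by (rule smooth_at_eqI[OF manifold_G])
      (use C'.j_i in \<open>simp add: F\<close>)
  moreover have "h \<one> = \<zero>" using \<phi>(2)[of "\<zero>"] by (simp add: h_def)
  ultimately have h: "restrict h (carrier G) \<in> C1s G A" by (intro C1s_restrict) auto
  have "f (g, k) = d1 G A \<rho> (restrict h (carrier G)) (g, k) \<oplus> f' (g, k)"
    if [simp]: "g \<in> carrier G" "k \<in> carrier G" for g k
  proof -
    have fc [simp]: "f (g, k) \<in> carrier A" "f' (g, k) \<in> carrier A" using cochain2D(1) f f' by auto
    have "(\<zero>, g) \<otimes>\<^bsub>tot ?E\<^esub> (\<zero>, k) = (f (g, k), \<one>) \<otimes>\<^bsub>tot ?E\<^esub> (\<zero>, g \<otimes> k)"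
      by (simp add: crossed_mult_section[OF f]) (simp add: mult_crossed)
    then have "\<phi> (\<zero>, g) \<otimes>\<^bsub>tot ?E'\<^esub> \<phi> (\<zero>, k) = \<phi> (f (g, k), \<one>) \<otimes>\<^bsub>tot ?E'\<^esub> \<phi> (\<zero>, g \<otimes> k)"
      using hom_mult[OF \<phi>_hom, of "(\<zero>, g)" "(\<zero>, k)"]
        hom_mult[OF \<phi>_hom, of "(f (g, k), \<one>)" "(\<zero>, g \<otimes> k)"] by simp
    then have "f (g, k) \<oplus> h (g \<otimes> k) = h g \<oplus> \<rho> g (h k) \<oplus> f' (g, k)"
      by (simp add: \<phi>_s \<phi>(2) mult_crossed cochain2D[OF f'])
    then show ?thesis
      by (subst eq_d1_mult_iff[OF h]) simp_all
  qed
  then show ?thesis unfolding cohomologous_def using h by blast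
qed

text \<open>The equivalence is (a, g) |-> (a + h(g), g). Its value at (0, g) is the product of
  (h(g), 1) and (0, g) in the second group, smooth near 1 because h is and because M' is normalised;
  that is all \<open>ext_hom_smooth\<close> asks for.\<close>

lemma cohomologous_imp_ext_equiv_crossed:
  assumes f: "f \<in> C2s G A" and f': "f' \<in> C2s G A"
    and M: "crossed_structure G A \<rho> f M" and M': "crossed_structure G A \<rho> f' M'"
    and eq: "cohomologous f f'"
  shows "ext_equiv A (crossed f M) (crossed f' M')"
proof -
  let ?E = "crossed f M" and ?E' = "crossed f' M'"
  interpret C: module_ext G A \<rho> ?E by (rule module_ext_crossed[OF M])
  interpret C': module_ext G A \<rho> ?E' by (rule module_ext_crossed[OF M'])
  obtain h where h: "h \<in> C1s G A" and fh: "\<And>g k. g \<in> carrier G \<Longrightarrow> k \<in> carrier G \<Longrightarrow>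
      f (g, k) = d1 G A \<rho> h (g, k) \<oplus> f' (g, k)"
    using eq unfolding cohomologous_def by blast
  have hc [simp]: "h g \<in> carrier A" if "g \<in> carrier G" for g using that h by (simp add: C1s_closed)
  have h1: "h \<one> = \<zero>" and h_smooth: "smooth_at MG MA \<one> h"
    using h by (auto simp: C1s_iff)
  define \<phi> where "\<phi> x = (fst x \<oplus> h (snd x), snd x)" for x
  note MC' = C'.manifold_T[unfolded mfd_crossed]
  have \<phi>_hom: "\<phi> \<in> hom (tot ?E) (tot ?E')"
  proof (rule homI)
    fix x y assume "x \<in> carrier (tot ?E)" "y \<in> carrier (tot ?E)"
    then obtain a g b k where xy: "x = (a, g)" "y = (b, k)" and [simp]: "a \<in> carrier A" "b \<in> carrier A"
      "g \<in> carrier G" "k \<in> carrier G" by auto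
    have fc [simp]: "f (g, k) \<in> carrier A" "f' (g, k) \<in> carrier A" using cochain2D(1) f f' by auto
    have "f (g, k) \<oplus> h (g \<otimes> k) = h g \<oplus> \<rho> g (h k) \<oplus> f' (g, k)"
      using fh[of g k] eq_d1_mult_iff[OF h fc] by simp
    then have "a \<oplus> \<rho> g b \<oplus> (f (g, k) \<oplus> h (g \<otimes> k)) =
        a \<oplus> \<rho> g b \<oplus> (h g \<oplus> \<rho> g (h k) \<oplus> f' (g, k))" by simp
    then have "a \<oplus> \<rho> g b \<oplus> f (g, k) \<oplus> h (g \<otimes> k) =
        a \<oplus> h g \<oplus> \<rho> g (b \<oplus> h k) \<oplus> f' (g, k)"
      by (simp add: \<rho>_mult A.m_ac)
    then show "\<phi> (x \<otimes>\<^bsub>tot ?E\<^esub> y) = \<phi> x \<otimes>\<^bsub>tot ?E'\<^esub> \<phi> y"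
      by (simp add: \<phi>_def xy mult_crossed)
  qed (auto simp: \<phi>_def)
  have "\<phi> \<in> lie_hom (tot ?E) (tot ?E')"
  proof (rule ext_hom_smooth[OF C.module_ext_axioms C'.module_ext_axioms \<phi>_hom,
        where s = "\<lambda>g. (\<zero>, g)"])
    show "\<phi> (inc ?E a) = inc ?E' a" if "a \<in> carrier A" for a
      using that by (simp add: \<phi>_def h1)
    show "smooth_at MG (mfd (tot ?E)) \<one> (\<lambda>g. (\<zero>, g))"
      using crossed_section_smooth[OF M] by simp
    have "smooth_at MG M' \<one> (\<lambda>g. inc ?E' (h g))"
      using C'.smooth_at_i[of "h \<one>"]
      by (intro smooth_at_compose[OF manifold_G manifold_A MC' h_smooth]) simp
    then have "smooth_at MG M' \<one> (\<lambda>g. inc ?E' (h g) \<otimes>\<^bsub>tot ?E'\<^esub> (\<zero>, g))"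
      using smooth_at_mult[OF C'.lie_T manifold_G] crossed_section_smooth[OF M'] by simp
    then have "smooth_at MG M' \<one> (\<lambda>g. \<phi> (\<zero>, g))"
      by (rule smooth_at_eqI[OF manifold_G])
        (simp add: \<phi>_def crossed_mult_section[OF f'])
    then show "smooth_at MG (mfd (tot ?E')) \<one> (\<lambda>g. \<phi> (\<zero>, g))" by simp
  qed simp_all
  then show ?thesis
    unfolding ext_equiv_def by (intro bexI[of _ \<phi>]) (auto simp: \<phi>_def h1)
qed

section \<open>The map from cohomology to classes of extensions\<close>

lemma equiv_ext_rel: "equiv {E. module_extension G A \<rho> E} (ext_rel G A \<rho>)"
proof (rule equivI)
  have ext: "module_ext G A \<rho> E" if "module_extension G A \<rho> E" for E :: "('a, 'u, 'g, 'v) std_ext"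
    using that by (simp add: module_ext_def module_ext_axioms_def lie_module_axioms)
  have lie: "lie_group (tot E)" if "module_extension G A \<rho> E" for E :: "('a, 'u, 'g, 'v) std_ext"
    using module_ext.lie_T[OF ext[OF that]] .
  show "refl_on {E. module_extension G A \<rho> E} (ext_rel G A \<rho>)"
    using ext_equiv_refl by (auto simp: refl_on_def ext_rel_def)
  show "sym (ext_rel G A \<rho>)"
    using ext_equiv_sym[OF ext ext] by (auto simp: sym_def ext_rel_def)
  show "trans (ext_rel G A \<rho>)"
    using ext_equiv_trans[OF lie lie lie] unfolding trans_def ext_rel_def by blast
qed (auto simp: ext_rel_def)

lemma ext_class_eq_iff:
  assumes "module_extension G A \<rho> E" "module_extension G A \<rho> E'"
  shows "ext_class G A \<rho> E = ext_class G A \<rho> E' \<longleftrightarrow> ext_equiv A E E'"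
  using eq_equiv_class_iff[OF equiv_ext_rel, of E E'] assms by (simp add: ext_class_def ext_rel_def)

text \<open>Well-definedness and injectivity of the map on cohomology in one equivalence. The case f
  = f' shows in addition that the class does not depend on the manifold structure M.\<close>

lemma coset_eq_iff_ext_class_eq:
  assumes "f \<in> Z2ss G A \<rho>" "f' \<in> Z2ss G A \<rho>"
    and "crossed_structure G A \<rho> f M" "crossed_structure G A \<rho> f' M'"
  shows "coset f = coset f' \<longleftrightarrow>
    ext_class G A \<rho> (crossed f M) = ext_class G A \<rho> (crossed f' M')"
proof -
  have c: "f \<in> C2s G A" "f' \<in> C2s G A" using assms(1,2) by (auto simp: Z2ss_def Z2s_def)
  show ?thesis
    using ext_class_eq_iff[of "crossed f M" "crossed f' M'"] coset_eq_iff[OF c]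
      ext_equiv_crossed_imp_cohomologous[OF c assms(3,4)]
      cohomologous_imp_ext_equiv_crossed[OF c assms(3,4)] assms(3,4)
    unfolding crossed_structure_def by blast
qed

theorem equivalent_crossed_ext:
  assumes "module_extension G A \<rho> E"
  obtains f M where "f \<in> Z2ss G A \<rho>" "crossed_structure G A \<rho> f M" "ext_equiv A E (crossed f M)"
proof -
  interpret module_ext G A \<rho> E
    by unfold_locales (rule assms)
  show ?thesis by (rule equivalent_crossed[OF that])
qed

theorem H2ss_bij_Ext:
  "\<exists>\<Phi>. bij_betw \<Phi> (carrier (H2ss G A \<rho>)) (Ext G A \<rho>) \<and>
    (\<forall>f\<in>Z2ss G A \<rho>. \<forall>M. crossed_structure G A \<rho> f M \<longrightarrow>
      \<Phi> (B2s G A \<rho> #>\<^bsub>Z2ss_group G A \<rho>\<^esub> f) = ext_class G A \<rho> (crossed f M))"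
proof -
  have coset: "B2s G A \<rho> #>\<^bsub>Z2ss_group G A \<rho>\<^esub> f = coset f" for f
    unfolding Z2ss_group_def by (rule r_coset_cochain_group)
  have H2ss: "carrier (H2ss G A \<rho>) = coset ` Z2ss G A \<rho>"
    unfolding H2ss_def FactGroup_def RCOSETS_def by (auto simp: coset) (auto simp: Z2ss_group_def cochain_group_def)
  \<comment> \<open>\<open>m\<close> chooses a manifold structure for each cocycle and
    \<open>r\<close> a cocycle in each class; by \<open>coset_eq_iff_ext_class_eq\<close> any other
    choices give the same value of the map.\<close>
  obtain m where m: "\<And>f. f \<in> Z2ss G A \<rho> \<Longrightarrow> crossed_structure G A \<rho> f (m f)"
    using crossed_structure_exists by metis
  define r where "r X = (SOME f. f \<in> Z2ss G A \<rho> \<and> coset f = X)" for X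
  have r: "r (coset f) \<in> Z2ss G A \<rho>" "coset (r (coset f)) = coset f" if "f \<in> Z2ss G A \<rho>" for f
    using someI[of "\<lambda>f'. f' \<in> Z2ss G A \<rho> \<and> coset f' = coset f" f] that by (auto simp: r_def)
  define \<Phi> where "\<Phi> X = ext_class G A \<rho> (crossed (r X) (m (r X)))" for X
  have \<Phi>: "\<Phi> (coset f) = ext_class G A \<rho> (crossed f M)"
    if "f \<in> Z2ss G A \<rho>" "crossed_structure G A \<rho> f M" for f M
    using coset_eq_iff_ext_class_eq[OF r(1)[OF that(1)] that(1) m[OF r(1)[OF that(1)]] that(2)]
      r(2)[OF that(1)] by (simp add: \<Phi>_def)
  have "bij_betw \<Phi> (carrier (H2ss G A \<rho>)) (Ext G A \<rho>)"
    unfolding bij_betw_def H2ss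
  proof (intro conjI)
    show "inj_on \<Phi> (coset ` Z2ss G A \<rho>)"
    proof (rule inj_onI)
      fix X Y assume "X \<in> coset ` Z2ss G A \<rho>" "Y \<in> coset ` Z2ss G A \<rho>" and eq: "\<Phi> X = \<Phi> Y"
      then obtain f f' where f: "f \<in> Z2ss G A \<rho>" "X = coset f" "f' \<in> Z2ss G A \<rho>" "Y = coset f'"
        by blast
      then show "X = Y"
        using eq coset_eq_iff_ext_class_eq[OF f(1,3) m[OF f(1)] m[OF f(3)]]
          \<Phi>[OF f(1) m[OF f(1)]] \<Phi>[OF f(3) m[OF f(3)]] by simp
    qed
    show "\<Phi> ` coset ` Z2ss G A \<rho> = Ext G A \<rho>"
    proof (intro equalityI subsetI)
      fix c assume "c \<in> \<Phi> ` coset ` Z2ss G A \<rho>"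
      then obtain f where f: "f \<in> Z2ss G A \<rho>" "c = ext_class G A \<rho> (crossed f (m f))"
        using \<Phi> m by auto
      then show "c \<in> Ext G A \<rho>"
        using m[OF f(1)] unfolding Ext_def ext_class_def crossed_structure_def by (auto intro: quotientI)
    next
      fix c assume "c \<in> Ext G A \<rho>"
      then obtain E where E: "module_extension G A \<rho> E" "c = ext_class G A \<rho> E"
        unfolding Ext_def ext_class_def by (auto elim: quotientE)
      obtain f M where f: "f \<in> Z2ss G A \<rho>" "crossed_structure G A \<rho> f M" "ext_equiv A E (crossed f M)"
        by (rule equivalent_crossed_ext[OF E(1)])
      then have "c = \<Phi> (coset f)"
        using ext_class_eq_iff[OF E(1), of "crossed f M"] \<Phi> E(2)
        by (simp add: crossed_structure_def)
      then show "c \<in> \<Phi> ` coset ` Z2ss G A \<rho>" using f(1) by blast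
    qed
  qed
  then show ?thesis unfolding coset using \<Phi> by blast
qed

end

subsection \<open>Connected groups\<close>

text \<open>Conjugation by (0, g)(0, h) = (f(g, h), g h) is the composite of two conjugations;
  comparing A-components through \<open>conj_crossed\<close> gives the formula, and the terms with
  f(g, h) stem from the A-component of that product. As a function of x, the right-hand side is
  smooth at 1 once f_g and f_h are.\<close>

lemma (in lie_cocycle) conj_defect_mult:
  assumes [simp]: "g \<in> carrier G" "h \<in> carrier G" "x \<in> carrier G"
  shows "conj_defect G A f (g \<otimes> h) x =
    \<rho> g (conj_defect G A f h x) \<oplus> conj_defect G A f g (h \<otimes> x \<otimes> inv h) \<oplus>
      \<rho> (g \<otimes> h \<otimes> x \<otimes> inv (g \<otimes> h)) (f (g, h)) \<oplus> \<ominus> f (g, h)"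
proof -
  interpret K: group "K undefined" by (rule group_crossed)
  let ?K = "K undefined"
  have [simp]: "conj_defect G A f z y \<in> carrier A" if "z \<in> carrier G" "y \<in> carrier G" for z y
    using that by (simp add: conj_defect_def)
  let ?m = "(\<zero>, g) \<otimes>\<^bsub>?K\<^esub> (\<zero>, h)" and ?x = "(\<zero>, x)"
  let ?c = "g \<otimes> h \<otimes> x \<otimes> inv (g \<otimes> h)"
  have m: "?m = (f (g, h), g \<otimes> h)" by (simp add: mult_crossed)
  have mem: "(\<zero>, g) \<in> carrier ?K" "(\<zero>, h) \<in> carrier ?K" "?x \<in> carrier ?K" by simp_all
  have "?m \<otimes>\<^bsub>?K\<^esub> ?x \<otimes>\<^bsub>?K\<^esub> inv\<^bsub>?K\<^esub> ?m =
      (\<zero>, g) \<otimes>\<^bsub>?K\<^esub> ((\<zero>, h) \<otimes>\<^bsub>?K\<^esub> ?x \<otimes>\<^bsub>?K\<^esub> inv\<^bsub>?K\<^esub> (\<zero>, h)) \<otimes>\<^bsub>?K\<^esub> inv\<^bsub>?K\<^esub> (\<zero>, g)"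
    by (simp only: K.inv_mult_group K.m_assoc K.m_closed K.inv_closed mem)
  from arg_cong[OF this, of fst]
  have "f (g, h) \<oplus> conj_defect G A f (g \<otimes> h) x \<oplus> \<ominus> \<rho> ?c (f (g, h)) =
      \<rho> g (conj_defect G A f h x) \<oplus> conj_defect G A f g (h \<otimes> x \<otimes> inv h)"
    unfolding m by (simp add: conj_crossed)
  then have "f (g, h) \<oplus> conj_defect G A f (g \<otimes> h) x =
      \<rho> g (conj_defect G A f h x) \<oplus> conj_defect G A f g (h \<otimes> x \<otimes> inv h) \<oplus> \<rho> ?c (f (g, h))"
    by (subst (asm) diff_eq_iff) simp_all
  then have "conj_defect G A f (g \<otimes> h) x \<oplus> f (g, h) =
      \<rho> g (conj_defect G A f h x) \<oplus> conj_defect G A f g (h \<otimes> x \<otimes> inv h) \<oplus> \<rho> ?c (f (g, h))"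
    by (simp add: A.m_comm)
  then show ?thesis
    by (intro sym[OF iffD2[OF diff_eq_iff]]) simp_all
qed

text \<open>
  The elements with smooth conjugation defect are closed under products and contain an identity
  neighbourhood, hence form an open and closed set.
\<close>

lemma (in lie_cocycle) connected_imp_Z2ss:
  assumes conn: "connected_space (mtop MG)"
  shows "f \<in> Z2ss G A \<rho>"
proof -
  define S where "S = {g \<in> carrier G. smooth_at MG MA \<one> (conj_defect G A f g)}"
  obtain U where U: "mopen MG U" "\<one> \<in> U"
    and fU: "\<And>z g. z \<in> carrier G \<Longrightarrow> g \<in> U \<Longrightarrow> z \<otimes> g \<in> U \<Longrightarrow>
      smooth_at GG MA (z, g) f"
    by (rule small_neighbourhood) blast
  have UG: "U \<subseteq> carrier G" using openin_subset[OF U(1)] by simp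
  have c_smooth: "smooth_at MG MG \<one> (\<lambda>x. g \<otimes> x \<otimes> inv g)" if "g \<in> carrier G" for g
    using that by (intro smooth_G manifold_G ) auto
  have US: "U \<subseteq> S"
  proof
    fix g assume g: "g \<in> U"
    then have gG: "g \<in> carrier G" using UG by blast
    \<comment> \<open>At x = 1 the arguments of f are (g, 1) and (1, g), and f is smooth at both by
      the choice of U, since g and 1 lie in U.\<close>
    have "smooth_at MG MA \<one>
        (\<lambda>x. f (g, x) \<oplus> \<ominus> f (g \<otimes> x \<otimes> inv g, g))"
      using fU[of g "\<one>"] fU[of "\<one>" g] g gG U(2)
      by (intro smooth_A manifold_G smooth_at_f[OF manifold_G] c_smooth smooth_G ) auto
    then have "smooth_at MG MA \<one> (conj_defect G A f g)"
      by (rule smooth_at_eqI[OF manifold_G]) (simp add: conj_defect_def)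
    then show "g \<in> S" using gG by (simp add: S_def)
  qed
  have S_mult: "g \<otimes> h \<in> S" if "g \<in> S" "h \<in> S" for g h
  proof -
    have gh: "g \<in> carrier G" "h \<in> carrier G"
      "smooth_at MG MA \<one> (conj_defect G A f g)"
      "smooth_at MG MA \<one> (conj_defect G A f h)" using that by (auto simp: S_def)
    have 1: "smooth_at MG MA \<one> (\<lambda>x. conj_defect G A f g (h \<otimes> x \<otimes> inv h))"
      by (rule smooth_at_compose[OF manifold_G manifold_G manifold_A c_smooth]) (use gh in simp_all)
    have "smooth_at MG MA \<one> (\<lambda>x.
        \<rho> g (conj_defect G A f h x) \<oplus> conj_defect G A f g (h \<otimes> x \<otimes> inv h) \<oplus>
        \<rho> (g \<otimes> h \<otimes> x \<otimes> inv (g \<otimes> h)) (f (g, h)) \<oplus> \<ominus> f (g, h))"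
      using gh by (intro smooth_A manifold_G 1 c_smooth smooth_G) auto
    then have "smooth_at MG MA \<one> (conj_defect G A f (g \<otimes> h))"
      by (rule smooth_at_eqI[OF manifold_G])
        (simp add: conj_defect_mult[OF gh(1,2)])
    then show ?thesis using gh by (simp add: S_def)
  qed
  have SG: "S \<subseteq> carrier G" by (auto simp: S_def)
  have "mopen MG S"
  proof (subst openin_subopen, intro ballI)
    fix g assume g: "g \<in> S"
    then have gG: "g \<in> carrier G" using SG by blast
    \<comment> \<open>A neighbourhood of g inside g U consists of products of g with elements of
      S.\<close>
    have "smooth_at MG MG g (\<lambda>x. inv g \<otimes> x)"
      using gG by (intro smooth_G manifold_G ) auto
    then obtain T where T: "mopen MG T" "g \<in> T" "(\<lambda>x. inv g \<otimes> x) ` T \<subseteq> U"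
      by (rule smooth_at_continuous[OF manifold_G manifold_G _ U(1)]) (use gG U(2) in simp)
    have "x \<in> S" if "x \<in> T" for x
    proof -
      have "x \<in> carrier G" using that openin_subset[OF T(1)] by auto
      then have "x = g \<otimes> (inv g \<otimes> x)" using gG by (simp flip: G.m_assoc)
      moreover have "inv g \<otimes> x \<in> S" using T(3) US that by blast
      ultimately show ?thesis using S_mult[OF g] by metis
    qed
    then show "\<exists>T. mopen MG T \<and> g \<in> T \<and> T \<subseteq> S" using T by blast
  qed
  moreover have "mopen MG (carrier G - S)"
  proof (subst openin_subopen, intro ballI)
    fix g assume g: "g \<in> carrier G - S"
    then have gG: "g \<in> carrier G" by blast
    \<comment> \<open>S is known to be closed under products but not under inverses, so the
      neighbourhood is given by x^-1 g in U: if x were in S, so would be g = x (x^-1 g).\<close>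
    have "smooth_at MG MG g (\<lambda>x. inv x \<otimes> g)"
      using gG by (intro smooth_G manifold_G ) auto
    then obtain T where T: "mopen MG T" "g \<in> T" "(\<lambda>x. inv x \<otimes> g) ` T \<subseteq> U"
      by (rule smooth_at_continuous[OF manifold_G manifold_G _ U(1)]) (use gG U(2) in simp)
    have TG: "T \<subseteq> carrier G" using openin_subset[OF T(1)] by simp
    have "x \<notin> S" if "x \<in> T" for x
    proof
      assume x: "x \<in> S"
      have "g = x \<otimes> (inv x \<otimes> g)" using gG x SG by (auto simp flip: G.m_assoc)
      moreover have "inv x \<otimes> g \<in> S" using T(3) US that by blast
      ultimately have "g \<in> S" using S_mult[OF x] by metis
      then show False using g by blast
    qed
    then show "\<exists>T. mopen MG T \<and> g \<in> T \<and> T \<subseteq> carrier G - S" using T TG by blast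
  qed
  ultimately have "S = {} \<or> S = carrier G"
    using conn SG unfolding connected_space_clopen_in closedin_def by simp
  then have S: "S = carrier G" using US U(2) by blast
  have "conj_defect G A f g \<in> C1s G A" if g: "g \<in> carrier G" for g
    unfolding C1s_iff using g S by (auto simp: S_def conj_defect_def)
  then show ?thesis using f_Z2s by (simp add: Z2ss_def)
qed

lemma (in lie_module) connected_imp_Z2ss_eq_Z2s:
  assumes "connected_space (mtop MG)"
  shows "Z2ss G A \<rho> = Z2s G A \<rho>"
proof
  show "Z2s G A \<rho> \<subseteq> Z2ss G A \<rho>"
  proof
    fix f assume "f \<in> Z2s G A \<rho>"
    then interpret lie_cocycle G A \<rho> f by unfold_locales
    show "f \<in> Z2ss G A \<rho>" by (rule connected_imp_Z2ss[OF assms])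
  qed
qed (auto simp: Z2ss_def)

theorem mainTheorem1:
  fixes G :: "('g, 'v::lcs) lie_group"
    and A :: "('a, 'u::lcs) lie_group"
    and \<rho> :: "'g \<Rightarrow> 'a \<Rightarrow> 'a"
  assumes "lie_group G" and "smooth_module G A \<rho>"
  shows "(\<forall>f \<in> Z2ss G A \<rho>. \<exists>M. crossed_structure G A \<rho> f M) \<and>
    (\<forall>E :: ('a, 'g, 'e, 'w::lcs) lie_ext. module_extension G A \<rho> E \<longrightarrow>
      (\<exists>f \<in> Z2ss G A \<rho>. \<exists>M. crossed_structure G A \<rho> f M \<and>
        ext_equiv A E (crossed_ext G A \<rho> f M))) \<and>
    (\<exists>\<Phi>. bij_betw \<Phi> (carrier (H2ss G A \<rho>)) (Ext G A \<rho>) \<and>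
      (\<forall>f \<in> Z2ss G A \<rho>. \<forall>M. crossed_structure G A \<rho> f M \<longrightarrow>
        \<Phi> (B2s G A \<rho> #>\<^bsub>Z2ss_group G A \<rho>\<^esub> f) = ext_class G A \<rho> (crossed_ext G A \<rho> f M))) \<and>
    (connected_space (mtop (mfd G)) \<longrightarrow> Z2ss G A \<rho> = Z2s G A \<rho> \<and>
      (\<exists>\<Phi>. bij_betw \<Phi> (carrier (H2s G A \<rho>)) (Ext G A \<rho>) \<and>
        (\<forall>f \<in> Z2s G A \<rho>. \<forall>M. crossed_structure G A \<rho> f M \<longrightarrow>
          \<Phi> (B2s G A \<rho> #>\<^bsub>Z2s_group G A \<rho>\<^esub> f) = ext_class G A \<rho> (crossed_ext G A \<rho> f M))))"
proof -
  interpret lie_module G A \<rho>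
    by unfold_locales (rule assms)+
  \<comment> \<open>Both quotients are by the same coboundaries, so equality of the cocycle sets
    makes the cohomology groups literally equal, and the statement for connected G is the general
    one rewritten.\<close>
  have eq: "H2ss G A \<rho> = H2s G A \<rho>" "Z2ss_group G A \<rho> = Z2s_group G A \<rho>"
    if "Z2ss G A \<rho> = Z2s G A \<rho>"
    using that by (simp_all add: H2ss_def H2s_def Z2ss_group_def Z2s_group_def)
  have ext: "\<exists>f\<in>Z2ss G A \<rho>. \<exists>M. crossed_structure G A \<rho> f M \<and> ext_equiv A E (crossed_ext G A \<rho> f M)"
    if "module_extension G A \<rho> E" for E :: "('a, 'g, 'e, 'w) lie_ext"
    using equivalent_crossed_ext[OF that] by metis
  show ?thesis
  proof (cases "connected_space (mtop (mfd G))")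
    case True
    note ss = connected_imp_Z2ss_eq_Z2s[OF True]
    show ?thesis
      unfolding ss[symmetric] eq[OF ss, symmetric]
      by (intro conjI impI ballI allI refl crossed_structure_exists ext H2ss_bij_Ext)
  next
    case False
    then show ?thesis
      by (intro conjI ballI allI impI crossed_structure_exists ext H2ss_bij_Ext) simp_all
  qed
qed

end
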